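(* Assume the Triangle Detection Conjecture. Then for a graph $H$, there is an algorithm computing $\hom(H,G)$ in time $O(|V(G)|+|E(G)|)$ for every input graph $G$ if and only if $H$ is a forest.
   Context: $\hom(H,G)$ is the number of homomorphisms from $H$ to $G$. Algorithms are (randomized) in the word RAM model with $O(\log n)$-bit words, with running time measured in expectation; the implicit constant may depend on $H$. Input graphs $G$ are arbitrary (not necessarily of bounded degeneracy). Triangle Detection Conjecture: there exists $\gamma>0$ such that in the word RAM model of $O(\log n)$ bits, any algorithm deciding whether an input graph with $n$ vertices and $m$ edges is triangle-free requires $\Omega(m^{1+\gamma})$ expected time. *)

theory Defs
  imports "HOL-Probability.Probability" "HOL-Library.Log_Nat"
begin

section \<open>Graphs\<close>

definition simple_graph :: "'a set \<Rightarrow> 'a set set \<Rightarrow> bool" where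
  "simple_graph V E \<longleftrightarrow> finite V \<and> (\<forall>e\<in>E. e \<subseteq> V \<and> card e = 2)"

text \<open>In a simple graph all members of \<open>E'\<close> have two elements, so \<open>f ` e \<in> E'\<close> forces \<open>f\<close> to
  separate the endpoints of \<open>e\<close>. Maps are extensional outside \<open>V\<close>, so that counting them is
  counting functions with domain \<open>V\<close>.\<close>

definition graph_homs :: "'a set \<Rightarrow> 'a set set \<Rightarrow> 'b set \<Rightarrow> 'b set set \<Rightarrow> ('a \<Rightarrow> 'b) set" where
  "graph_homs V E V' E' = {f \<in> V \<rightarrow>\<^sub>E V'. \<forall>e\<in>E. f ` e \<in> E'}"

definition hom_count :: "'a set \<Rightarrow> 'a set set \<Rightarrow> 'b set \<Rightarrow> 'b set set \<Rightarrow> nat" where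
  "hom_count V E V' E' = card (graph_homs V E V' E')"

definition is_cycle :: "'a set set \<Rightarrow> 'a list \<Rightarrow> bool" where
  "is_cycle E vs \<longleftrightarrow> length vs \<ge> 3 \<and> distinct vs \<and>
     (\<forall>i<length vs. {vs ! i, vs ! (Suc i mod length vs)} \<in> E)"

definition forest :: "'a set \<Rightarrow> 'a set set \<Rightarrow> bool" where
  "forest V E \<longleftrightarrow> simple_graph V E \<and> (\<nexists>vs. is_cycle E vs)"

definition triangle_free :: "'a set set \<Rightarrow> bool" where
  "triangle_free E \<longleftrightarrow> \<not> (\<exists>x y z. x \<noteq> y \<and> y \<noteq> z \<and> x \<noteq> z \<and> {x, y} \<in> E \<and> {y, z} \<in> E \<and> {x, z} \<in> E)"


section \<open>The randomized word RAM\<close>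

text \<open>
  The machine has registers and a random access memory, both holding \<open>w\<close>-bit words, represented as
  natural numbers below \<open>2 ^ w\<close>. Every instruction costs one time unit; all arithmetic is modulo
  \<open>2 ^ w\<close>. A program is a list of instructions, and the machine halts when the program counter
  leaves this list. \<open>Rand\<close> fetches the next word of an infinite tape of independent uniformly
  distributed words.
\<close>

unbundle bit_operations_syntax

datatype binop = Add | Sub | Mul | Div | Mod | And | Or | Xor | Shl | Shr | Less | Eq

fun binop_val :: "nat \<Rightarrow> binop \<Rightarrow> nat \<Rightarrow> nat \<Rightarrow> nat" where
  "binop_val w Add x y = take_bit w (x + y)"
| "binop_val w Sub x y = take_bit w (x + 2 ^ w - y)"
| "binop_val w Mul x y = take_bit w (x * y)"
| "binop_val w Div x y = take_bit w (x div y)"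
| "binop_val w Mod x y = take_bit w (x mod y)"
| "binop_val w And x y = take_bit w (x AND y)"
| "binop_val w Or  x y = take_bit w (x OR y)"
| "binop_val w Xor x y = take_bit w (x XOR y)"
| "binop_val w Shl x y = take_bit w (push_bit y x)"
| "binop_val w Shr x y = take_bit w (drop_bit y x)"
| "binop_val w Less x y = take_bit w (of_bool (x < y))"
| "binop_val w Eq x y = take_bit w (of_bool (x = y))"

datatype instr =
    Const nat nat            (* Const r k:     r := k *)
  | Bin binop nat nat nat    (* Bin b r s t:   r := s b t *)
  | Load nat nat             (* Load r s:      r := mem[s] *)
  | Store nat nat            (* Store r s:     mem[r] := s *)
  | Rand nat                 (* Rand r:        r := random word *)
  | Jump nat                 (* Jump l:        go to instruction l *)
  | JumpIf nat nat           (* JumpIf r l:    go to instruction l if r is nonzero *)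

type_synonym program = "instr list"

record config =
  pc :: nat
  regs :: "nat \<Rightarrow> nat"
  mem :: "nat \<Rightarrow> nat"
  tape :: "nat stream"

definition set_reg :: "nat \<Rightarrow> nat \<Rightarrow> config \<Rightarrow> config" where
  "set_reg r x s = s\<lparr>pc := Suc (pc s), regs := (regs s)(r := x)\<rparr>"

fun exec :: "nat \<Rightarrow> instr \<Rightarrow> config \<Rightarrow> config" where
  "exec w (Const r k) s = set_reg r (take_bit w k) s"
| "exec w (Bin b r i j) s = set_reg r (binop_val w b (regs s i) (regs s j)) s"
| "exec w (Load r i) s = set_reg r (mem s (regs s i)) s"
| "exec w (Store r i) s = s\<lparr>pc := Suc (pc s), mem := (mem s)(regs s r := regs s i)\<rparr>"
| "exec w (Rand r) s = set_reg r (take_bit w (shd (tape s))) (s\<lparr>tape := stl (tape s)\<rparr>)"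
| "exec w (Jump l) s = s\<lparr>pc := l\<rparr>"
| "exec w (JumpIf r l) s = s\<lparr>pc := (if regs s r \<noteq> 0 then l else Suc (pc s))\<rparr>"

definition halted :: "program \<Rightarrow> config \<Rightarrow> bool" where
  "halted P s \<longleftrightarrow> length P \<le> pc s"

definition step :: "nat \<Rightarrow> program \<Rightarrow> config \<Rightarrow> config" where
  "step w P s = (if halted P s then s else exec w (P ! pc s) s)"

definition running_time :: "nat \<Rightarrow> program \<Rightarrow> config \<Rightarrow> enat" where
  "running_time w P s = (INF t \<in> {t. halted P ((step w P ^^ t) s)}. enat t)"

text \<open>The output of a halting computation is the final content of register 0.\<close>

definition halts_with :: "nat \<Rightarrow> program \<Rightarrow> config \<Rightarrow> nat \<Rightarrow> bool" where
  "halts_with w P s x \<longleftrightarrow>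
     (\<exists>t. halted P ((step w P ^^ t) s) \<and> regs ((step w P ^^ t) s) 0 = x)"

definition random_tape :: "nat \<Rightarrow> nat stream measure" where
  "random_tape w = stream_space (measure_pmf (pmf_of_set {..<2 ^ w}))"


section \<open>Algorithms on graphs\<close>

text \<open>An input graph has vertex set \<open>{..<n}\<close> and is given by \<open>n\<close> together with a list of its
  edges, each edge occurring exactly once, in arbitrary order and orientation.\<close>

definition encodes :: "nat \<Rightarrow> (nat \<times> nat) list \<Rightarrow> nat set set \<Rightarrow> bool" where
  "encodes n es E \<longleftrightarrow> simple_graph {..<n} E \<and>
     distinct (map (\<lambda>(u, v). {u, v}) es) \<and> set (map (\<lambda>(u, v). {u, v}) es) = E"

definition input_words :: "nat \<Rightarrow> (nat \<times> nat) list \<Rightarrow> nat list" where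
  "input_words n es = n # length es # concat (map (\<lambda>(u, v). [u, v]) es)"

text \<open>\<open>floorlog 2 (n + 1)\<close> is the bit length of \<open>n + 1\<close>. The constant \<open>c\<close> hidden in
  ``words of \<open>O(log n)\<close> bits'' belongs to the algorithm, which is thus a pair of \<open>c\<close> and a program.\<close>

definition word_size :: "nat \<Rightarrow> nat \<Rightarrow> nat" where
  "word_size c n = c * floorlog 2 (n + 1)"

definition init_config :: "nat \<Rightarrow> nat \<Rightarrow> (nat \<times> nat) list \<Rightarrow> nat stream \<Rightarrow> config" where
  "init_config w n es \<omega> =
     \<lparr>pc = 0, regs = (\<lambda>_. 0),
      mem = (\<lambda>i. if i < length (input_words n es) then take_bit w (input_words n es ! i) else 0),
      tape = \<omega>\<rparr>"

definition expected_time :: "nat \<Rightarrow> program \<Rightarrow> nat \<Rightarrow> (nat \<times> nat) list \<Rightarrow> ennreal" where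
  "expected_time c P n es = (let w = word_size c n in
     \<integral>\<^sup>+\<omega>. ennreal_of_enat (running_time w P (init_config w n es \<omega>)) \<partial>random_tape w)"

text \<open>Algorithms are Las Vegas algorithms: randomness affects the running time, whereas the output
  is correct with probability 1. The function to be computed takes the number of vertices and the
  edge set of the input graph.\<close>

definition computes :: "nat \<Rightarrow> program \<Rightarrow> (nat \<Rightarrow> nat set set \<Rightarrow> nat) \<Rightarrow> bool" where
  "computes c P f \<longleftrightarrow> (\<forall>n es E. encodes n es E \<longrightarrow> (let w = word_size c n in
     AE \<omega> in random_tape w. halts_with w P (init_config w n es \<omega>) (f n E)))"

definition linear_time :: "nat \<Rightarrow> program \<Rightarrow> bool" where
  "linear_time c P \<longleftrightarrow> (\<exists>C::real. \<forall>n es E. encodes n es E \<longrightarrow> n > 0 \<longrightarrow>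
     expected_time c P n es \<le> ennreal (C * real (n + card E)))"

definition worst_case_time :: "nat \<Rightarrow> program \<Rightarrow> nat \<Rightarrow> ennreal" where
  "worst_case_time c P m =
     (SUP (n, es) \<in> {(n, es). \<exists>E. encodes n es E \<and> card E = m}. expected_time c P n es)"

definition triangle_detection_conjecture :: bool where
  "triangle_detection_conjecture \<longleftrightarrow> (\<exists>\<gamma>::real. \<gamma> > 0 \<and> (\<forall>c P.
     computes c P (\<lambda>n E. of_bool (triangle_free E)) \<longrightarrow>
     (\<exists>C::real. C > 0 \<and>
       (\<forall>\<^sub>F m in sequentially. ennreal (C * real m powr (1 + \<gamma>)) \<le> worst_case_time c P m))))"

end

theory Submission
  imports Defs
begin

text \<open>
  If \<open>H\<close> is a forest, its homomorphisms are counted by eliminating leaves: for a leaf \<open>v\<close> with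
  neighbour \<open>p\<close>, the weight vector of \<open>p\<close> is multiplied by the adjacency matrix of \<open>G\<close> applied to
  the weight vector of \<open>v\<close>. Counts are below \<open>2 ^ w\<close>, so all arithmetic may be done modulo \<open>2 ^ w\<close>.

  If \<open>H\<close> contains a cycle through an edge \<open>{a, b}\<close>, a linear-time algorithm for \<open>hom(H, \<cdot>)\<close>
  detects triangles in linear time. Replace every vertex of \<open>H\<close> by a copy of \<open>V(G)\<close>, the edges of
  \<open>H\<close> that meet \<open>{a, b}\<close> by the adjacency relation of \<open>G\<close>, and all other edges of \<open>H\<close> by perfect
  matchings. Along the cycle a colour-preserving homomorphism from \<open>H\<close> then picks the vertices of a
  triangle of \<open>G\<close>, one for \<open>a\<close>, one for \<open>b\<close> and one for the rest of the cycle. Homomorphisms that use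
  all edge colours exist iff colour-preserving ones do, and they are counted by inclusion-exclusion
  over the subsets \<open>T\<close> of \<open>E(H)\<close> from the numbers \<open>hom(H, G\<^sub>T)\<close>, where \<open>G\<^sub>T\<close> only retains the
  edges with colours in \<open>T\<close>.
\<close>

section \<open>Expected cost of a randomized word RAM\<close>

text \<open>The obstacle in the hard direction is that the hypothetical algorithm for H comes with
  its own word size, fixed by the size of the gadget, whereas the triangle detector has a single
  word size fixed by G. The detector therefore simulates the given program with shorter words, and
  the cost calculus must bound the random time of an embedded program. The time bound has to be
  linear in the number of edges, uniformly in the number of vertices, and the memory of a simulated
  machine has polynomially many cells. Nothing of either size may be scanned or cleared. Hence
  vertices are relabelled through the edge list, and the word size is chosen large enough to give
  each of the constantly many calls a fresh region. Adjacency is imposed on all edges meeting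
  \<open>a\<close> or \<open>b\<close> so that a triangle always yields a homomorphism, with every
  other vertex of H placed at the third corner; the cycle is what forces the converse. The
  alternating sum is only known modulo \<open>2 ^ w\<close>, but it equals a nonnegative count below
  \<open>2 ^ w\<close>, so testing it for zero is exact.\<close>

type_synonym core = "nat \<times> (nat \<Rightarrow> nat) \<times> (nat \<Rightarrow> nat)"

definition config_of :: "core \<Rightarrow> nat stream \<Rightarrow> config" where
  "config_of a \<omega> = \<lparr>pc = fst a, regs = fst (snd a), mem = snd (snd a), tape = \<omega>\<rparr>"

definition core_of :: "config \<Rightarrow> core" where
  "core_of s = (pc s, regs s, mem s)"

text \<open>\<open>x\<close> is the word that a \<open>Rand\<close> instruction fetches.\<close>

definition cexec :: "nat \<Rightarrow> nat \<Rightarrow> instr \<Rightarrow> core \<Rightarrow> core" where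
  "cexec w x I a = core_of (exec w I (config_of a (sconst x)))"

definition chalted :: "program \<Rightarrow> core \<Rightarrow> bool" where
  "chalted B a \<longleftrightarrow> length B \<le> fst a"

definition cstep :: "nat \<Rightarrow> program \<Rightarrow> nat \<Rightarrow> core \<Rightarrow> core" where
  "cstep w B x a = (if chalted B a then a else cexec w x (B ! fst a) a)"

lemma cexec_simps [simp]:
  "cexec w x (Const r k) (p, R, M) = (Suc p, R(r := take_bit w k), M)"
  "cexec w x (Bin b r i j) (p, R, M) = (Suc p, R(r := binop_val w b (R i) (R j)), M)"
  "cexec w x (Load r i) (p, R, M) = (Suc p, R(r := M (R i)), M)"
  "cexec w x (Store r i) (p, R, M) = (Suc p, R, M(R r := R i))"
  "cexec w x (Rand r) (p, R, M) = (Suc p, R(r := take_bit w x), M)"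
  "cexec w x (Jump l) (p, R, M) = (l, R, M)"
  "cexec w x (JumpIf r l) (p, R, M) = (if R r \<noteq> 0 then l else Suc p, R, M)"
  by (simp_all add: cexec_def core_of_def config_of_def set_reg_def)

lemma core_of_config_of [simp]: "core_of (config_of a \<omega>) = a"
  by (simp add: core_of_def config_of_def)

lemma halted_config_of [simp]: "halted B (config_of a \<omega>) = chalted B a"
  by (simp add: halted_def config_of_def chalted_def)

definition draws :: "program \<Rightarrow> core \<Rightarrow> bool" where
  "draws B a \<longleftrightarrow> \<not> chalted B a \<and> (\<exists>r. B ! fst a = Rand r)"

text \<open>The tape influences a step only through its head, which is consumed exactly at a
  \<open>Rand\<close> instruction. This separates the core from the tape and justifies a recursion
  on cores alone.\<close>

lemma step_config_of:
  "step w B (config_of a \<omega>) =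
     config_of (cstep w B (shd \<omega>) a) (if draws B a then stl \<omega> else \<omega>)"
  by (cases "B ! fst a")
    (auto simp: step_def cstep_def cexec_def draws_def config_of_def core_of_def set_reg_def
       halted_def chalted_def)

lemma cstep_not_draws: "\<not> draws B a \<Longrightarrow> cstep w B x a = cstep w B y a"
  by (cases "B ! fst a")
    (auto simp: cstep_def cexec_def draws_def config_of_def core_of_def set_reg_def)

abbreviation word_pmf :: "nat \<Rightarrow> nat pmf" where
  "word_pmf w \<equiv> pmf_of_set {..<2 ^ w}"

lemma lessThan_power2 [simp]: "{..<(2::nat) ^ w} \<noteq> {}"
  by (auto simp: lessThan_empty_iff)

lemma set_word_pmf [simp]: "set_pmf (word_pmf w) = {..<2 ^ w}"
  by (rule set_pmf_of_set) auto

text \<open>\<open>ert w B g t a\<close> is the expected time until halting or \<open>t\<close> steps, plus a terminal cost \<open>g\<close> of the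
  final core. If wrong outputs cost \<open>\<top>\<close>, finiteness of the supremum over \<open>t\<close> encodes almost sure
  termination with the right output, so that a single quantity accounts for time and correctness.
  As it is defined by recursion on cores, running programs one after the other requires no strong
  Markov property of the tape.\<close>

primrec ert :: "nat \<Rightarrow> program \<Rightarrow> (core \<Rightarrow> ennreal) \<Rightarrow> nat \<Rightarrow> core \<Rightarrow> ennreal" where
  "ert w B g 0 a = (if chalted B a then g a else 0)"
| "ert w B g (Suc t) a = (if chalted B a then g a
     else 1 + (\<integral>\<^sup>+x. ert w B g t (cstep w B x a) \<partial>measure_pmf (word_pmf w)))"

definition ERT :: "nat \<Rightarrow> program \<Rightarrow> (core \<Rightarrow> ennreal) \<Rightarrow> core \<Rightarrow> ennreal" where
  "ERT w B g a = (SUP t. ert w B g t a)"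

lemma ert_halted: "chalted B a \<Longrightarrow> ert w B g t a = g a"
  by (cases t) auto

text \<open>A run that is cut off before halting is charged no terminal cost, so a later cut-off can
  only increase the cost.\<close>

lemma ert_mono: "ert w B g t a \<le> ert w B g (Suc t) a"
proof (induction t arbitrary: a)
  case 0
  show ?case by simp
next
  case (Suc t)
  show ?case
    unfolding ert.simps(2)[of w B g "Suc t" a] ert.simps(2)[of w B g t a]
    by (auto intro!: add_left_mono nn_integral_mono Suc simp del: ert.simps)
qed

lemma ERT_halted: "chalted B a \<Longrightarrow> ERT w B g a = g a"
  by (simp add: ERT_def ert_halted)

lemma ert_le_ERT: "ert w B g t a \<le> ERT w B g a"
  unfolding ERT_def by (rule SUP_upper) simp

text \<open>The bound is shown for each truncation separately and then passed to the supremum, so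
  supremum and integral are never exchanged.\<close>

lemma ERT_step:
  assumes "\<not> chalted B a"
  shows "ERT w B g a \<le> 1 + (\<integral>\<^sup>+x. ERT w B g (cstep w B x a) \<partial>measure_pmf (word_pmf w))"
  unfolding ERT_def[of w B g a]
proof (rule SUP_least)
  fix t
  show "ert w B g t a \<le> 1 + (\<integral>\<^sup>+x. ERT w B g (cstep w B x a) \<partial>measure_pmf (word_pmf w))"
  proof (cases t)
    case 0
    with assms show ?thesis by simp
  next
    case (Suc u)
    with assms show ?thesis
      by (auto intro!: add_left_mono nn_integral_mono ert_le_ERT)
  qed
qed

lemma ERT_step_le:
  assumes "\<not> chalted B a" "\<And>x. x < 2 ^ w \<Longrightarrow> ERT w B g (cstep w B x a) \<le> D"
  shows "ERT w B g a \<le> D + 1"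
proof -
  have "(\<integral>\<^sup>+x. ERT w B g (cstep w B x a) \<partial>measure_pmf (word_pmf w)) \<le>
      (\<integral>\<^sup>+x. D \<partial>measure_pmf (word_pmf w))"
    by (rule nn_integral_mono_AE) (auto simp: AE_measure_pmf_iff assms(2))
  also have "\<dots> = D"
    by simp
  finally have "1 + (\<integral>\<^sup>+x. ERT w B g (cstep w B x a) \<partial>measure_pmf (word_pmf w)) \<le> 1 + D"
    by (rule add_left_mono)
  from order_trans[OF ERT_step[OF assms(1)] this] show ?thesis
    by (simp only: add.commute)
qed

section \<open>Pathwise cost over a fixed tape, and its expectation\<close>

primrec tert :: "nat \<Rightarrow> program \<Rightarrow> (core \<Rightarrow> ennreal) \<Rightarrow> nat \<Rightarrow> config \<Rightarrow> ennreal" where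
  "tert w B g 0 s = (if halted B s then g (core_of s) else 0)"
| "tert w B g (Suc t) s = (if halted B s then g (core_of s) else 1 + tert w B g t (step w B s))"

lemma sets_random_tape: "sets (random_tape w) = sets (stream_space (count_space UNIV))"
  unfolding random_tape_def by (rule sets_stream_space_cong) simp

lemma borel_measurable_random_tape:
  "borel_measurable (random_tape w) = borel_measurable (stream_space (count_space UNIV))"
  by (rule measurable_cong_sets) (simp_all add: sets_random_tape)

lemma prob_space_random_tape: "prob_space (random_tape w)"
  unfolding random_tape_def by (intro prob_space.prob_space_stream_space measure_pmf.prob_space_axioms)

lemma measurable_tert:
  "(\<lambda>\<omega>. tert w B g t (config_of a \<omega>)) \<in> borel_measurable (random_tape w)"
  unfolding borel_measurable_random_tape
proof (induction t arbitrary: a)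
  case 0
  show ?case by (cases "chalted B a") simp_all
next
  case (Suc t)
  let ?S = "stream_space (count_space (UNIV :: nat set))"
  \<comment> \<open>The next core depends on the tape only through \<open>shd\<close>, which takes
    countably many values, so measurability may be checked with that value frozen. The function
    \<open>h\<close> will be \<open>stl\<close> or the identity.\<close>
  have *: "(\<lambda>\<omega>. tert w B g t (config_of (cstep w B (shd \<omega>) a) (h \<omega>))) \<in> borel_measurable ?S"
    if h: "h \<in> measurable ?S ?S" for h
  proof (rule measurable_compose_countable[where g = shd and
        f = "\<lambda>x \<omega>. tert w B g t (config_of (cstep w B x a) (h \<omega>))"])
    show "shd \<in> ?S \<rightarrow>\<^sub>M count_space UNIV" by simp
    show "(\<lambda>\<omega>. tert w B g t (config_of (cstep w B x a) (h \<omega>))) \<in> borel_measurable ?S" for x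
      by (rule measurable_compose[OF h Suc])
  qed
  show ?case
    using *[of stl] *[of "\<lambda>\<omega>. \<omega>"]
    by (cases "chalted B a"; cases "draws B a") (simp_all add: step_config_of)
qed

text \<open>A random tape is a uniform word followed by an independent random tape. At a
  \<open>Rand\<close> the outer integral is the one in \<open>ert\<close>; at any other instruction
  the successor ignores the word, and the integrand in \<open>ert\<close> is constant.\<close>

lemma nn_integral_tert:
  "(\<integral>\<^sup>+\<omega>. tert w B g t (config_of a \<omega>) \<partial>random_tape w) = ert w B g t a"
proof (induction t arbitrary: a)
  case 0
  interpret prob_space "random_tape w" by (rule prob_space_random_tape)
  show ?case by (simp add: emeasure_space_1)
next
  case (Suc t)
  interpret prob_space "random_tape w" by (rule prob_space_random_tape)
  have meas: "(\<lambda>\<omega>. tert w B g (Suc t) (config_of a \<omega>)) \<in> borel_measurable (stream_space (word_pmf w))"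
    using measurable_tert[of w B g "Suc t" a] by (simp add: random_tape_def)
  show ?case
  proof (cases "chalted B a")
    case True
    then show ?thesis by (simp add: emeasure_space_1)
  next
    case nh: False
    show ?thesis
    proof (cases "draws B a")
      case True
      have "(\<integral>\<^sup>+\<omega>. tert w B g (Suc t) (config_of a \<omega>) \<partial>random_tape w) =
          (\<integral>\<^sup>+x. \<integral>\<^sup>+\<omega>. tert w B g (Suc t) (config_of a (x ## \<omega>)) \<partial>random_tape w \<partial>word_pmf w)"
        unfolding random_tape_def
        by (rule prob_space.nn_integral_stream_space[OF measure_pmf.prob_space_axioms meas])
      also have "\<dots> = (\<integral>\<^sup>+x. 1 + ert w B g t (cstep w B x a) \<partial>word_pmf w)"
        using True nh by (simp add: step_config_of nn_integral_add measurable_tert Suc emeasure_space_1)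
      also have "\<dots> = ert w B g (Suc t) a"
        using nh by (simp add: nn_integral_add)
      finally show ?thesis .
    next
      case False
      define b where "b = cstep w B 0 a"
      have *: "cstep w B x a = b" for x
        unfolding b_def by (rule cstep_not_draws[OF False])
      have "(\<integral>\<^sup>+\<omega>. tert w B g (Suc t) (config_of a \<omega>) \<partial>random_tape w) =
          1 + ert w B g t b"
        using False nh
        by (simp add: step_config_of * nn_integral_add measurable_tert Suc emeasure_space_1)
      also have "\<dots> = ert w B g (Suc t) a"
        using nh by (simp add: *)
      finally show ?thesis .
    qed
  qed
qed

lemma tert_mono: "tert w B g t s \<le> tert w B g (Suc t) s"
proof (induction t arbitrary: s)
  case (Suc t)
  show ?case
    unfolding tert.simps(2)[of w B g "Suc t" s] tert.simps(2)[of w B g t s]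
    by (auto intro!: add_left_mono Suc simp del: tert.simps)
qed simp

lemma nn_integral_SUP_tert:
  "(\<integral>\<^sup>+\<omega>. (SUP t. tert w B g t (config_of a \<omega>)) \<partial>random_tape w) = ERT w B g a"
proof -
  have "(\<integral>\<^sup>+\<omega>. (SUP t. tert w B g t (config_of a \<omega>)) \<partial>random_tape w) =
      (SUP t. \<integral>\<^sup>+\<omega>. tert w B g t (config_of a \<omega>) \<partial>random_tape w)"
    by (rule nn_integral_monotone_convergence_SUP)
      (auto intro!: measurable_tert incseq_SucI le_funI tert_mono)
  then show ?thesis
    by (simp add: nn_integral_tert ERT_def)
qed

lemma tert_add:
  "(\<forall>i<T. \<not> halted B ((step w B ^^ i) s)) \<Longrightarrow>
     tert w B g (T + u) s = of_nat T + tert w B g u ((step w B ^^ T) s)"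
proof (induction T arbitrary: s)
  case (Suc T)
  have *: "(step w B ^^ Suc i) s = (step w B ^^ i) (step w B s)" for i
    by (simp only: funpow_Suc_right o_apply)
  have "\<forall>i<T. \<not> halted B ((step w B ^^ i) (step w B s))"
    using Suc.prems by (metis * Suc_mono)
  moreover have "\<not> halted B s"
    using Suc.prems by (metis funpow_0 zero_less_Suc)
  ultimately show ?case
    using Suc.IH[of "step w B s"] by (simp only: * add_Suc tert.simps if_False of_nat_Suc add.assoc)
qed simp

lemma halted_first_time:
  assumes "halted B ((step w B ^^ t) s)"
  obtains T where "halted B ((step w B ^^ T) s)" "\<forall>i<T. \<not> halted B ((step w B ^^ i) s)"
    "running_time w B s = enat T"
proof -
  let ?h = "\<lambda>t. halted B ((step w B ^^ t) s)"
  let ?T = "LEAST t. ?h t"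
  have 1: "?h ?T" using assms by (rule LeastI)
  have 2: "\<forall>i<?T. \<not> ?h i" using not_less_Least by blast
  have "running_time w B s = enat ?T"
    unfolding running_time_def
    by (rule antisym) (auto intro!: INF_lower INF_greatest Least_le 1)
  with 1 2 show ?thesis by (rule that)
qed

lemma step_halted: "halted B s \<Longrightarrow> (step w B ^^ t) s = s"
  by (induction t) (auto simp: step_def)

lemma halted_unique:
  assumes "halted B ((step w B ^^ t) s)" "halted B ((step w B ^^ u) s)"
  shows "(step w B ^^ t) s = (step w B ^^ u) s"
proof -
  have *: "(step w B ^^ (i + j)) s = (step w B ^^ i) s" if "halted B ((step w B ^^ i) s)" for i j
    unfolding add.commute[of i] funpow_add o_apply by (rule step_halted[OF that])
  show ?thesis
    using *[OF assms(1), of u] *[OF assms(2), of t] unfolding add.commute[of u] by (rule trans[OF sym])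
qed

lemma SUP_tert_halting:
  assumes "halted B ((step w B ^^ T) s)" "\<forall>i<T. \<not> halted B ((step w B ^^ i) s)"
  shows "(SUP t. tert w B g t s) = of_nat T + g (core_of ((step w B ^^ T) s))"
proof -
  have *: "tert w B g (T + u) s = of_nat T + g (core_of ((step w B ^^ T) s))" for u
    using tert_add[OF assms(2), of g u] assms(1) by (cases u) auto
  have inc: "incseq (\<lambda>t. tert w B g t s)"
    by (rule incseq_SucI) (rule tert_mono)
  show ?thesis
  proof (rule antisym)
    show "(SUP t. tert w B g t s) \<le> of_nat T + g (core_of ((step w B ^^ T) s))"
      using incseqD[OF inc] * by (intro SUP_least) (metis le_add2)
    show "of_nat T + g (core_of ((step w B ^^ T) s)) \<le> (SUP t. tert w B g t s)"
      using *[of 0] by (intro SUP_upper2[of T]) auto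
  qed
qed

lemma SUP_tert_diverging:
  assumes "\<forall>i. \<not> halted B ((step w B ^^ i) s)"
  shows "(SUP t. tert w B g t s) = \<top>"
proof -
  have "of_nat T \<le> (SUP t. tert w B g t s)" for T
    using tert_add[of T B w s g 0] assms by (intro SUP_upper2[of T]) auto
  then show ?thesis
    by (metis ennreal_SUP_of_nat_eq_top SUP_least top_unique)
qed

definition penalty :: "nat \<Rightarrow> core \<Rightarrow> ennreal" where
  "penalty x b = (if fst (snd b) 0 = x then 0 else \<top>)"

lemma running_time_le_SUP_tert:
  "ennreal_of_enat (running_time w B s) \<le> (SUP t. tert w B g t s)"
proof (cases "\<exists>t. halted B ((step w B ^^ t) s)")
  case True
  then obtain T where "halted B ((step w B ^^ T) s)" "\<forall>i<T. \<not> halted B ((step w B ^^ i) s)"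
      "running_time w B s = enat T"
    by (meson halted_first_time)
  then show ?thesis
    by (simp add: SUP_tert_halting)
qed (simp add: SUP_tert_diverging)

lemma SUP_tert_halts_with:
  assumes "halts_with w B s x"
  shows "(SUP t. tert w B (penalty x) t s) = ennreal_of_enat (running_time w B s)"
proof -
  obtain t where t: "halted B ((step w B ^^ t) s)" "regs ((step w B ^^ t) s) 0 = x"
    using assms by (auto simp: halts_with_def)
  obtain T where T: "halted B ((step w B ^^ T) s)" "\<forall>i<T. \<not> halted B ((step w B ^^ i) s)"
      "running_time w B s = enat T"
    by (rule halted_first_time[OF t(1)])
  have "regs ((step w B ^^ T) s) 0 = x"
    using halted_unique[OF t(1) T(1)] t(2) by simp
  then show ?thesis
    using T by (simp add: SUP_tert_halting penalty_def core_of_def)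
qed

text \<open>Divergence would push the cost above every number of steps, and a wrong output would add
  the terminal cost \<top>; finiteness excludes both.\<close>

lemma SUP_tert_finite:
  assumes "(SUP t. tert w B (penalty x) t s) \<noteq> \<top>"
  shows "halts_with w B s x"
proof -
  from assms SUP_tert_diverging obtain t where "halted B ((step w B ^^ t) s)"
    by blast
  then obtain T where T: "halted B ((step w B ^^ T) s)" "\<forall>i<T. \<not> halted B ((step w B ^^ i) s)"
    by (rule halted_first_time)
  with assms show ?thesis
    by (auto simp: SUP_tert_halting penalty_def core_of_def halts_with_def split: if_splits)
qed

definition init_core :: "nat \<Rightarrow> nat \<Rightarrow> (nat \<times> nat) list \<Rightarrow> core" where
  "init_core w n es = (0, (\<lambda>_. 0),
     (\<lambda>i. if i < length (input_words n es) then take_bit w (input_words n es ! i) else 0))"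

lemma init_config_eq: "init_config w n es \<omega> = config_of (init_core w n es) \<omega>"
  by (simp add: init_config_def init_core_def config_of_def)

text \<open>Almost surely the output is right and the penalty vanishes, so cost and running time
  agree almost everywhere. This is how the hypotheses on a given algorithm enter the
  \<open>ERT\<close> calculus.\<close>

lemma ERT_eq_expected_time:
  assumes "computes c P f" "encodes n es E" "w = word_size c n"
  shows "ERT w P (penalty (f n E)) (init_core w n es) = expected_time c P n es"
proof -
  have "AE \<omega> in random_tape w. halts_with w P (config_of (init_core w n es) \<omega>) (f n E)"
    using assms by (auto simp: computes_def init_config_eq Let_def)
  then have "(\<integral>\<^sup>+\<omega>. (SUP t. tert w P (penalty (f n E)) t (config_of (init_core w n es) \<omega>)) \<partial>random_tape w) =
      (\<integral>\<^sup>+\<omega>. ennreal_of_enat (running_time w P (config_of (init_core w n es) \<omega>)) \<partial>random_tape w)"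
    by (intro nn_integral_cong_AE) (auto elim!: eventually_mono simp: SUP_tert_halts_with)
  then show ?thesis
    by (simp add: nn_integral_SUP_tert expected_time_def assms(3) init_config_eq Let_def)
qed

lemma expected_time_le_ERT:
  assumes "w = word_size c n"
  shows "expected_time c P n es \<le> ERT w P g (init_core w n es)"
  unfolding expected_time_def nn_integral_SUP_tert[symmetric] Let_def init_config_eq assms
  by (intro nn_integral_mono running_time_le_SUP_tert)

text \<open>A function with finite integral is finite almost everywhere, and finite penalised cost
  certifies the output. Together with \<open>expected_time_le_ERT\<close>, a single bound on
  \<open>ERT\<close> yields both correctness and speed.\<close>

lemma AE_halts_with_if_ERT_finite:
  assumes "ERT w P (penalty x) a < \<top>"
  shows "AE \<omega> in random_tape w. halts_with w P (config_of a \<omega>) x"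
proof -
  have "AE \<omega> in random_tape w. (SUP t. tert w P (penalty x) t (config_of a \<omega>)) \<noteq> \<infinity>"
    using assms by (intro nn_integral_PInf_AE borel_measurable_SUP measurable_tert)
      (auto simp: nn_integral_SUP_tert)
  then show ?thesis
    unfolding infinity_ennreal_def by eventually_elim (rule SUP_tert_finite)
qed

section \<open>Structured programs\<close>

text \<open>In \<open>Loop i b t C\<close> register \<open>i\<close> is the counter,
  \<open>b\<close> holds the bound and \<open>t\<close> is scratch. Counted loops are enough because
  only \<open>Sim\<close>, an embedded machine program, has a random running time.\<close>

datatype com =
    Block "instr list"
  | Seq com com (infixr ";;" 60)
  | Loop nat nat nat com
  | Sim program nat nat nat nat

text \<open>Registers are shifted by \<open>d\<close>, addresses by the content of register \<open>bs\<close>, and results are cut to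
  the smaller word size with the mask in register \<open>mk\<close>. Every instruction becomes exactly two, so
  that jump targets double; this is why jumps are padded.\<close>

fun sim_instr :: "(nat \<Rightarrow> nat) \<Rightarrow> nat \<Rightarrow> nat \<Rightarrow> nat \<Rightarrow> nat \<Rightarrow> instr \<Rightarrow> instr list" where
  "sim_instr \<tau> d t mk bs (Const r k) = [Const (d + r) k, Bin And (d + r) (d + r) mk]"
| "sim_instr \<tau> d t mk bs (Bin b r i j) = [Bin b (d + r) (d + i) (d + j), Bin And (d + r) (d + r) mk]"
| "sim_instr \<tau> d t mk bs (Load r i) = [Bin Add t (d + i) bs, Load (d + r) t]"
| "sim_instr \<tau> d t mk bs (Store r i) = [Bin Add t (d + r) bs, Store t (d + i)]"
| "sim_instr \<tau> d t mk bs (Rand r) = [Rand (d + r), Bin And (d + r) (d + r) mk]"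
| "sim_instr \<tau> d t mk bs (Jump l) = [Const t 0, Jump (\<tau> l)]"
| "sim_instr \<tau> d t mk bs (JumpIf r l) = [Const t 0, JumpIf (d + r) (\<tau> l)]"

text \<open>The \<open>min\<close> sends every jump that would leave \<open>P\<close>, and hence
  halt it, to the first instruction after the simulation: halting becomes falling through.\<close>

definition sim_target :: "nat \<Rightarrow> program \<Rightarrow> nat \<Rightarrow> nat" where
  "sim_target p P l = p + 2 * min l (length P)"

primrec clen :: "com \<Rightarrow> nat" where
  "clen (Block is) = length is"
| "clen (C ;; C') = clen C + clen C'"
| "clen (Loop i b t C) = 7 + clen C"
| "clen (Sim P d t mk bs) = 2 * length P"

text \<open>Machine jumps are absolute, which is why the code depends on its own address
  \<open>p\<close>.\<close>

primrec compile :: "nat \<Rightarrow> com \<Rightarrow> instr list" where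
  "compile p (Block is) = is"
| "compile p (C ;; C') = compile p C @ compile (p + clen C) C'"
| "compile p (Loop i b t C) =
     [Const i 0, Bin Less t i b, JumpIf t (p + 4), Jump (p + 7 + clen C)] @ compile (p + 4) C @
     [Const t 1, Bin Add i i t, Jump (p + 1)]"
| "compile p (Sim P d t mk bs) = concat (map (sim_instr (sim_target p P) d t mk bs) P)"

lemma length_sim_instr [simp]: "length (sim_instr \<tau> d t mk bs I) = 2"
  by (cases I) auto

lemma length_concat_map_sim [simp]: "length (concat (map (sim_instr \<tau> d t mk bs) P)) = 2 * length P"
  by (induction P) auto

lemma length_compile [simp]: "length (compile p C) = clen C"
  by (induction C arbitrary: p) auto

lemma nth_concat_map_sim:
  assumes "i < length P" "j < 2"
  shows "concat (map (sim_instr \<tau> d t mk bs) P) ! (2 * i + j) = sim_instr \<tau> d t mk bs (P ! i) ! j"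
  using assms
proof (induction P arbitrary: i)
  case (Cons I P)
  then show ?case by (cases i) (auto simp: nth_append)
qed simp

section \<open>Cost triples for structured programs\<close>

definition located :: "program \<Rightarrow> nat \<Rightarrow> instr list \<Rightarrow> bool" where
  "located B p L \<longleftrightarrow> p + length L \<le> length B \<and> (\<forall>i<length L. B ! (p + i) = L ! i)"

lemma located_append: "located B p (L @ L') \<longleftrightarrow> located B p L \<and> located B (p + length L) L'"
proof -
  have "(\<forall>i<length L + length L'. B ! (p + i) = (L @ L') ! i) \<longleftrightarrow>
      (\<forall>i<length L. B ! (p + i) = L ! i) \<and> (\<forall>i<length L'. B ! (p + length L + i) = L' ! i)"
    (is "?l \<longleftrightarrow> ?r")
  proof
    assume l: ?l
    show ?r
    proof (intro conjI allI impI)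
      fix i assume "i < length L"
      then show "B ! (p + i) = L ! i" using l by (auto simp: nth_append dest: spec[of _ i])
    next
      fix i assume "i < length L'"
      then show "B ! (p + length L + i) = L' ! i"
        using l[rule_format, of "length L + i"] by (simp add: nth_append add.assoc)
    qed
  next
    assume r: ?r
    show ?l
    proof (intro allI impI)
      fix i assume i: "i < length L + length L'"
      show "B ! (p + i) = (L @ L') ! i"
      proof (cases "i < length L")
        case False
        with i r show ?thesis
          using conjunct2[OF r, rule_format, of "i - length L"] by (simp add: nth_append)
      qed (use r in \<open>simp add: nth_append\<close>)
    qed
  qed
  then show ?thesis
    by (auto simp: located_def)
qed

lemma located_Cons: "located B p (I # L) \<longleftrightarrow> p < length B \<and> B ! p = I \<and> located B (Suc p) L"
  using located_append[of B p "[I]" L] by (auto simp: located_def)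

fun is_rand :: "instr \<Rightarrow> bool" where
  "is_rand (Rand r) = True"
| "is_rand _ = False"

lemma ERT_exec:
  assumes "p < length B" "B ! p = I" "\<not> is_rand I" "ERT w B g (cexec w 0 I (p, R, M)) \<le> D"
  shows "ERT w B g (p, R, M) \<le> D + 1"
proof (rule ERT_step_le)
  show nh: "\<not> chalted B (p, R, M)" using assms by (simp add: chalted_def)
  fix x :: nat
  have "cexec w x I (p, R, M) = cexec w 0 I (p, R, M)"
    using assms(3) by (cases I) auto
  then show "ERT w B g (cstep w B x (p, R, M)) \<le> D"
    using nh assms by (simp add: cstep_def)
qed

text \<open>Continuation style: \<open>D\<close> bounds the cost of whatever is executed after \<open>C\<close>.\<close>

definition triple ::
  "nat \<Rightarrow> ((nat \<Rightarrow> nat) \<Rightarrow> (nat \<Rightarrow> nat) \<Rightarrow> bool) \<Rightarrow> com \<Rightarrow> nat \<Rightarrow>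
    ((nat \<Rightarrow> nat) \<Rightarrow> (nat \<Rightarrow> nat) \<Rightarrow> bool) \<Rightarrow> bool" where
  "triple w A C k Z \<longleftrightarrow> (\<forall>B p g D R M. located B p (compile p C) \<longrightarrow> A R M \<longrightarrow>
     (\<forall>R' M'. Z R' M' \<longrightarrow> ERT w B g (p + clen C, R', M') \<le> D) \<longrightarrow> ERT w B g (p, R, M) \<le> D + of_nat k)"

lemma tripleD:
  assumes "triple w A C k Z" "located B p (compile p C)" "A R M" "q = p + clen C"
    "\<And>R' M'. Z R' M' \<Longrightarrow> ERT w B g (q, R', M') \<le> D"
  shows "ERT w B g (p, R, M) \<le> D + of_nat k"
  using assms unfolding triple_def by blast

lemma triple_conseq:
  assumes "triple w A C k Z" "\<And>R M. A' R M \<Longrightarrow> A R M" "\<And>R M. Z R M \<Longrightarrow> Z' R M" "k \<le> k'"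
  shows "triple w A' C k' Z'"
  unfolding triple_def
proof (intro allI impI)
  fix B p g D R M
  assume *: "located B p (compile p C)" "A' R M"
    "\<forall>R' M'. Z' R' M' \<longrightarrow> ERT w B g (p + clen C, R', M') \<le> D"
  have "ERT w B g (p, R, M) \<le> D + of_nat k"
    by (rule tripleD[OF assms(1)]) (use * assms in auto)
  also have "\<dots> \<le> D + of_nat k'"
    by (intro add_left_mono of_nat_mono assms(4))
  finally show "ERT w B g (p, R, M) \<le> D + of_nat k'" .
qed

lemma triple_Seq:
  assumes "triple w A C k Y" "triple w Y C' k' Z"
  shows "triple w A (C ;; C') (k + k') Z"
  unfolding triple_def
proof (intro allI impI)
  fix B p g D R M
  assume *: "located B p (compile p (C ;; C'))" "A R M"
    "\<forall>R' M'. Z R' M' \<longrightarrow> ERT w B g (p + clen (C ;; C'), R', M') \<le> D"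
  have "ERT w B g (p, R, M) \<le> D + of_nat k' + of_nat k"
  proof (rule tripleD[OF assms(1)])
    fix R' M' assume Y: "Y R' M'"
    show "ERT w B g (p + clen C, R', M') \<le> D + of_nat k'"
      by (rule tripleD[OF assms(2)]) (use * Y in \<open>auto simp: located_append add.assoc\<close>)
  qed (use * in \<open>auto simp: located_append\<close>)
  then show "ERT w B g (p, R, M) \<le> D + of_nat (k + k')"
    by (simp add: ac_simps)
qed

fun straight :: "instr \<Rightarrow> bool" where
  "straight (Rand r) = False"
| "straight (Jump l) = False"
| "straight (JumpIf r l) = False"
| "straight _ = True"

fun run :: "nat \<Rightarrow> instr list \<Rightarrow> (nat \<Rightarrow> nat) \<Rightarrow> (nat \<Rightarrow> nat) \<Rightarrow> (nat \<Rightarrow> nat) \<times> (nat \<Rightarrow> nat)" where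
  "run w [] R M = (R, M)"
| "run w (Const r k # is) R M = run w is (R(r := take_bit w k)) M"
| "run w (Bin b r i j # is) R M = run w is (R(r := binop_val w b (R i) (R j))) M"
| "run w (Load r i # is) R M = run w is (R(r := M (R i))) M"
| "run w (Store r i # is) R M = run w is R (M(R r := R i))"
| "run w (_ # is) R M = run w is R M"

lemma ERT_run:
  assumes "list_all straight is" "located B p is" "ERT w B g (p + length is, run w is R M) \<le> D"
  shows "ERT w B g (p, R, M) \<le> D + of_nat (length is)"
  using assms
proof (induction "is" arbitrary: p R M)
  case (Cons I "is")
  have "ERT w B g (p, R, M) \<le> D + of_nat (length is) + 1"
  proof (rule ERT_exec)
    show "ERT w B g (cexec w 0 I (p, R, M)) \<le> D + of_nat (length is)"
      using Cons by (cases I) (auto simp: located_Cons)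
  qed (use Cons in \<open>cases I; auto simp: located_Cons\<close>)+
  then show ?case by (simp add: ac_simps)
qed simp

lemma triple_Block:
  assumes "list_all straight is" "\<And>R M. A R M \<Longrightarrow> case_prod Z (run w is R M)"
  shows "triple w A (Block is) (length is) Z"
  unfolding triple_def
proof (intro allI impI)
  fix B p g D R M
  assume *: "located B p (compile p (Block is))" "A R M"
    "\<forall>R' M'. Z R' M' \<longrightarrow> ERT w B g (p + clen (Block is), R', M') \<le> D"
  show "ERT w B g (p, R, M) \<le> D + of_nat (length is)"
    by (rule ERT_run[OF assms(1)]) (use * assms(2)[of R M] in \<open>auto split: prod.splits\<close>)
qed

text \<open>Each round pays 5 for the test, the jump on it, two instructions of increment and the
  jump back; the 4 are the initialisation and the failing test with its exit. Premise
  \<open>inv\<close> is needed because loop control overwrites \<open>i\<close> and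
  \<open>t\<close>, and \<open>n < 2 ^ w\<close> keeps the counter from wrapping around.\<close>

lemma triple_Loop:
  assumes body: "\<And>j. j < n \<Longrightarrow>
      triple w (\<lambda>R M. I j R M \<and> R i = j \<and> R b = n) C k (\<lambda>R M. I (Suc j) R M \<and> R i = j \<and> R b = n)"
    and inv: "\<And>j R M x y. I j R M \<Longrightarrow> I j (R(i := x, t := y)) M"
    and regs: "i \<noteq> b" "i \<noteq> t" "b \<noteq> t" and n: "n < 2 ^ w" and w: "w > 0"
    and pre: "\<And>R M. A R M \<Longrightarrow> I 0 R M \<and> R b = n"
    and post: "\<And>R M. I n R M \<Longrightarrow> R b = n \<Longrightarrow> Z R M"
  shows "triple w A (Loop i b t C) (4 + n * (5 + k)) Z"
proof -
  have inv_i: "I j (R(i := x)) M" and inv_t: "I j (R(t := x)) M" if "I j R M" for j R M x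
    using inv[OF that, of x "R t"] inv[OF that, of "R i" x] regs
    by (simp_all add: fun_upd_idem)
  have "triple w (\<lambda>R M. I 0 R M \<and> R b = n) (Loop i b t C) (4 + n * (5 + k)) (\<lambda>R M. I n R M \<and> R b = n)"
    unfolding triple_def
  proof (intro allI impI)
    fix B p g D R0 M0
    assume loc: "located B p (compile p (Loop i b t C))" and start: "I 0 R0 M0 \<and> R0 b = n"
      and ex: "\<forall>R' M'. I n R' M' \<and> R' b = n \<longrightarrow> ERT w B g (p + clen (Loop i b t C), R', M') \<le> D"
    define L where "L = clen C"
    have code: "p < length B" "B ! p = Const i 0"
      "Suc p < length B" "B ! Suc p = Bin Less t i b"
      "Suc (Suc p) < length B" "B ! Suc (Suc p) = JumpIf t (p + 4)"
      "Suc (Suc (Suc p)) < length B" "B ! Suc (Suc (Suc p)) = Jump (p + 7 + L)"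
      "located B (p + 4) (compile (p + 4) C)"
      "p + 4 + L < length B" "B ! (p + 4 + L) = Const t 1"
      "Suc (p + 4 + L) < length B" "B ! Suc (p + 4 + L) = Bin Add i i t"
      "Suc (Suc (p + 4 + L)) < length B" "B ! Suc (Suc (p + 4 + L)) = Jump (Suc p)"
      using loc by (auto simp: located_append located_Cons L_def eval_nat_numeral)
    \<comment> \<open>Induction on the number \<open>u\<close> of remaining rounds; 3 pays for the
      failing test and the exit.\<close>
    have head: "ERT w B g (Suc p, R, M) \<le> D + 3 + of_nat (u * (5 + k))"
      if "u \<le> n" "I (n - u) R M" "R i = n - u" "R b = n" for u R M
      using that
    proof (induction u arbitrary: R M)
      case 0
      have "ERT w B g (p + 7 + L, R(t := 0), M) \<le> D"
        using ex 0 regs inv_t[of n R M 0] by (auto simp: L_def add_ac)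
      then have 1: "ERT w B g (Suc (Suc (Suc p)), R(t := 0), M) \<le> D + 1"
        by (intro ERT_exec code) (auto simp: code)
      then have 2: "ERT w B g (Suc (Suc p), R(t := 0), M) \<le> D + 1 + 1"
        by (intro ERT_exec[OF code(5,6)]) auto
      then have "ERT w B g (Suc p, R, M) \<le> D + 1 + 1 + 1"
        using 0 by (intro ERT_exec[OF code(3,4)]) auto
      then show ?case by (simp add: add.assoc)
    next
      case (Suc u)
      define j where "j = n - Suc u"
      have j: "j < n" "Suc j = n - u" "j < 2 ^ w" "Suc j < 2 ^ w"
        using Suc.prems n by (auto simp: j_def)
      define E where "E = D + 3 + of_nat (u * (5 + k))"
      have t1: "take_bit w (Suc 0) = 1" "take_bit w 1 = (1::nat)"
        using w by (auto simp: take_bit_nat_eq_self_iff)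
      have after: "ERT w B g (p + 4 + L, R', M') \<le> E + 3"
        if I': "I (Suc j) R' M'" "R' i = j" "R' b = n" for R' M'
      proof -
        have "I (Suc j) (R'(t := 1, i := Suc j)) M'"
          by (intro inv_i inv_t I')
        then have "ERT w B g (Suc p, R'(t := 1, i := Suc j), M') \<le> E"
          unfolding E_def using I' Suc.prems regs by (intro Suc.IH) (auto simp: j(2) simp del: fun_upd_apply, auto)
        then have "ERT w B g (Suc (Suc (p + 4 + L)), R'(t := 1, i := Suc j), M') \<le> E + 1"
          by (intro ERT_exec[OF code(14,15)]) auto
        then have "ERT w B g (Suc (p + 4 + L), R'(t := 1), M') \<le> E + 1 + 1"
          using I' regs j by (intro ERT_exec[OF code(12,13)]) (auto simp: take_bit_nat_eq_self)
        then have "ERT w B g (p + 4 + L, R', M') \<le> E + 1 + 1 + 1"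
          using t1 by (intro ERT_exec[OF code(10,11)]) auto
        then show ?thesis by (simp add: add.assoc)
      qed
      have "ERT w B g (p + 4, R(t := 1), M) \<le> E + 3 + of_nat k"
        by (rule tripleD[OF body[OF j(1)] code(9)])
          (use Suc.prems regs in \<open>auto simp: L_def j_def[symmetric] intro!: inv_t after[unfolded L_def]\<close>)
      then have "ERT w B g (Suc (Suc p), R(t := 1), M) \<le> E + 3 + of_nat k + 1"
        by (intro ERT_exec[OF code(5,6)]) auto
      then have "ERT w B g (Suc p, R, M) \<le> E + 3 + of_nat k + 1 + 1"
        using Suc.prems t1 j by (intro ERT_exec[OF code(3,4)]) (auto simp: j_def)
      also have "\<dots> = D + 3 + of_nat (Suc u * (5 + k))"
        by (simp add: E_def algebra_simps)
      finally show ?case .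
    qed
    have "ERT w B g (Suc p, R0(i := 0), M0) \<le> D + 3 + of_nat (n * (5 + k))"
      using start regs by (intro head) (auto intro: inv_i)
    then have "ERT w B g (p, R0, M0) \<le> D + 3 + of_nat (n * (5 + k)) + 1"
      by (intro ERT_exec[OF code(1,2)]) auto
    moreover have "D + 3 + of_nat (n * (5 + k)) + 1 = D + ((3 + 1) + of_nat (n * (5 + k)))"
      by (simp only: ac_simps)
    moreover have "(3 + 1) + of_nat (n * (5 + k)) = (of_nat (4 + n * (5 + k)) :: ennreal)"
      unfolding of_nat_add[of 4] by simp
    ultimately show "ERT w B g (p, R0, M0) \<le> D + of_nat (4 + n * (5 + k))"
      by (simp only:)
  qed
  then show ?thesis
    by (rule triple_conseq) (use pre post in auto)
qed

section \<open>Simulation with a smaller word size\<close>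

fun instr_regs :: "instr \<Rightarrow> nat set" where
  "instr_regs (Const r k) = {r}"
| "instr_regs (Bin b r i j) = {r, i, j}"
| "instr_regs (Load r i) = {r, i}"
| "instr_regs (Store r i) = {r, i}"
| "instr_regs (Rand r) = {r}"
| "instr_regs (Jump l) = {}"
| "instr_regs (JumpIf r l) = {r}"

lemma finite_instr_regs [simp]: "finite (instr_regs I)"
  by (cases I) auto

text \<open>The operators form the exact value before truncating, so truncating further is harmless.
  Only \<open>Sub\<close> mentions the word size itself: it adds \<open>2 ^ w\<close> instead of
  \<open>2 ^ v\<close>, and the difference is a multiple of \<open>2 ^ v\<close>.\<close>

lemma take_bit_binop_val:
  assumes "v \<le> w" "x < 2 ^ v" "y < 2 ^ v"
  shows "take_bit v (binop_val w b x y) = binop_val v b x y"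
proof -
  have *: "take_bit v (take_bit w z) = take_bit v z" for z :: nat
    using assms(1) by (simp add: take_bit_take_bit min_def)
  show ?thesis
  proof (cases b)
    case Sub
    define K where "K = (2::nat) ^ v * (2 ^ (w - v) - 1)"
    have "(2::nat) ^ w = 2 ^ v * 2 ^ (w - v)"
      using assms(1) by (simp flip: power_add)
    then have "(2::nat) ^ w = 2 ^ v + K"
      unfolding K_def by (simp add: algebra_simps)
    then have "x + 2 ^ w - y = (x + 2 ^ v - y) + 2 ^ v * (2 ^ (w - v) - 1)"
      using assms(3) unfolding K_def[symmetric] by linarith
    then have "take_bit v (x + 2 ^ w - y) = take_bit v (x + 2 ^ v - y)"
      by (simp add: take_bit_eq_mod)
    then show ?thesis
      by (simp only: Sub binop_val.simps *)
  qed (simp_all only: binop_val.simps *)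
qed

lemma binop_val_less [simp]: "binop_val v b x y < 2 ^ v"
  by (cases b; simp only: binop_val.simps take_bit_nat_less_exp)

text \<open>Every \<open>v\<close>-bit word is the low part of exactly \<open>2 ^ (w - v)\<close>
  words of \<open>w\<close> bits. Masking a random word therefore simulates \<open>Rand\<close>
  exactly in distribution.\<close>

lemma map_pmf_take_bit:
  assumes "v \<le> w"
  shows "map_pmf (take_bit v) (word_pmf w) = word_pmf v"
proof (rule pmf_eqI)
  fix y :: nat
  have card: "card ({..<2 ^ w} \<inter> take_bit v -` {y}) = (if y < 2 ^ v then 2 ^ (w - v) else 0)"
  proof (cases "y < 2 ^ v")
    case True
    have pw: "(2::nat) ^ w = 2 ^ v * 2 ^ (w - v)"
      using assms by (simp flip: power_add)
    have "bij_betw (\<lambda>q. y + 2 ^ v * q) {..<2 ^ (w - v)} ({..<2 ^ w} \<inter> take_bit v -` {y})"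
    proof (rule bij_betwI[where g = "\<lambda>x. x div 2 ^ v"])
      show "(\<lambda>q. y + 2 ^ v * q) \<in> {..<2 ^ (w - v)} \<rightarrow> {..<2 ^ w} \<inter> take_bit v -` {y}"
      proof
        fix q :: nat assume q: "q \<in> {..<2 ^ (w - v)}"
        have "y + 2 ^ v * q < 2 ^ v * (q + 1)" using True by simp
        also have "\<dots> \<le> 2 ^ w" using q unfolding pw by (intro mult_le_mono) auto
        finally show "y + 2 ^ v * q \<in> {..<2 ^ w} \<inter> take_bit v -` {y}"
          using True by (simp add: take_bit_eq_mod)
      qed
      show "(\<lambda>x. x div 2 ^ v) \<in> {..<2 ^ w} \<inter> take_bit v -` {y} \<rightarrow> {..<2 ^ (w - v)}"
        by (auto simp: pw mult.commute less_mult_imp_div_less)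
      show "(y + 2 ^ v * q) div 2 ^ v = q" if "q \<in> {..<2 ^ (w - v)}" for q
        using True by simp
      show "y + 2 ^ v * (x div 2 ^ v) = x" if "x \<in> {..<2 ^ w} \<inter> take_bit v -` {y}" for x
        using that by (auto simp: take_bit_eq_mod)
    qed
    then show ?thesis using True by (simp flip: bij_betw_same_card)
  next
    case False
    have "take_bit v x \<noteq> y" for x :: nat
      using False take_bit_nat_less_exp[of v x] by auto
    then have "{..<2 ^ w} \<inter> take_bit v -` {y} = {}"
      by auto
    then show ?thesis using False by simp
  qed
  have pw: "(2::real) ^ w = 2 ^ v * 2 ^ (w - v)"
    using assms by (simp flip: power_add)
  have "pmf (map_pmf (take_bit v) (word_pmf w)) y = real (card ({..<2 ^ w} \<inter> take_bit v -` {y})) / 2 ^ w"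
    by (simp add: pmf_map measure_pmf_of_set)
  also have "\<dots> = pmf (word_pmf v) y"
    by (simp add: card pmf_of_set pw)
  finally show "pmf (map_pmf (take_bit v) (word_pmf w)) y = pmf (word_pmf v) y" .
qed

lemma ert_le_one_step:
  assumes "\<not> chalted B a" "\<And>x. x < 2 ^ w \<Longrightarrow> ert w B g t (cstep w B x a) \<le> f x"
  shows "ert w B g (Suc t) a \<le> 1 + (\<integral>\<^sup>+x. f x \<partial>measure_pmf (word_pmf w))"
  using assms by (auto intro!: add_left_mono nn_integral_mono_AE simp: AE_measure_pmf_iff)

context
  fixes w v :: nat and P :: program and nr d t mk bs :: nat and base :: nat
    and R0 M0 :: "nat \<Rightarrow> nat"
  assumes nr: "\<forall>I\<in>set P. \<forall>r\<in>instr_regs I. r < nr" "0 < nr"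
    and vw: "v \<le> w"
    and fresh: "t \<notin> {d..<d + nr}" "mk \<notin> {d..<d + nr}" "bs \<notin> {d..<d + nr}" "t \<noteq> mk" "t \<noteq> bs"
    and mk: "R0 mk = 2 ^ v - 1" and bs: "R0 bs = base" and fits: "base + 2 ^ v \<le> 2 ^ w"
begin

text \<open>The last two conjuncts are a frame condition relative to the host state
  \<open>R0\<close>, \<open>M0\<close> at the start of the simulation. The bounds by
  \<open>2 ^ v\<close> are what \<open>take_bit_binop_val\<close> and the address translation
  require.\<close>

definition sim_data ::
  "(nat \<Rightarrow> nat) \<Rightarrow> (nat \<Rightarrow> nat) \<Rightarrow> (nat \<Rightarrow> nat) \<Rightarrow> (nat \<Rightarrow> nat) \<Rightarrow> bool" where
  "sim_data r m R M \<longleftrightarrow>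
     (\<forall>i<nr. R (d + i) = r i \<and> r i < 2 ^ v) \<and>
     (\<forall>x<2 ^ v. M (base + x) = m x \<and> m x < 2 ^ v) \<and>
     (\<forall>i. i \<notin> {d..<d + nr} \<longrightarrow> i \<noteq> t \<longrightarrow> R i = R0 i) \<and>
     (\<forall>x. x \<notin> {base..<base + 2 ^ v} \<longrightarrow> M x = M0 x)"

definition sim_rel :: "nat \<Rightarrow> core \<Rightarrow> core \<Rightarrow> bool" where
  "sim_rel p a b \<longleftrightarrow> fst b = sim_target p P (fst a) \<and>
     sim_data (fst (snd a)) (snd (snd a)) (fst (snd b)) (snd (snd b))"

lemma sim_data_temp: "sim_data r m R M \<Longrightarrow> sim_data r m (R(t := z)) M"
  using fresh(1) by (auto simp: sim_data_def)

lemma sim_data_reg: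
  "sim_data r m R M \<Longrightarrow> i < nr \<Longrightarrow> z < 2 ^ v \<Longrightarrow> sim_data (r(i := z)) m (R(d + i := z)) M"
  by (auto simp: sim_data_def)

lemma sim_data_mem:
  "sim_data r m R M \<Longrightarrow> x < 2 ^ v \<Longrightarrow> z < 2 ^ v \<Longrightarrow> sim_data r (m(x := z)) R (M(base + x := z))"
  by (auto simp: sim_data_def)

lemma sim_rel_exec:
  assumes data: "sim_data r m R M" and I: "\<forall>i\<in>instr_regs I. i < nr"
    and tgt: "\<tau> (Suc l) = Suc (Suc q)"
  shows "case cexec v (take_bit v x) I (l, r, m) of (l', r', m') \<Rightarrow>
    case cexec w y (sim_instr \<tau> d t mk bs I ! 1) (Suc q,
        snd (cexec w x (sim_instr \<tau> d t mk bs I ! 0) (q, R, M))) of (q', R', M') \<Rightarrow>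
      q' = \<tau> l' \<and> sim_data r' m' R' M'"
proof -
  have mkR: "R mk = mask v" and bsR: "R bs = base"
    using data fresh mk bs by (auto simp: sim_data_def mask_eq_exp_minus_1)
  have ne: "d + i \<noteq> mk" "mk \<noteq> d + i" "d + i \<noteq> t" if "i < nr" for i
    using fresh that by auto
  have reg: "R (d + i) = r i" "r i < 2 ^ v" if "i < nr" for i
    using data that by (auto simp: sim_data_def)
  have mem: "M (base + z) = m z" "m z < 2 ^ v" if "z < 2 ^ v" for z
    using data that by (auto simp: sim_data_def)
  have and_mk: "binop_val w And z (mask v) = take_bit v z" for z
    using vw unfolding binop_val.simps take_bit_eq_mask[symmetric]
    by (simp add: take_bit_take_bit min_absorb2)
  \<comment> \<open>By \<open>fits\<close> the whole simulated region lies below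
    \<open>2 ^ w\<close>, so adding the base does not wrap around.\<close>
  have addr: "take_bit w (R (d + i) + R bs) = base + r i" if "i < nr" for i
    using reg[OF that] fits by (simp add: take_bit_nat_eq_self bsR add.commute)
  show ?thesis
  proof (cases I)
    case (Const i k)
    then show ?thesis
      using I tgt ne[of i] sim_data_reg[OF data, of i "take_bit v k"] by (simp add: mkR and_mk min_absorb1[OF vw] del: binop_val.simps)
  next
    case (Bin b i j k)
    then show ?thesis
      using I tgt ne[of i] sim_data_reg[OF data, of i "binop_val v b (r j) (r k)"] reg(1)
      by (simp add: mkR and_mk reg take_bit_binop_val[OF vw] del: binop_val.simps)
  next
    case (Load i j)
    then show ?thesis
      using I tgt sim_data_reg[OF sim_data_temp[OF data], of i "m (r j)"] reg[of j] mem[of "r j"] addr[of j]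
      by simp
  next
    case (Store i j)
    then show ?thesis
      using I tgt sim_data_mem[OF sim_data_temp[OF data], of "r i" "r j"] reg[of i] reg[of j] addr[of i] ne[of j]
      by simp
  next
    case (Rand i)
    then show ?thesis
      using I tgt ne[of i] sim_data_reg[OF data, of i "take_bit v x"] by (simp add: mkR and_mk min_absorb1[OF vw] del: binop_val.simps)
  next
    case (Jump k)
    then show ?thesis
      using sim_data_temp[OF data] by simp
  next
    case (JumpIf i k)
    then show ?thesis
      using I tgt sim_data_temp[OF data] reg[of i] ne[of i] by simp
  qed
qed

lemma sim_rel_step:
  assumes loc: "located B p (compile p (Sim P d t mk bs))"
    and rel: "sim_rel p a b" and nh: "\<not> chalted P a"
  shows "\<not> chalted B b" "\<not> chalted B (cstep w B x b)"
    "sim_rel p (cstep v P (take_bit v x) a) (cstep w B y (cstep w B x b))"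
proof -
  obtain l r m where a: "a = (l, r, m)" by (cases a)
  obtain q R M where b: "b = (q, R, M)" by (cases b)
  have l: "l < length P" using nh by (simp add: chalted_def a)
  define I where "I = P ! l"
  have I: "\<forall>i\<in>instr_regs I. i < nr" using nr(1) l by (auto simp: I_def)
  have q: "q = p + 2 * l" and data: "sim_data r m R M"
    using rel l by (auto simp: sim_rel_def a b sim_target_def)
  have len: "Suc q < length B"
    using loc l by (auto simp: located_def q)
  have code: "B ! q = sim_instr (sim_target p P) d t mk bs I ! 0"
    "B ! Suc q = sim_instr (sim_target p P) d t mk bs I ! 1"
    using loc l nth_concat_map_sim[of l P 0 "sim_target p P" d t mk bs]
      nth_concat_map_sim[of l P 1 "sim_target p P" d t mk bs]
    by (auto simp: located_def q I_def dest: spec[of _ "2 * l"] spec[of _ "Suc (2 * l)"])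
  have tgt: "sim_target p P (Suc l) = Suc (Suc q)"
    using l by (auto simp: sim_target_def q)
  show nh1: "\<not> chalted B b"
    using len by (simp add: chalted_def b)
  have pc: "fst (cexec w x (sim_instr (sim_target p P) d t mk bs I ! 0) (q, R, M)) = Suc q"
    by (cases I) simp_all
  have st: "cstep w B x b = (Suc q, snd (cexec w x (sim_instr (sim_target p P) d t mk bs I ! 0) (q, R, M)))"
    using nh1 code pc by (simp add: cstep_def b prod_eq_iff)
  show nh2: "\<not> chalted B (cstep w B x b)"
    using len by (simp add: chalted_def st)
  have ex2: "cstep w B y (cstep w B x b) = cexec w y (sim_instr (sim_target p P) d t mk bs I ! 1) (cstep w B x b)"
    unfolding st using len code by (simp add: cstep_def chalted_def)
  have exa: "cstep v P (take_bit v x) a = cexec v (take_bit v x) I (l, r, m)"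
    using nh by (simp add: cstep_def I_def a)
  show "sim_rel p (cstep v P (take_bit v x) a) (cstep w B y (cstep w B x b))"
    unfolding ex2 unfolding st exa sim_rel_def
    using sim_rel_exec[where \<tau> = "sim_target p P" and x = x and y = y, OF data I tgt]
    by (simp only: case_prod_beta)
qed

text \<open>Each simulated step costs two host steps, and the same cut-off \<open>u\<close> serves
  on both sides because truncated cost is monotone in it. Where \<open>P\<close> halts with a wrong
  output the right-hand side is \<top>, so the continuation only has to be bounded for the output
  \<open>out\<close>.\<close>

lemma ert_sim_le:
  assumes loc: "located B p (compile p (Sim P d t mk bs))"
    and ex: "\<And>a b. chalted P a \<Longrightarrow> sim_rel p a b \<Longrightarrow> fst (snd a) 0 = out \<Longrightarrow> ERT w B g b \<le> D"
  shows "sim_rel p a b \<Longrightarrow> ert w B g u b \<le> 2 * ert v P (penalty out) u a + D"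
proof (induction u arbitrary: a b)
  have halted: "ert w B g u b \<le> 2 * ert v P (penalty out) u a + D" if "sim_rel p a b" "chalted P a" for a b u
  proof (cases "fst (snd a) 0 = out")
    case True
    then show ?thesis
      using order_trans[OF ert_le_ERT ex[OF that(2,1)]] by (simp add: add_increasing)
  qed (use that in \<open>simp add: ert_halted penalty_def ennreal_mult_top\<close>)
  {
    case 0
    show ?case
    proof (cases "chalted P a")
      case True
      then show ?thesis by (rule halted[OF 0])
    qed (use sim_rel_step(1)[OF loc 0] in simp)
  next
    case (Suc u)
    show ?case
    proof (cases "chalted P a")
      case True
      then show ?thesis by (rule halted[OF Suc.prems])
    next
      case False
      note st = sim_rel_step[OF loc Suc.prems False]
      let ?f = "\<lambda>x. 2 * ert v P (penalty out) u (cstep v P (take_bit v x) a) + D"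
      note nh = st(1)
      \<comment> \<open>One extra unit of cut-off aligns the host with a whole simulated step: two
        host steps, then the induction hypothesis at \<open>u\<close>.\<close>
      have "ert w B g (Suc u) b \<le> ert w B g (Suc (Suc u)) b"
        by (rule ert_mono)
      also have "\<dots> \<le> 1 + (\<integral>\<^sup>+x. 1 + ?f x \<partial>measure_pmf (word_pmf w))"
      proof (rule ert_le_one_step[OF nh])
        fix x :: nat assume x: "x < 2 ^ w"
        have "ert w B g (Suc u) (cstep w B x b) \<le> 1 + (\<integral>\<^sup>+y. ?f x \<partial>measure_pmf (word_pmf w))"
          by (rule ert_le_one_step[OF st(2)]) (rule Suc.IH[OF st(3)])
        then show "ert w B g (Suc u) (cstep w B x b) \<le> 1 + ?f x"
          by simp
      qed
      also have "\<dots> = 2 + 2 * (\<integral>\<^sup>+x. ert v P (penalty out) u (cstep v P (take_bit v x) a)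
          \<partial>measure_pmf (word_pmf w)) + D"
        by (simp add: nn_integral_add nn_integral_cmult add.assoc flip: one_add_one)
      \<comment> \<open>The simulated machine sees only the low \<open>v\<close> bits of the host's
        word; their distribution is uniform again.\<close>
      also have "(\<integral>\<^sup>+x. ert v P (penalty out) u (cstep v P (take_bit v x) a) \<partial>measure_pmf (word_pmf w)) =
          (\<integral>\<^sup>+x. ert v P (penalty out) u (cstep v P x a) \<partial>measure_pmf (map_pmf (take_bit v) (word_pmf w)))"
        by simp
      also have "2 + 2 * \<dots> + D = 2 * ert v P (penalty out) (Suc u) a + D"
        using False by (simp add: map_pmf_take_bit[OF vw] distrib_left)
      finally show ?thesis .
    qed
  }
qed

lemma ERT_sim_le:
  assumes loc: "located B p (compile p (Sim P d t mk bs))"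
    and ex: "\<And>R M. R d = out \<Longrightarrow> (\<forall>i. i \<notin> {d..<d + nr} \<longrightarrow> i \<noteq> t \<longrightarrow> R i = R0 i) \<Longrightarrow>
      (\<forall>x. x \<notin> {base..<base + 2 ^ v} \<longrightarrow> M x = M0 x) \<Longrightarrow>
      ERT w B g (p + clen (Sim P d t mk bs), R, M) \<le> D"
    and zero: "\<forall>i<nr. R0 (d + i) = 0"
    and m: "\<forall>x<2 ^ v. M0 (base + x) = m x" "\<forall>x. m x < 2 ^ v"
  shows "ERT w B g (p, R0, M0) \<le> D + 2 * ERT v P (penalty out) (0, (\<lambda>_. 0), m)"
proof -
  have rel: "sim_rel p (0, (\<lambda>_. 0), m) (p, R0, M0)"
    using zero m by (simp add: sim_rel_def sim_data_def sim_target_def)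
  have "ERT w B g b \<le> D" if "chalted P a" "sim_rel p a b" "fst (snd a) 0 = out" for a b
    using that ex[of "fst (snd b)" "snd (snd b)"] nr(2)
    by (cases b) (auto simp: sim_rel_def sim_data_def chalted_def sim_target_def dest: spec[of _ 0])
  note * = ert_sim_le[OF loc this rel]
  show ?thesis
    unfolding ERT_def[of w B]
  proof (rule SUP_least)
    fix u
    have "ert w B g u (p, R0, M0) \<le> 2 * ert v P (penalty out) u (0, (\<lambda>_. 0), m) + D"
      by (rule *)
    also have "\<dots> \<le> 2 * ERT v P (penalty out) (0, (\<lambda>_. 0), m) + D"
      by (intro add_right_mono mult_left_mono ert_le_ERT) auto
    finally show "ert w B g u (p, R0, M0) \<le> D + 2 * ERT v P (penalty out) (0, (\<lambda>_. 0), m)"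
      by (simp add: add.commute)
  qed
qed

end

lemma triple_Sim:
  assumes "\<forall>I\<in>set P. \<forall>r\<in>instr_regs I. r < nr" "0 < nr" "v \<le> w"
    and "t \<notin> {d..<d + nr}" "mk \<notin> {d..<d + nr}" "bs \<notin> {d..<d + nr}" "t \<noteq> mk" "t \<noteq> bs"
    and "base + 2 ^ v \<le> 2 ^ w" "\<forall>x. m x < 2 ^ v"
    and pre: "\<And>R M. A R M \<Longrightarrow> R mk = 2 ^ v - 1 \<and> R bs = base \<and> (\<forall>i<nr. R (d + i) = 0) \<and>
      (\<forall>x<2 ^ v. M (base + x) = m x)"
    and post: "\<And>R M R' M'. A R M \<Longrightarrow> R' d = out \<Longrightarrow> (\<And>i. i \<notin> {d..<d + nr} \<Longrightarrow> i \<noteq> t \<Longrightarrow> R' i = R i) \<Longrightarrow>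
      (\<And>x. x \<notin> {base..<base + 2 ^ v} \<Longrightarrow> M' x = M x) \<Longrightarrow> Z R' M'"
    and cost: "2 * ERT v P (penalty out) (0, (\<lambda>_. 0), m) \<le> of_nat k"
  shows "triple w A (Sim P d t mk bs) k Z"
  unfolding triple_def
proof (intro allI impI)
  fix B p g D R M
  assume *: "located B p (compile p (Sim P d t mk bs))" "A R M"
    "\<forall>R' M'. Z R' M' \<longrightarrow> ERT w B g (p + clen (Sim P d t mk bs), R', M') \<le> D"
  have "ERT w B g (p, R, M) \<le> D + 2 * ERT v P (penalty out) (0, (\<lambda>_. 0), m)"
    by (rule ERT_sim_le[of P nr v w t d mk bs R base, OF assms(1-8) _ _ assms(9) *(1)])
      (use pre[OF *(2)] post[OF *(2)] * assms(10) in auto)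
  also have "\<dots> \<le> D + of_nat k"
    by (rule add_left_mono[OF cost])
  finally show "ERT w B g (p, R, M) \<le> D + of_nat k" .
qed

section \<open>Elimination orders of forests\<close>

datatype 'a elim_step = Leaf 'a 'a | Iso 'a

text \<open>The rules build the forest by attaching leaves and isolated vertices. The head of the
  list is the vertex attached last, hence the one to be eliminated first.\<close>

inductive eliminates :: "'a elim_step list \<Rightarrow> 'a set \<Rightarrow> 'a set set \<Rightarrow> bool" where
  eliminates_Nil: "eliminates [] {} {}"
| eliminates_Leaf: "eliminates ss V E \<Longrightarrow> v \<notin> V \<Longrightarrow> p \<in> V \<Longrightarrow>
    eliminates (Leaf v p # ss) (insert v V) (insert {v, p} E)"
| eliminates_Iso: "eliminates ss V E \<Longrightarrow> v \<notin> V \<Longrightarrow> eliminates (Iso v # ss) (insert v V) E"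

lemma eliminates_finite:
  assumes "eliminates ss V E"
  shows "finite V \<and> (\<forall>e\<in>E. e \<subseteq> V)"
  using assms by induction auto

lemma is_cycle_mono: "is_cycle E vs \<Longrightarrow> E \<subseteq> E' \<Longrightarrow> is_cycle E' vs"
  by (auto simp: is_cycle_def)

text \<open>In a longest path, the first vertex has no neighbour outside of the path.\<close>

lemma cycle_if_degree_ge_2:
  assumes G: "simple_graph V E" and ne: "V \<noteq> {}"
    and deg: "\<And>v. v \<in> V \<Longrightarrow> \<exists>u u'. u \<noteq> u' \<and> {v, u} \<in> E \<and> {v, u'} \<in> E"
  shows "\<exists>vs. is_cycle E vs"
proof -
  define path where "path vs \<longleftrightarrow> vs \<noteq> [] \<and> distinct vs \<and> set vs \<subseteq> V \<and>
    (\<forall>i. Suc i < length vs \<longrightarrow> {vs ! i, vs ! Suc i} \<in> E)" for vs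
  have fin: "finite V" using G by (simp add: simple_graph_def)
  obtain v0 where v0: "v0 \<in> V" using ne by blast
  have "path [v0]" using v0 by (simp add: path_def)
  moreover have "\<forall>vs. path vs \<longrightarrow> length vs < Suc (card V)"
  proof (intro allI impI)
    fix vs assume "path vs"
    then have "card (set vs) \<le> card V" "card (set vs) = length vs"
      using fin card_mono[of V "set vs"] distinct_card[of vs] by (simp_all add: path_def)
    then show "length vs < Suc (card V)" by simp
  qed
  ultimately obtain vs where vs: "path vs" and max: "\<And>us. path us \<Longrightarrow> length us \<le> length vs"
    using ex_has_greatest_nat[of path "[v0]" length "Suc (card V)"] by blast
  define x where "x = vs ! 0"
  have vs0: "vs \<noteq> []" "distinct vs" "set vs \<subseteq> V"
    and vsE: "\<And>i. Suc i < length vs \<Longrightarrow> {vs ! i, vs ! Suc i} \<in> E"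
    using vs by (auto simp: path_def)
  have x: "x \<in> V" using vs0 by (auto simp: x_def)
  have nb: "u \<in> set vs \<and> u \<noteq> x" if "{x, u} \<in> E" for u
  proof
    have u: "u \<in> V" "u \<noteq> x"
      using that G by (force simp: simple_graph_def)+
    show "u \<noteq> x" by fact
    show "u \<in> set vs"
    proof (rule ccontr)
      assume "u \<notin> set vs"
      moreover have "{(u # vs) ! i, (u # vs) ! Suc i} \<in> E" if "Suc i < length (u # vs)" for i
        using that vsE \<open>{x, u} \<in> E\<close> by (cases i) (auto simp: x_def insert_commute)
      ultimately have "path (u # vs)"
        using vs0 u by (auto simp: path_def)
      from max[OF this] show False by simp
    qed
  qed
  obtain u u' where "u \<noteq> u'" "{x, u} \<in> E" "{x, u'} \<in> E"
    using deg[OF x] by blast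
  \<comment> \<open>Of two neighbours of the end vertex \<open>x\<close>, one is not its successor
    on the path. As it lies on the path, its index is at least 2, and it closes a cycle.\<close>
  then obtain y where y: "{x, y} \<in> E" "length vs > 1 \<longrightarrow> y \<noteq> vs ! 1"
    by blast
  from nb[OF y(1)] obtain i where i: "i < length vs" "y = vs ! i" "y \<noteq> x"
    by (auto simp: in_set_conv_nth)
  have "i \<noteq> 0" using i by (metis x_def)
  moreover have "i \<noteq> 1" using i y by metis
  ultimately have i2: "i \<ge> 2" by simp
  have "is_cycle E (take (Suc i) vs)"
    unfolding is_cycle_def
  proof (intro conjI allI impI)
    show "3 \<le> length (take (Suc i) vs)" using i i2 by simp
    show "distinct (take (Suc i) vs)" using vs0 by simp
    fix j assume j: "j < length (take (Suc i) vs)"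
    have len: "length (take (Suc i) vs) = Suc i" using i by simp
    show "{take (Suc i) vs ! j, take (Suc i) vs ! (Suc j mod length (take (Suc i) vs))} \<in> E"
    proof (cases "j = i")
      case True
      then show ?thesis using i y by (simp add: len x_def insert_commute)
    next
      case False
      then have "Suc j < Suc i" using j len by simp
      then show ?thesis using i vsE[of j] by (simp add: len)
    qed
  qed
  then show ?thesis by blast
qed

text \<open>By the contrapositive of \<open>cycle_if_degree_ge_2\<close> some vertex has at most one
  neighbour. Deleting it creates no cycle, so induction on the number of vertices applies.\<close>

lemma forest_eliminates:
  assumes "forest V E"
  shows "\<exists>ss. eliminates ss V E"
  using assms
proof (induction "card V" arbitrary: V E)
  case 0
  then have "V = {}" "E = {}"
    by (force simp: forest_def simple_graph_def)+
  then show ?case using eliminates_Nil by blast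
next
  case (Suc k)
  have G: "simple_graph V E" and nc: "\<nexists>vs. is_cycle E vs"
    using Suc.prems by (auto simp: forest_def)
  have "V \<noteq> {}" using Suc.hyps by auto
  then obtain v where v: "v \<in> V" and deg: "\<And>u u'. {v, u} \<in> E \<Longrightarrow> {v, u'} \<in> E \<Longrightarrow> u = u'"
    using cycle_if_degree_ge_2[OF G] nc by metis
  define V' where "V' = V - {v}"
  define E' where "E' = {e \<in> E. v \<notin> e}"
  have "forest V' E'"
    unfolding forest_def
  proof
    show "simple_graph V' E'"
      using G by (auto simp: simple_graph_def V'_def E'_def)
    show "\<nexists>vs. is_cycle E' vs"
      using nc is_cycle_mono[of E' _ E] by (auto simp: E'_def)
  qed
  moreover have "k = card V'"
    using Suc.hyps(2) v by (simp add: V'_def)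
  ultimately obtain ss where ss: "eliminates ss V' E'"
    using Suc.hyps(1) by blast
  have V: "V = insert v V'" "v \<notin> V'" using v by (auto simp: V'_def)
  show ?case
  proof (cases "\<exists>p. {v, p} \<in> E")
    case True
    then obtain p where p: "{v, p} \<in> E" by blast
    have "p \<in> V'" using p G by (force simp: simple_graph_def V'_def)
    moreover have "E = insert {v, p} E'"
    proof -
      have "e = {v, p}" if e: "e \<in> E" "v \<in> e" for e
      proof -
        have "card e = 2" using G e by (auto simp: simple_graph_def)
        then obtain u where "e = {v, u}" using e(2) by (auto simp: card_2_iff doubleton_eq_iff)
        then show ?thesis using deg p e by blast
      qed
      then have "E \<subseteq> insert {v, p} E'" unfolding E'_def by blast
      moreover have "insert {v, p} E' \<subseteq> E" using p unfolding E'_def by blast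
      ultimately show ?thesis by (rule equalityI)
    qed
    ultimately show ?thesis
      using eliminates_Leaf[OF ss V(2)] V(1) by blast
  next
    case False
    have "v \<notin> e" if e: "e \<in> E" for e
    proof
      assume "v \<in> e"
      moreover have "card e = 2" using G e by (auto simp: simple_graph_def)
      ultimately obtain u where "e = {v, u}" by (auto simp: card_2_iff doubleton_eq_iff)
      then show False using False e by blast
    qed
    then have "E = E'" by (auto simp: E'_def)
    then show ?thesis using eliminates_Iso[OF ss V(2)] V(1) by blast
  qed
qed

section \<open>Weighted homomorphism counts under elimination\<close>

definition weighted_homs :: "'a set \<Rightarrow> 'a set set \<Rightarrow> nat \<Rightarrow> nat set set \<Rightarrow> ('a \<Rightarrow> nat \<Rightarrow> nat) \<Rightarrow> nat" where
  "weighted_homs V E n F \<phi> = (\<Sum>f\<in>V \<rightarrow>\<^sub>E {..<n}. of_bool (\<forall>e\<in>E. f ` e \<in> F) * (\<Prod>v\<in>V. \<phi> v (f v)))"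

lemma hom_count_eq_weighted_homs:
  assumes "finite V"
  shows "hom_count V E {..<n} F = weighted_homs V E n F (\<lambda>_ _. 1)"
proof -
  have "finite (V \<rightarrow>\<^sub>E {..<n})" using assms by (simp add: finite_PiE)
  then have "(\<Sum>f\<in>V \<rightarrow>\<^sub>E {..<n}. of_bool (\<forall>e\<in>E. f ` e \<in> F)) =
      card ((V \<rightarrow>\<^sub>E {..<n}) \<inter> {f. \<forall>e\<in>E. f ` e \<in> F})"
    by (simp add: sum_of_bool_eq)
  then show ?thesis
    by (simp add: hom_count_def graph_homs_def weighted_homs_def Int_def)
qed

lemma sum_PiE_insert:
  fixes g :: "('a \<Rightarrow> nat) \<Rightarrow> nat"
  assumes "v \<notin> V"
  shows "(\<Sum>f\<in>insert v V \<rightarrow>\<^sub>E A. g f) = (\<Sum>f\<in>V \<rightarrow>\<^sub>E A. \<Sum>y\<in>A. g (f(v := y)))"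
proof -
  have "(\<Sum>f\<in>insert v V \<rightarrow>\<^sub>E A. g f) = (\<Sum>(y, f)\<in>A \<times> (V \<rightarrow>\<^sub>E A). g (f(v := y)))"
    unfolding PiE_insert_eq
    by (subst sum.reindex) (use inj_combinator[OF assms, of "\<lambda>_. A"] in \<open>auto simp: o_def case_prod_beta\<close>)
  also have "\<dots> = (\<Sum>y\<in>A. \<Sum>f\<in>V \<rightarrow>\<^sub>E A. g (f(v := y)))"
    by (simp add: sum.cartesian_product)
  also have "\<dots> = (\<Sum>f\<in>V \<rightarrow>\<^sub>E A. \<Sum>y\<in>A. g (f(v := y)))"
    by (rule sum.swap)
  finally show ?thesis .
qed

lemma prod_insert_upd:
  assumes "finite V" "v \<notin> V"
  shows "(\<Prod>u\<in>insert v V. \<phi> u ((f(v := y)) u)) = \<phi> v y * (\<Prod>u\<in>V. \<phi> u (f u))"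
proof -
  have "(\<Prod>u\<in>V. \<phi> u ((f(v := y)) u)) = (\<Prod>u\<in>V. \<phi> u (f u))"
    by (rule prod.cong) (use assms in auto)
  then show ?thesis using assms by simp
qed

lemma image_upd_eq: "e \<subseteq> V \<Longrightarrow> v \<notin> V \<Longrightarrow> (f(v := y)) ` e = f ` e"
  by (rule image_cong) auto

lemma weighted_homs_Iso:
  assumes "finite V" "\<forall>e\<in>E. e \<subseteq> V" "v \<notin> V"
  shows "weighted_homs (insert v V) E n F \<phi> = (\<Sum>x<n. \<phi> v x) * weighted_homs V E n F \<phi>"
proof -
  have *: "(\<forall>e\<in>E. (f(v := y)) ` e \<in> F) \<longleftrightarrow> (\<forall>e\<in>E. f ` e \<in> F)" for f y
    using assms image_upd_eq[of _ V v f y] by (intro ball_cong) auto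
  show ?thesis
    unfolding weighted_homs_def sum_PiE_insert[OF assms(3)] prod_insert_upd[OF assms(1,3)] *
    unfolding sum_distrib_left
    by (rule sum.cong) (auto simp: sum_distrib_right ac_simps)
qed

definition nbr_sum :: "nat \<Rightarrow> nat set set \<Rightarrow> (nat \<Rightarrow> nat) \<Rightarrow> nat \<Rightarrow> nat" where
  "nbr_sum n F \<psi> x = (\<Sum>y<n. of_bool ({x, y} \<in> F) * \<psi> y)"

text \<open>The image of the leaf occurs only in its own weight and in its edge to the image of
  \<open>p\<close>, so it can be summed out first, leaving a factor that depends on
  \<open>f p\<close>. Starting from weights 1, the weight of a vertex at \<open>x\<close> thus
  counts the maps of all that was eliminated through this vertex when it is sent to
  \<open>x\<close>.\<close>

lemma weighted_homs_Leaf: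
  assumes "finite V" "\<forall>e\<in>E. e \<subseteq> V" "v \<notin> V" "p \<in> V"
  shows "weighted_homs (insert v V) (insert {v, p} E) n F \<phi> =
    weighted_homs V E n F (\<phi>(p := \<lambda>x. \<phi> p x * nbr_sum n F (\<phi> v) x))"
proof -
  let ?\<psi> = "\<phi>(p := \<lambda>x. \<phi> p x * nbr_sum n F (\<phi> v) x)"
  have *: "(\<forall>e\<in>insert {v, p} E. (f(v := y)) ` e \<in> F) \<longleftrightarrow> {f p, y} \<in> F \<and> (\<forall>e\<in>E. f ` e \<in> F)" for f y
  proof -
    have "(f(v := y)) ` {v, p} = {f p, y}"
      using assms by auto
    moreover have "(\<forall>e\<in>E. (f(v := y)) ` e \<in> F) \<longleftrightarrow> (\<forall>e\<in>E. f ` e \<in> F)"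
      using assms image_upd_eq[of _ V v f y] by (intro ball_cong) auto
    ultimately show ?thesis by simp
  qed
  have **: "(\<Prod>u\<in>V. ?\<psi> u (f u)) = nbr_sum n F (\<phi> v) (f p) * (\<Prod>u\<in>V. \<phi> u (f u))" for f
  proof -
    have "(\<Prod>u\<in>V - {p}. ?\<psi> u (f u)) = (\<Prod>u\<in>V - {p}. \<phi> u (f u))"
      by (rule prod.cong) auto
    then show ?thesis
      unfolding prod.remove[OF assms(1,4)] by simp
  qed
  show ?thesis
    unfolding weighted_homs_def sum_PiE_insert[OF assms(3)] prod_insert_upd[OF assms(1,3)] * **
    by (rule sum.cong) (auto simp: nbr_sum_def sum_distrib_left sum_distrib_right of_bool_conj ac_simps
        simp del: sum_of_bool_mult_eq sum_mult_of_bool_eq)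
qed

fun apply_step :: "nat \<Rightarrow> nat set set \<Rightarrow> 'a elim_step \<Rightarrow> ('a \<Rightarrow> nat \<Rightarrow> nat) \<times> nat \<Rightarrow> ('a \<Rightarrow> nat \<Rightarrow> nat) \<times> nat" where
  "apply_step n F (Leaf v p) (\<phi>, r) = (\<phi>(p := \<lambda>x. \<phi> p x * nbr_sum n F (\<phi> v) x), r)"
| "apply_step n F (Iso v) (\<phi>, r) = (\<phi>, r * (\<Sum>x<n. \<phi> v x))"

lemma fold_apply_step:
  assumes "eliminates ss V E"
  shows "snd (fold (apply_step n F) ss (\<phi>, r)) = r * weighted_homs V E n F \<phi>"
  using assms
proof (induction arbitrary: \<phi> r)
  case eliminates_Nil
  then show ?case by (simp add: weighted_homs_def)
next
  case (eliminates_Leaf ss V E v p)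
  then show ?case using eliminates_finite[of ss V E] by (simp add: weighted_homs_Leaf fun_upd_def)
next
  case (eliminates_Iso ss V E v)
  then show ?case using eliminates_finite[of ss V E] by (simp add: weighted_homs_Iso mult.assoc)
qed

text \<open>Evaluating the definition of \<open>nbr_sum\<close> for all \<open>x\<close> would take
  quadratic time. In this form every listed edge makes two contributions, so one pass over the edge
  list yields all values.\<close>

lemma nbr_sum_encodes:
  assumes "encodes n es F" "x < n"
  shows "nbr_sum n F \<psi> x = (\<Sum>(a, b)\<leftarrow>es. of_bool (x = a) * \<psi> b + of_bool (x = b) * \<psi> a)"
proof -
  have G: "simple_graph {..<n} F" and d: "distinct (map (\<lambda>(u, v). {u, v}) es)"
    and s: "set (map (\<lambda>(u, v). {u, v}) es) = F"
    using assms by (auto simp: encodes_def)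
  define g where "g e = (\<Sum>y<n. of_bool ({x, y} = e) * \<psi> y)" for e
  have fin: "finite F" using s by (metis finite_set)
  have "nbr_sum n F \<psi> x = (\<Sum>y<n. \<Sum>e\<in>F. of_bool ({x, y} = e) * \<psi> y)"
    unfolding nbr_sum_def
  proof (rule sum.cong)
    fix y
    have "(\<Sum>e\<in>F. of_bool ({x, y} = e) * \<psi> y) = (\<Sum>e\<in>F. if {x, y} = e then \<psi> y else 0)"
      by (rule sum.cong) auto
    then show "of_bool ({x, y} \<in> F) * \<psi> y = (\<Sum>e\<in>F. of_bool ({x, y} = e) * \<psi> y)"
      using fin by simp
  qed simp
  also have "\<dots> = (\<Sum>e\<in>F. g e)"
    unfolding g_def by (rule sum.swap)
  also have "\<dots> = sum_list (map g (map (\<lambda>(u, v). {u, v}) es))"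
    using sum_list_distinct_conv_sum_set[OF d, of g] s by simp
  also have "\<dots> = (\<Sum>(a, b)\<leftarrow>es. of_bool (x = a) * \<psi> b + of_bool (x = b) * \<psi> a)"
    unfolding map_map
  proof (intro arg_cong[where f = sum_list] map_cong refl)
    fix p assume p: "p \<in> set es"
    obtain a b where ab: "p = (a, b)" by (cases p)
    then have "{a, b} \<in> F" using p s by force
    then have ab': "a \<noteq> b" "a < n" "b < n" using G by (auto simp: simple_graph_def)
    have "g {a, b} = (\<Sum>y<n. (if y = b then of_bool (x = a) * \<psi> b else 0) + (if y = a then of_bool (x = b) * \<psi> a else 0))"
      unfolding g_def by (rule sum.cong) (use ab' in \<open>auto simp: doubleton_eq_iff\<close>)
    also have "\<dots> = of_bool (x = a) * \<psi> b + of_bool (x = b) * \<psi> a"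
      using ab' by (simp add: sum.distrib)
    finally show "(g \<circ> (\<lambda>(u, v). {u, v})) p = (case p of (a, b) \<Rightarrow> of_bool (x = a) * \<psi> b + of_bool (x = b) * \<psi> a)"
      by (simp add: ab)
  qed
  finally show ?thesis .
qed

section \<open>The program for forests\<close>

lemma triple_program:
  assumes "triple w (\<lambda>R M. (0, R, M) = a) C k (\<lambda>R M. R 0 = x)" "fst a = 0"
  shows "ERT w (compile 0 C) (penalty x) a \<le> of_nat k"
proof -
  obtain R M where a: "a = (0, R, M)" using assms(2) by (cases a) auto
  have "ERT w (compile 0 C) (penalty x) (0, R, M) \<le> 0 + of_nat k"
    by (rule tripleD[OF assms(1)]) (auto simp: located_def a ERT_halted chalted_def penalty_def)
  then show ?thesis by (simp add: a)
qed

lemma take_bit_mult_nat: "take_bit w (take_bit w a * take_bit w b) = take_bit w (a * b)" for a b :: nat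
  by (simp add: take_bit_eq_mod mod_simps)

lemma nth_input_words:
  assumes "e < length es"
  shows "input_words n es ! (2 + 2 * e) = fst (es ! e)" "input_words n es ! (3 + 2 * e) = snd (es ! e)"
proof -
  have "concat (map (\<lambda>(u, v). [u, v]) es) ! (2 * e) = fst (es ! e) \<and>
      concat (map (\<lambda>(u, v). [u, v]) es) ! Suc (2 * e) = snd (es ! e)"
    using assms
  proof (induction es arbitrary: e)
    case (Cons p es)
    then show ?case by (cases e) (auto simp: case_prod_beta)
  qed simp
  then show "input_words n es ! (2 + 2 * e) = fst (es ! e)" "input_words n es ! (3 + 2 * e) = snd (es ! e)"
    by (auto simp: input_words_def eval_nat_numeral)
qed

lemma length_input_words: "length (input_words n es) = 2 + 2 * length es"
  by (induction es) (auto simp: input_words_def)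

text \<open>Register 0 holds the product of the sums over the isolated vertices eliminated so far, register 3
  holds \<open>n\<close>, register 4 the number of edges, and register 5 the address of a matrix with \<open>h + 1\<close> rows
  of length \<open>n\<close>: row \<open>i < h\<close> contains the weights of the vertex of \<open>H\<close> with index \<open>i\<close>, row \<open>h\<close> is
  scratch space.\<close>

definition setup_block :: "nat \<Rightarrow> instr list" where
  "setup_block h = [Const 6 0, Load 3 6, Const 6 1, Load 4 6, Bin Add 5 4 4, Const 6 2, Bin Add 5 5 6,
     Const 0 1, Const 7 h, Bin Mul 7 7 3]"

definition ones_block :: "instr list" where
  "ones_block = [Bin Add 8 5 2, Const 9 1, Store 8 9]"

definition forest_init :: "nat \<Rightarrow> com" where
  "forest_init h = Block (setup_block h) ;; Loop 2 7 1 (Block ones_block)"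

text \<open>Registers 7, 8 and 9 receive the start addresses of the scratch row, the row of the leaf
  and the row of its neighbour.\<close>

definition leaf_block :: "nat \<Rightarrow> nat \<Rightarrow> nat \<Rightarrow> instr list" where
  "leaf_block h i j = [Const 7 h, Bin Mul 7 7 3, Bin Add 7 7 5, Const 8 i, Bin Mul 8 8 3, Bin Add 8 8 5,
     Const 9 j, Bin Mul 9 9 3, Bin Add 9 9 5]"

definition zero_block :: "instr list" where
  "zero_block = [Bin Add 10 7 2, Const 11 0, Store 10 11]"

text \<open>Edge number \<open>e\<close> occupies the words at \<open>2 * e + 2\<close> and
  \<open>2 * e + 3\<close>. Both of its orientations are added to the scratch row, as in
  \<open>nbr_sum_encodes\<close>.\<close>

definition edge_block :: "instr list" where
  "edge_block = [Bin Add 10 2 2, Const 11 2, Bin Add 10 10 11, Load 12 10,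
     Const 11 1, Bin Add 10 10 11, Load 13 10,
     Bin Add 14 7 12, Bin Add 15 8 13, Load 15 15, Load 16 14, Bin Add 16 16 15, Store 14 16,
     Bin Add 14 7 13, Bin Add 15 8 12, Load 15 15, Load 16 14, Bin Add 16 16 15, Store 14 16]"

definition mult_block :: "instr list" where
  "mult_block = [Bin Add 10 7 2, Load 10 10, Bin Add 11 9 2, Load 12 11, Bin Mul 12 12 10, Store 11 12]"

definition iso_block :: "nat \<Rightarrow> instr list" where
  "iso_block i = [Const 8 i, Bin Mul 8 8 3, Bin Add 8 8 5, Const 7 0]"

definition sum_block :: "instr list" where
  "sum_block = [Bin Add 10 8 2, Load 10 10, Bin Add 7 7 10]"

fun step_code :: "nat \<Rightarrow> ('a \<Rightarrow> nat) \<Rightarrow> 'a elim_step \<Rightarrow> com" where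
  "step_code h idx (Leaf v p) =
     Block (leaf_block h (idx v) (idx p)) ;; Loop 2 3 1 (Block zero_block) ;;
     Loop 2 4 1 (Block edge_block) ;; Loop 2 3 1 (Block mult_block)"
| "step_code h idx (Iso v) =
     Block (iso_block (idx v)) ;; Loop 2 3 1 (Block sum_block) ;; Block [Bin Mul 0 0 7]"

section \<open>Correctness of the forest program\<close>

context
  fixes w n h :: nat and es :: "(nat \<times> nat) list" and F :: "nat set set"
    and V :: "'a set" and idx :: "'a \<Rightarrow> nat"
  assumes enc: "encodes n es F" and idx: "inj_on idx V" "\<And>v. v \<in> V \<Longrightarrow> idx v < h"
    and fits: "2 * length es + 2 + Suc h * n < 2 ^ w" "h < 2 ^ w"
begin

definition cell :: "nat \<Rightarrow> nat \<Rightarrow> nat" where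
  "cell i x = 2 * length es + 2 + i * n + x"

lemma cell_eq_iff: "x < n \<Longrightarrow> y < n \<Longrightarrow> cell i x = cell j y \<longleftrightarrow> i = j \<and> x = y"
proof
  assume "x < n" "y < n" "cell i x = cell j y"
  then have "(i * n + x) div n = (j * n + y) div n" "(i * n + x) mod n = (j * n + y) mod n"
    by (simp_all add: cell_def)
  then show "i = j \<and> x = y" using \<open>x < n\<close> \<open>y < n\<close> by simp
qed simp

lemma cell_less: "i \<le> h \<Longrightarrow> x < n \<Longrightarrow> cell i x < 2 ^ w"
proof -
  assume "i \<le> h" "x < n"
  then have "i * n + x \<le> h * n + n"
    by (intro add_mono mult_right_mono) auto
  then show ?thesis using fits unfolding cell_def mult_Suc by linarith
qed

lemma base_less: "i \<le> h \<Longrightarrow> cell i 0 < 2 ^ w"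
proof -
  assume "i \<le> h"
  then have "i * n \<le> h * n" by (intro mult_right_mono) auto
  then show ?thesis using fits unfolding cell_def mult_Suc by linarith
qed

lemma cell_shift: "take_bit w (cell i 0 + x) = cell i x" if "i \<le> h" "x < n"
  using cell_less[OF that] by (simp add: cell_def take_bit_nat_eq_self)

lemma cell_base:
  assumes "i \<le> h"
  shows "take_bit w (take_bit w (take_bit w i * n) + (2 * length es + 2)) = cell i 0"
proof -
  have "i * n \<le> h * n" using assms by (intro mult_right_mono) auto
  then have "i * n < 2 ^ w" "i < 2 ^ w" using fits assms unfolding mult_Suc by linarith+
  then show ?thesis
    using base_less[OF assms] by (simp add: take_bit_nat_eq_self cell_def add.commute)
qed

lemma cell_not_input: "e < length es \<Longrightarrow> 2 + 2 * e \<noteq> cell i x" "e < length es \<Longrightarrow> 3 + 2 * e \<noteq> cell i x"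
  by (auto simp: cell_def)

text \<open>Weights are stored as residues modulo \<open>2 ^ w\<close>. Truncation commutes with all
  the arithmetic involved, so only the final count has to be bounded.\<close>

definition weights_ok :: "('a \<Rightarrow> nat \<Rightarrow> nat) \<Rightarrow> nat \<Rightarrow> (nat \<Rightarrow> nat) \<Rightarrow> (nat \<Rightarrow> nat) \<Rightarrow> bool" where
  "weights_ok \<phi> r R M \<longleftrightarrow> R 0 = take_bit w r \<and> R 3 = n \<and> R 4 = length es \<and> R 5 = 2 * length es + 2 \<and>
     (\<forall>e<length es. M (2 + 2 * e) = fst (es ! e) \<and> M (3 + 2 * e) = snd (es ! e)) \<and>
     (\<forall>v\<in>V. \<forall>x<n. M (cell (idx v) x) = take_bit w (\<phi> v x))"

lemma word_pos: "0 < w" and n_less: "n < 2 ^ w" and m_less: "length es < 2 ^ w"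
proof -
  show "0 < w" using fits by (cases w) auto
  show "n < 2 ^ w" "length es < 2 ^ w" using fits by auto
qed

lemma two_less: "(2::nat) < 2 ^ w"
  using fits by auto

lemma small_consts: "take_bit w 2 = (2::nat)" "take_bit w (Suc 0) = Suc 0" "take_bit w 1 = (1::nat)"
  by (rule take_bit_nat_eq_self, use two_less in linarith)+

lemma two_le_word: "2 \<le> w"
proof (rule ccontr)
  assume "\<not> 2 \<le> w"
  then have "w = 0 \<or> w = 1" by linarith
  then show False using two_less by auto
qed

lemma edge_bounds: "e < length es \<Longrightarrow> fst (es ! e) < n \<and> snd (es ! e) < n \<and> fst (es ! e) \<noteq> snd (es ! e)"
proof -
  assume "e < length es"
  then have "es ! e \<in> set es" by simp
  then have e: "{fst (es ! e), snd (es ! e)} \<in> F"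
    using enc by (force simp: encodes_def case_prod_beta)
  have "\<forall>e\<in>F. e \<subseteq> {..<n} \<and> card e = 2"
    using enc by (simp add: encodes_def simple_graph_def)
  from bspec[OF this e]
  have "{fst (es ! e), snd (es ! e)} \<subseteq> {..<n} \<and> card {fst (es ! e), snd (es ! e)} = 2" .
  then show ?thesis by (cases "fst (es ! e) = snd (es ! e)") auto
qed

lemma triple_Iso:
  assumes v: "v \<in> V"
  shows "triple w (weights_ok \<phi> r) (step_code h idx (Iso v)) (13 * (n + length es + 1))
    (weights_ok \<phi> (r * (\<Sum>x<n. \<phi> v x)))"
proof -
  have i: "idx v \<le> h" using idx(2)[OF v] by simp
  define J where "J j R M \<longleftrightarrow> weights_ok \<phi> r R M \<and> R 8 = cell (idx v) 0 \<and> R 7 = take_bit w (\<Sum>x<j. \<phi> v x)" for j R M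
  have 1: "triple w (weights_ok \<phi> r) (Block (iso_block (idx v))) (length (iso_block (idx v))) (J 0)"
    by (rule triple_Block) (use cell_base[OF i] in \<open>auto simp: weights_ok_def J_def iso_block_def\<close>)
  have 2: "triple w (J 0) (Loop 2 3 1 (Block sum_block)) (4 + n * (5 + length sum_block)) (J n)"
  proof (rule triple_Loop[where I = J])
    fix j assume j: "j < n"
    show "triple w (\<lambda>R M. J j R M \<and> R 2 = j \<and> R 3 = n) (Block sum_block) (length sum_block)
        (\<lambda>R M. J (Suc j) R M \<and> R 2 = j \<and> R 3 = n)"
      by (rule triple_Block) (use cell_shift[OF i j] j v in \<open>auto simp: weights_ok_def J_def sum_block_def take_bit_add\<close>)
  qed (auto simp: J_def weights_ok_def word_pos n_less)
  have 3: "triple w (J n) (Block [Bin Mul 0 0 7]) (length [Bin Mul 0 0 7]) (weights_ok \<phi> (r * (\<Sum>x<n. \<phi> v x)))"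
    by (rule triple_Block) (auto simp: weights_ok_def J_def take_bit_eq_mod mod_simps)
  show ?thesis
    unfolding step_code.simps
    by (rule triple_conseq[OF triple_Seq[OF 1 triple_Seq[OF 2 3]]])
      (auto simp: iso_block_def sum_block_def)
qed

lemma triple_Leaf:
  assumes v: "v \<in> V" and p: "p \<in> V" and vp: "v \<noteq> p"
  shows "triple w (weights_ok \<phi> r) (step_code h idx (Leaf v p)) (50 * (n + length es + 1))
    (weights_ok (\<phi>(p := \<lambda>x. \<phi> p x * nbr_sum n F (\<phi> v) x)) r)"
proof -
  have i: "idx v \<le> h" "idx p \<le> h" "idx v \<noteq> idx p" "idx v \<noteq> h" "idx p \<noteq> h"
    using idx(2)[OF v] idx(2)[OF p] idx(1) v p vp by (auto simp: inj_on_def)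
  have neh: "idx u \<noteq> h" if "u \<in> V" for u using idx(2)[OF that] by simp
  define g where "g x = (\<lambda>(a, b). of_bool (x = a) * \<phi> v b + of_bool (x = b) * \<phi> v a)" for x
  define K where "K R M \<longleftrightarrow> weights_ok \<phi> r R M \<and> R 7 = cell h 0 \<and> R 8 = cell (idx v) 0 \<and> R 9 = cell (idx p) 0" for R M
  \<comment> \<open>The scratch row is cleared (\<open>J1\<close>), collects the neighbour sums edge
    by edge (\<open>J2\<close>), and is multiplied into the row of \<open>p\<close>
    (\<open>J3\<close>); in \<open>\<psi> j\<close> this is done for the first \<open>j\<close>
    entries.\<close>
  define J1 where "J1 j R M \<longleftrightarrow> K R M \<and> (\<forall>x<j. M (cell h x) = 0)" for j R M
  define J2 where "J2 j R M \<longleftrightarrow> K R M \<and> (\<forall>x<n. M (cell h x) = take_bit w (\<Sum>e\<leftarrow>take j es. g x e))" for j R M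
  define \<psi> where "\<psi> j = \<phi>(p := \<lambda>x. if x < j then \<phi> p x * nbr_sum n F (\<phi> v) x else \<phi> p x)" for j
  define J3 where "J3 j R M \<longleftrightarrow> weights_ok (\<psi> j) r R M \<and> R 7 = cell h 0 \<and> R 9 = cell (idx p) 0 \<and>
    (\<forall>x<n. M (cell h x) = take_bit w (nbr_sum n F (\<phi> v) x))" for j R M
  have 0: "triple w (weights_ok \<phi> r) (Block (leaf_block h (idx v) (idx p))) (length (leaf_block h (idx v) (idx p))) K"
    by (rule triple_Block)
      (use cell_base[OF i(1)] cell_base[OF i(2)] cell_base[of h] in \<open>auto simp: weights_ok_def K_def leaf_block_def\<close>)
  have 1: "triple w K (Loop 2 3 1 (Block zero_block)) (4 + n * (5 + length zero_block)) (J1 n)"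
  proof (rule triple_Loop[where I = J1])
    fix j assume j: "j < n"
    show "triple w (\<lambda>R M. J1 j R M \<and> R 2 = j \<and> R 3 = n) (Block zero_block)
        (length zero_block) (\<lambda>R M. J1 (Suc j) R M \<and> R 2 = j \<and> R 3 = n)"
      by (rule triple_Block)
        (use cell_shift[OF order_refl j] j neh cell_not_input in
          \<open>auto simp: zero_block_def J1_def K_def weights_ok_def cell_eq_iff less_Suc_eq\<close>)
  qed (auto simp: J1_def K_def weights_ok_def word_pos n_less)
  have 2: "triple w (J1 n) (Loop 2 4 1 (Block edge_block)) (4 + length es * (5 + length edge_block)) (J2 (length es))"
  proof (rule triple_Loop[where I = J2])
    fix j assume j: "j < length es"
    define a b where "a = fst (es ! j)" and "b = snd (es ! j)"
    have ab: "a < n" "b < n" "a \<noteq> b" using edge_bounds[OF j] by (auto simp: a_def b_def)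
    have tk: "(\<Sum>e\<leftarrow>take (Suc j) es. g x e) = (\<Sum>e\<leftarrow>take j es. g x e) + of_bool (x = a) * \<phi> v b + of_bool (x = b) * \<phi> v a" for x
      using j by (simp add: take_Suc_conv_app_nth g_def a_def b_def case_prod_beta)
    have addr: "take_bit w (j + j) = j + j" "take_bit w (Suc (Suc (j + j))) = Suc (Suc (j + j))"
      "take_bit w (Suc (Suc (Suc (j + j)))) = Suc (Suc (Suc (j + j)))"
      using j fits by (simp_all add: take_bit_nat_eq_self)
    show "triple w (\<lambda>R M. J2 j R M \<and> R 2 = j \<and> R 4 = length es) (Block edge_block)
        (length edge_block) (\<lambda>R M. J2 (Suc j) R M \<and> R 2 = j \<and> R 4 = length es)"
    proof (rule triple_Block)
      fix R M assume A: "J2 j R M \<and> R 2 = j \<and> R 4 = length es"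
      have "M (2 + 2 * j) = a" "M (3 + 2 * j) = b"
        using A j by (auto simp: J2_def K_def weights_ok_def a_def b_def)
      then have M: "M (Suc (Suc (j + j))) = a" "M (Suc (Suc (Suc (j + j)))) = b"
        by (simp_all add: eval_nat_numeral)
      have Mv: "M (cell (idx v) x) = take_bit w (\<phi> v x)" if "x < n" for x
        using A v that by (auto simp: J2_def K_def weights_ok_def)
      define S where "S x = (\<Sum>e\<leftarrow>take j es. g x e)" for x
      have MS: "M (cell h x) = take_bit w (S x)" if "x < n" for x
        using A that by (auto simp: J2_def S_def)
      have r: "R 7 = cell h 0" "R 8 = cell (idx v) 0" "R 2 = j"
        using A by (auto simp: J2_def K_def)
      \<comment> \<open>The cells updated for the two orientations differ because \<open>a\<close>
        and \<open>b\<close> do, so the second update does not see the first.\<close>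
      define M' where "M' = M(cell h a := take_bit w (S a + \<phi> v b), cell h b := take_bit w (S b + \<phi> v a))"
      have "snd (run w edge_block R M) = M'"
        using ab i by (simp add: edge_block_def M'_def r addr M small_consts two_le_word gr_implies_not0[OF word_pos] cell_shift cell_eq_iff Mv MS take_bit_add)
      moreover have "fst (run w edge_block R M) k = R k" if "k < 10" for k
        using that by (simp add: edge_block_def)
      moreover have "weights_ok \<phi> r R M'"
        using A neh ab cell_not_input by (auto simp: J2_def K_def weights_ok_def M'_def cell_eq_iff)
      moreover have "M' (cell h x) = take_bit w (S x + of_bool (x = a) * \<phi> v b + of_bool (x = b) * \<phi> v a)" if "x < n" for x
        using that ab by (auto simp: M'_def cell_eq_iff MS)
      ultimately show "case run w edge_block R M of (R, M) \<Rightarrow> J2 (Suc j) R M \<and> R 2 = j \<and> R 4 = length es"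
        using A by (auto simp: case_prod_beta J2_def K_def weights_ok_def tk S_def)
    qed (simp add: edge_block_def)
  qed (auto simp: J1_def J2_def K_def weights_ok_def word_pos m_less)
  have 3: "triple w (J2 (length es)) (Loop 2 3 1 (Block mult_block)) (4 + n * (5 + length mult_block))
      (weights_ok (\<phi>(p := \<lambda>x. \<phi> p x * nbr_sum n F (\<phi> v) x)) r)"
  proof (rule triple_Loop[where I = J3])
    fix j assume j: "j < n"
    show "triple w (\<lambda>R M. J3 j R M \<and> R 2 = j \<and> R 3 = n) (Block mult_block)
        (length mult_block) (\<lambda>R M. J3 (Suc j) R M \<and> R 2 = j \<and> R 3 = n)"
    proof (rule triple_Block)
      fix R M assume A: "J3 j R M \<and> R 2 = j \<and> R 3 = n"
      have r: "R 7 = cell h 0" "R 9 = cell (idx p) 0" "R 2 = j"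
        using A by (auto simp: J3_def)
      have M: "M (cell (idx p) j) = take_bit w (\<phi> p j)" "M (cell h j) = take_bit w (nbr_sum n F (\<phi> v) j)"
        using A p j by (auto simp: J3_def weights_ok_def \<psi>_def)
      define M' where "M' = M(cell (idx p) j := take_bit w (\<phi> p j * nbr_sum n F (\<phi> v) j))"
      have "snd (run w mult_block R M) = M'"
        using j i by (simp add: mult_block_def M'_def r cell_shift M take_bit_mult_nat)
      moreover have "fst (run w mult_block R M) k = R k" if "k < 10" for k
        using that by (simp add: mult_block_def)
      moreover have "weights_ok (\<psi> (Suc j)) r R M'"
      proof -
        have "M' (cell (idx u) x) = take_bit w (\<psi> (Suc j) u x)" if "u \<in> V" "x < n" for u x
        proof -
          have "M (cell (idx u) x) = take_bit w (\<psi> j u x)"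
            using A that by (auto simp: J3_def weights_ok_def)
          moreover have "idx u = idx p \<longleftrightarrow> u = p"
            using idx(1) that p by (auto simp: inj_on_def)
          ultimately show ?thesis
            using that j by (auto simp: M'_def cell_eq_iff \<psi>_def)
        qed
        then show ?thesis
          using A cell_not_input by (auto simp: J3_def weights_ok_def M'_def)
      qed
      moreover have "M' (cell h x) = take_bit w (nbr_sum n F (\<phi> v) x)" if "x < n" for x
        using A that i j by (auto simp: J3_def M'_def cell_eq_iff)
      ultimately show "case run w mult_block R M of (R, M) \<Rightarrow> J3 (Suc j) R M \<and> R 2 = j \<and> R 3 = n"
        using A by (auto simp: case_prod_beta J3_def weights_ok_def)
    qed (simp add: mult_block_def)
  next
    fix R M assume A: "J2 (length es) R M"
    have "nbr_sum n F (\<phi> v) x = (\<Sum>e\<leftarrow>take (length es) es. g x e)" if "x < n" for x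
      unfolding g_def nbr_sum_encodes[OF enc that] by simp
    then show "J3 0 R M \<and> R 3 = n"
      using A by (auto simp: J2_def K_def J3_def \<psi>_def weights_ok_def)
  next
    fix R M assume "J3 n R M"
    then show "weights_ok (\<phi>(p := \<lambda>x. \<phi> p x * nbr_sum n F (\<phi> v) x)) r R M"
      by (auto simp: J3_def weights_ok_def \<psi>_def)
  qed (auto simp: J3_def weights_ok_def word_pos n_less)
  have "triple w (weights_ok \<phi> r) (step_code h idx (Leaf v p))
      (length (leaf_block h (idx v) (idx p)) + ((4 + n * (5 + length zero_block)) + ((4 + length es * (5 + length edge_block)) + (4 + n * (5 + length mult_block)))))
      (weights_ok (\<phi>(p := \<lambda>x. \<phi> p x * nbr_sum n F (\<phi> v) x)) r)"
    unfolding step_code.simps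
    by (rule triple_Seq[OF 0 triple_Seq[OF 1 triple_Seq[OF 2 3]]])
  then show ?thesis
    by (rule triple_conseq) (auto simp: leaf_block_def zero_block_def edge_block_def mult_block_def)
qed

lemma triple_forest_init:
  "triple w (\<lambda>R M. (0, R, M) = init_core w n es) (forest_init h) (14 + h * n * 8) (weights_ok (\<lambda>_ _. 1) 1)"
proof -
  define J where "J j R M \<longleftrightarrow> R 0 = 1 \<and> R 3 = n \<and> R 4 = length es \<and> R 5 = 2 * length es + 2 \<and> R 7 = h * n \<and>
     (\<forall>e<length es. M (2 + 2 * e) = fst (es ! e) \<and> M (3 + 2 * e) = snd (es ! e)) \<and>
     (\<forall>k<j. M (2 * length es + 2 + k) = 1)" for j and R M :: "nat \<Rightarrow> nat"
  have hn: "h * n < 2 ^ w" using fits unfolding mult_Suc by linarith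
  have "triple w (\<lambda>R M. (0, R, M) = init_core w n es) (Block (setup_block h)) (length (setup_block h)) (J 0)"
  proof (rule triple_Block)
    fix R M assume A: "(0::nat, R, M) = init_core w n es"
    have "M (2 + 2 * e) = fst (es ! e) \<and> M (3 + 2 * e) = snd (es ! e)" if e: "e < length es" for e
    proof -
      have "fst (es ! e) < 2 ^ w" "snd (es ! e) < 2 ^ w"
        using edge_bounds[OF e] n_less by (meson less_trans)+
      then show ?thesis
        using A e nth_input_words[OF e, of n]
        by (simp add: init_core_def length_input_words take_bit_nat_eq_self)
    qed
    moreover have "M 0 = n" "M (Suc 0) = length es"
      using A n_less m_less by (simp_all add: init_core_def input_words_def take_bit_nat_eq_self)
    moreover have "take_bit w (length es + length es) = length es + length es"
      "take_bit w (2 * length es) = 2 * length es"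
      "take_bit w (Suc (Suc (length es + length es))) = Suc (Suc (length es + length es))"
      "take_bit w (Suc (Suc (2 * length es))) = Suc (Suc (2 * length es))"
      "take_bit w h = h" "take_bit w (h * n) = h * n"
      using fits hn by (simp_all add: take_bit_nat_eq_self)
    ultimately show "case run w (setup_block h) R M of (R, M) \<Rightarrow> J 0 R M"
      by (simp add: setup_block_def J_def small_consts two_le_word word_pos)
  qed (simp add: setup_block_def)
  moreover have "triple w (J 0) (Loop 2 7 1 (Block ones_block)) (4 + h * n * (5 + length ones_block)) (weights_ok (\<lambda>_ _. 1) 1)"
  proof (rule triple_Loop[where I = J])
    fix j assume j: "j < h * n"
    have "take_bit w (2 * length es + 2 + j) = 2 * length es + 2 + j"
      using j fits unfolding mult_Suc by (intro take_bit_nat_eq_self) linarith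
    then show "triple w (\<lambda>R M. J j R M \<and> R 2 = j \<and> R 7 = h * n) (Block ones_block)
        (length ones_block) (\<lambda>R M. J (Suc j) R M \<and> R 2 = j \<and> R 7 = h * n)"
      by (intro triple_Block) (auto simp: J_def ones_block_def small_consts word_pos less_Suc_eq)
  next
    fix R M assume J: "J (h * n) R M"
    have "M (cell (idx u) x) = 1" if "u \<in> V" "x < n" for u x
    proof -
      have "idx u * n + x < Suc (idx u) * n" using that by simp
      also have "\<dots> \<le> h * n" using idx(2)[OF that(1)] by (intro mult_right_mono) auto
      finally show ?thesis using J by (simp add: J_def cell_def add.assoc)
    qed
    then show "weights_ok (\<lambda>_ _. 1) 1 R M"
      using J by (simp add: J_def weights_ok_def small_consts word_pos)
  qed (auto simp: J_def word_pos hn)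
  ultimately have "triple w (\<lambda>R M. (0, R, M) = init_core w n es) (forest_init h)
      (length (setup_block h) + (4 + h * n * (5 + length ones_block))) (weights_ok (\<lambda>_ _. 1) 1)"
    unfolding forest_init_def by (rule triple_Seq)
  then show ?thesis
    by (rule triple_conseq) (auto simp: setup_block_def ones_block_def)
qed

lemma triple_forest_steps:
  assumes "eliminates ss U E" "U \<subseteq> V"
  shows "triple w (weights_ok \<phi> r) (foldr (\<lambda>s C. step_code h idx s ;; C) ss (Block []))
     (length ss * (50 * (n + length es + 1))) (\<lambda>R M. R 0 = take_bit w (r * weighted_homs U E n F \<phi>))"
proof -
  have "triple w (weights_ok \<phi> r) (foldr (\<lambda>s C. step_code h idx s ;; C) ss (Block []))
     (length ss * (50 * (n + length es + 1))) (\<lambda>R M. R 0 = take_bit w (snd (fold (apply_step n F) ss (\<phi>, r))))"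
    using assms
  proof (induction arbitrary: \<phi> r)
    case eliminates_Nil
    have "triple w (weights_ok \<phi> r) (Block []) (length ([] :: instr list)) (\<lambda>R M. R 0 = take_bit w r)"
      by (rule triple_Block) (auto simp: weights_ok_def)
    then show ?case by simp
  next
    case (eliminates_Leaf ss U E v p)
    then have "v \<in> V" "p \<in> V" "v \<noteq> p" by auto
    from triple_Seq[OF triple_Leaf[OF this] eliminates_Leaf.IH] eliminates_Leaf.prems
    show ?case by (simp del: step_code.simps fun_upd_apply)
  next
    case (eliminates_Iso ss U E v)
    then have v: "v \<in> V" by auto
    have "triple w (weights_ok \<phi> r) (step_code h idx (Iso v)) (50 * (n + length es + 1))
      (weights_ok \<phi> (r * (\<Sum>x<n. \<phi> v x)))"
      by (rule triple_conseq[OF triple_Iso[OF v]]) auto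
    from triple_Seq[OF this eliminates_Iso.IH] eliminates_Iso.prems
    show ?case by (simp del: step_code.simps)
  qed
  then show ?thesis
    by (simp add: fold_apply_step[OF assms(1)])
qed

end

lemma hom_count_le: "finite V \<Longrightarrow> hom_count V E {..<n} F \<le> n ^ card V"
proof -
  assume fin: "finite V"
  have "hom_count V E {..<n} F \<le> card (V \<rightarrow>\<^sub>E {..<n})"
    unfolding hom_count_def graph_homs_def by (intro card_mono finite_PiE) (use fin in auto)
  also have "\<dots> = n ^ card V"
    using fin by (simp add: card_PiE)
  finally show ?thesis .
qed

lemma encodes_length:
  assumes "encodes n es F"
  shows "length es = card F"
  using assms distinct_card[of "map (\<lambda>(u, v). {u, v}) es"] by (simp add: encodes_def)

lemma encodes_length_le:
  assumes "encodes n es F"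
  shows "length es \<le> n * n"
proof -
  have d: "distinct es"
    using assms by (auto simp: encodes_def distinct_map)
  have "set es \<subseteq> {..<n} \<times> {..<n}"
  proof
    fix p assume p: "p \<in> set es"
    obtain a b where ab: "p = (a, b)" by (cases p)
    then have "{a, b} \<in> F" using p assms by (force simp: encodes_def)
    then show "p \<in> {..<n} \<times> {..<n}"
      using assms by (auto simp: encodes_def simple_graph_def ab)
  qed
  then have "card (set es) \<le> card ({..<n} \<times> {..<n})"
    by (intro card_mono) auto
  then show ?thesis
    using d by (simp add: distinct_card card_cartesian_product)
qed

text \<open>Words of size \<open>word_size c n\<close> hold every number below
  \<open>(n + 2) ^ c\<close>. The shift by 2 keeps the base at least 2 even for
  \<open>n = 0\<close>, so that a larger exponent always gives more room.\<close>

lemma power_le_word: "(n + 2) ^ c \<le> 2 ^ word_size c n"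
proof -
  have "n + 1 < 2 ^ floorlog 2 (n + 1)"
    using floorlog_bounds[of "n + 1" 2] by simp
  then have "(n + 2) ^ c \<le> (2 ^ floorlog 2 (n + 1)) ^ c"
    by (intro power_mono) auto
  also have "\<dots> = 2 ^ word_size c n"
    by (simp add: word_size_def mult.commute flip: power_mult)
  finally show ?thesis .
qed

lemma linear_time_if_forest:
  assumes forest: "forest V E"
  shows "\<exists>c P. computes c P (\<lambda>n F. hom_count V E {..<n} F) \<and> linear_time c P"
proof -
  have fin: "finite V" using forest by (simp add: forest_def simple_graph_def)
  obtain ss where ss: "eliminates ss V E" using forest_eliminates[OF forest] by blast
  define h where "h = card V"
  obtain idx where "bij_betw idx V {0..<h}"
    using ex_bij_betw_finite_nat[OF fin] by (auto simp: h_def)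
  then have idx: "inj_on idx V" "\<And>v. v \<in> V \<Longrightarrow> idx v < h"
    by (auto simp: bij_betw_def)
  define C where "C = forest_init h ;; foldr (\<lambda>s C. step_code h idx s ;; C) ss (Block [])"
  \<comment> \<open>Addresses and counts are bounded by \<open>N ^ (h + 4)\<close> with
    \<open>N = n + 2\<close>; one more factor makes the bounds strict.\<close>
  define c where "c = h + 5"
  define K where "K = 14 + 8 * h + 50 * length ss"
  have main: "ERT w (compile 0 C) (penalty (hom_count V E {..<n} F)) (init_core w n es) \<le>
      of_nat (K * (n + card F + 1))"
    if enc: "encodes n es F" and w: "w = word_size c n" for n es F w
  proof -
    define N where "N = n + 2"
    have N: "2 \<le> N" "n \<le> N" by (auto simp: N_def)
    have Nw: "N ^ c \<le> 2 ^ w" unfolding w N_def by (rule power_le_word)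
    have hN: "Suc h \<le> N ^ h"
    proof -
      have "Suc h \<le> 2 ^ h" by (induction h) auto
      also have "\<dots> \<le> N ^ h" using N by (intro power_mono) auto
      finally show ?thesis .
    qed
    have lt: "N ^ (h + 4) < N ^ c"
      unfolding c_def using N by (intro power_strict_increasing) auto
    have "2 * length es + 2 \<le> N ^ 3"
    proof -
      have "2 * length es + 2 \<le> 2 * (n * n) + 2" using encodes_length_le[OF enc] by simp
      also have "\<dots> \<le> N ^ 3" by (simp add: N_def power3_eq_cube algebra_simps)
      finally show ?thesis .
    qed
    also have "\<dots> \<le> N ^ (h + 3)" using N by (intro power_increasing) auto
    finally have 1: "2 * length es + 2 \<le> N ^ (h + 3)" .
    have "Suc h * n \<le> N ^ h * N" using hN N by (intro mult_le_mono)
    also have "\<dots> = N ^ (h + 1)" by simp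
    also have "\<dots> \<le> N ^ (h + 3)" using N by (intro power_increasing) auto
    finally have 2: "Suc h * n \<le> N ^ (h + 3)" .
    have "2 * length es + 2 + Suc h * n \<le> 2 * N ^ (h + 3)" using 1 2 by simp
    also have "\<dots> \<le> N * N ^ (h + 3)" using N by (intro mult_right_mono) auto
    also have "\<dots> = N ^ (h + 4)" by (simp add: eval_nat_numeral)
    also note lt
    also note Nw
    finally have fits: "2 * length es + 2 + Suc h * n < 2 ^ w" .
    have "h < Suc h" by simp
    also have "Suc h \<le> N ^ h" by (rule hN)
    also have "\<dots> \<le> N ^ (h + 4)" using N by (intro power_increasing) auto
    also note lt
    also note Nw
    finally have hw: "h < 2 ^ w" .
    have "hom_count V E {..<n} F \<le> n ^ h"
      unfolding h_def by (rule hom_count_le[OF fin])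
    also have "\<dots> \<le> N ^ h" using N by (intro power_mono) auto
    also have "\<dots> \<le> N ^ (h + 4)" using N by (intro power_increasing) auto
    also note lt
    also note Nw
    finally have out: "hom_count V E {..<n} F < 2 ^ w" .
    have post: "take_bit w (1 * weighted_homs V E n F (\<lambda>_ _. 1)) = hom_count V E {..<n} F"
      unfolding hom_count_eq_weighted_homs[OF fin, symmetric] mult_1 by (rule take_bit_nat_eq_self[OF out])
    have "triple w (\<lambda>R M. (0, R, M) = init_core w n es) C
       (14 + h * n * 8 + length ss * (50 * (n + length es + 1)))
       (\<lambda>R M. R 0 = take_bit w (1 * weighted_homs V E n F (\<lambda>_ _. 1)))"
      unfolding C_def
      by (rule triple_Seq[OF triple_forest_init[where idx = idx, OF enc idx fits hw]
            triple_forest_steps[where V = V and idx = idx, OF enc idx fits hw ss order_refl]])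
    then have "triple w (\<lambda>R M. (0, R, M) = init_core w n es) C
       (K * (n + card F + 1)) (\<lambda>R M. R 0 = hom_count V E {..<n} F)"
      unfolding post by (rule triple_conseq)
        (auto simp: K_def encodes_length[OF enc] algebra_simps)
    then show ?thesis
      by (rule triple_program) (simp add: init_core_def)
  qed
  have "computes c (compile 0 C) (\<lambda>n F. hom_count V E {..<n} F)"
    unfolding computes_def Let_def init_config_eq
    by (intro allI impI AE_halts_with_if_ERT_finite le_less_trans[OF main[OF _ refl] of_nat_less_top])
  moreover have "linear_time c (compile 0 C)"
    unfolding linear_time_def
  proof (intro exI[of _ "2 * real K"] allI impI)
    fix n es F assume enc: "encodes n es F" and n: "n > (0::nat)"
    have "expected_time c (compile 0 C) n es \<le> of_nat (K * (n + card F + 1))"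
      using expected_time_le_ERT[OF refl] main[OF enc refl] by (rule order_trans)
    also have "\<dots> \<le> of_nat (2 * K * (n + card F))"
    proof (rule of_nat_mono)
      \<comment> \<open>Positivity of \<open>n\<close> absorbs the additive constant into the linear
        bound.\<close>
      have "n + card F + 1 \<le> 2 * (n + card F)" using n by simp
      then show "K * (n + card F + 1) \<le> 2 * K * (n + card F)"
        using mult_le_mono2[of "n + card F + 1" "2 * (n + card F)" K] by (simp add: mult.assoc mult.left_commute)
    qed
    also have "\<dots> = ennreal (2 * real K * real (n + card F))"
      by (simp add: ennreal_of_nat_eq_real_of_nat)
    finally show "expected_time c (compile 0 C) n es \<le> ennreal (2 * real K * real (n + card F))" .
  qed
  ultimately show ?thesis by blast
qed

section \<open>The triangle gadget\<close>

text \<open>Moebius inversion on the lattice of subsets of \<open>S\<close>, after sorting the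
  elements of \<open>X\<close> by the exact value of \<open>g\<close>.\<close>

lemma sum_mobius_card:
  fixes g :: "'b \<Rightarrow> 'c set"
  assumes "finite X" "finite S" "\<And>x. x \<in> X \<Longrightarrow> g x \<subseteq> S"
  shows "(\<Sum>T\<in>Pow S. (- 1) ^ (card S - card T) * int (card {x \<in> X. g x \<subseteq> T})) =
    int (card {x \<in> X. g x = S})"
proof -
  define f where "f T = int (card {x \<in> X. g x = T})" for T
  have "int (card {x \<in> X. g x \<subseteq> T}) = sum f (Pow T)" if "finite T" for T
  proof -
    have "{x \<in> X. g x \<subseteq> T} = (\<Union>T'\<in>Pow T. {x \<in> X. g x = T'})" by auto
    also have "card \<dots> = (\<Sum>T'\<in>Pow T. card {x \<in> X. g x = T'})"
      by (rule card_UN_disjoint) (use that assms(1) in auto)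
    finally show ?thesis by (simp add: f_def)
  qed
  then show ?thesis
    using inclusion_exclusion_mobius[where S = S and g = "\<lambda>T. int (card {x \<in> X. g x \<subseteq> T})" and f = f] assms(2)
    by (simp add: f_def)
qed

context
  fixes V :: "'a set" and E :: "'a set set" and idx :: "'a \<Rightarrow> nat" and h :: nat
    and a b :: 'a and F :: "nat set set" and m :: nat and lab :: "nat \<Rightarrow> nat"
  assumes H: "simple_graph V E" and idx: "bij_betw idx V {..<h}"
    and F: "\<forall>e\<in>F. card e = 2"
    and lab: "inj_on lab (\<Union>F)" "lab ` (\<Union>F) \<subseteq> {..<2 * m}"
begin

text \<open>Base-\<open>h\<close> coordinates: the residue is the index of a vertex of H, the
  quotient the position inside its copy.\<close>

definition gvertex :: "'a \<Rightarrow> nat \<Rightarrow> nat" where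
  "gvertex v x = idx v + h * x"

definition colour :: "nat \<Rightarrow> 'a" where
  "colour z = inv_into V idx (z mod h)"

definition compatible :: "'a \<Rightarrow> 'a \<Rightarrow> nat \<Rightarrow> nat \<Rightarrow> bool" where
  "compatible i j x y \<longleftrightarrow> (if i \<in> {a, b} \<or> j \<in> {a, b} then \<exists>u v. {u, v} \<in> F \<and> x = lab u \<and> y = lab v
     else x = y \<and> x < 2 * m)"

definition gadget :: "'a set set \<Rightarrow> nat set set" where
  "gadget T = {{gvertex i x, gvertex j y} | i j x y. {i, j} \<in> T \<and> compatible i j x y}"

lemma idx_less: "v \<in> V \<Longrightarrow> idx v < h"
  using bij_betw_apply[OF idx] by simp

lemma edge_in_V: "{i, j} \<in> E \<Longrightarrow> i \<in> V \<and> j \<in> V \<and> i \<noteq> j"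
  using H by (force simp: simple_graph_def)

lemma colour_gvertex [simp]: "v \<in> V \<Longrightarrow> colour (gvertex v x) = v"
  using idx_less[of v] bij_betw_inv_into_left[OF idx, of v] by (simp add: colour_def gvertex_def)

lemma gvertex_div [simp]: "v \<in> V \<Longrightarrow> gvertex v x div h = x"
  using idx_less[of v] by (simp add: gvertex_def)

lemma gvertex_eq_iff: "i \<in> V \<Longrightarrow> j \<in> V \<Longrightarrow> gvertex i x = gvertex j y \<longleftrightarrow> i = j \<and> x = y"
  by (metis colour_gvertex gvertex_div)

lemma colour_in: "z < h * k \<Longrightarrow> colour z \<in> V \<and> z = gvertex (colour z) (z div h)"
proof -
  assume "z < h * k"
  then have "z mod h < h" by (cases "h = 0") auto
  then have "z mod h \<in> idx ` V" using idx by (auto simp: bij_betw_def)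
  then show ?thesis
    using inv_into_into[of "z mod h" idx V] f_inv_into_f[of "z mod h" idx V] by (simp add: colour_def gvertex_def)
qed

lemma compatible_sym: "compatible i j x y \<longleftrightarrow> compatible j i y x"
proof -
  have "compatible j i y x" if "compatible i j x y" for i j x y
  proof (cases "i \<in> {a, b} \<or> j \<in> {a, b}")
    case True
    then obtain u v where "{u, v} \<in> F" "x = lab u" "y = lab v"
      using \<open>compatible i j x y\<close> unfolding compatible_def by auto
    then have "\<exists>u v. {u, v} \<in> F \<and> y = lab u \<and> x = lab v"
      by (intro exI[of _ v] exI[of _ u]) (simp add: insert_commute)
    then show ?thesis using True by (simp only: compatible_def disj_commute if_True)
  qed (use \<open>compatible i j x y\<close> in \<open>simp add: compatible_def\<close>)
  then show ?thesis by blast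
qed

lemma compatible_bounds: "compatible i j x y \<Longrightarrow> x < 2 * m \<and> y < 2 * m"
  unfolding compatible_def using lab(2) by (auto split: if_splits)

text \<open>A gadget edge determines, through \<open>colour\<close>, the edge of H it was made from,
  so passing to \<open>T\<close> only deletes edges of other colours. Homomorphisms into
  \<open>gadget T\<close> are thus those into \<open>gadget E\<close> whose edge colours lie in
  \<open>T\<close>, which is the form that inclusion-exclusion needs.\<close>

lemma gadget_iff: "T \<subseteq> E \<Longrightarrow> z \<in> gadget T \<longleftrightarrow> z \<in> gadget E \<and> colour ` z \<in> T"
proof (intro iffI conjI; (elim conjE)?)
  assume T: "T \<subseteq> E" and z: "z \<in> gadget T"
  from z T show "z \<in> gadget E" unfolding gadget_def by blast
  from z obtain i j x y where z: "z = {gvertex i x, gvertex j y}" "{i, j} \<in> T"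
    unfolding gadget_def by blast
  then show "colour ` z \<in> T" using edge_in_V[of i j] T by auto
next
  assume T: "T \<subseteq> E" and z: "z \<in> gadget E" "colour ` z \<in> T"
  from z(1) obtain i j x y where ij: "z = {gvertex i x, gvertex j y}" "{i, j} \<in> E" "compatible i j x y"
    unfolding gadget_def by blast
  then have "colour ` z = {i, j}" using edge_in_V[of i j] by auto
  then show "z \<in> gadget T" using ij z(2) unfolding gadget_def by auto
qed

lemma gadget_compatible: "{gvertex i x, gvertex j y} \<in> gadget E \<Longrightarrow> i \<in> V \<Longrightarrow> j \<in> V \<Longrightarrow> compatible i j x y"
proof -
  assume "{gvertex i x, gvertex j y} \<in> gadget E" and ij: "i \<in> V" "j \<in> V"
  then obtain i' j' x' y' where *: "{gvertex i x, gvertex j y} = {gvertex i' x', gvertex j' y'}" "{i', j'} \<in> E" "compatible i' j' x' y'"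
    unfolding gadget_def by blast
  then have "i' \<in> V" "j' \<in> V" using edge_in_V by auto
  then show ?thesis
    using * ij compatible_sym[of i' j' x' y'] by (auto simp: doubleton_eq_iff gvertex_eq_iff)
qed

lemma sum_hom_count_gadget:
  "(\<Sum>T\<in>Pow E. (- 1) ^ (card E - card T) * int (hom_count V E {..<h * k} (gadget T))) =
    int (card {f \<in> graph_homs V E {..<h * k} (gadget E). (\<lambda>e. colour ` f ` e) ` E = E})"
proof -
  let ?X = "graph_homs V E {..<h * k} (gadget E)"
  have finV: "finite V" and EV: "E \<subseteq> Pow V" using H by (auto simp: simple_graph_def)
  have finE: "finite E" using finV EV by (meson finite_Pow_iff finite_subset)
  have finX: "finite ?X"
    by (rule finite_subset[of _ "V \<rightarrow>\<^sub>E {..<h * k}"]) (auto simp: graph_homs_def finV intro: finite_PiE)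
  have homs: "graph_homs V E {..<h * k} (gadget T) = {f \<in> ?X. (\<lambda>e. colour ` f ` e) ` E \<subseteq> T}" if "T \<subseteq> E" for T
    using gadget_iff[OF that] by (auto simp: graph_homs_def)
  have "(\<Sum>T\<in>Pow E. (- 1) ^ (card E - card T) * int (hom_count V E {..<h * k} (gadget T))) =
      (\<Sum>T\<in>Pow E. (- 1) ^ (card E - card T) * int (card {f \<in> ?X. (\<lambda>e. colour ` f ` e) ` E \<subseteq> T}))"
  proof (rule sum.cong[OF refl])
    fix T assume "T \<in> Pow E"
    then have "T \<subseteq> E" by simp
    then show "(- 1) ^ (card E - card T) * int (hom_count V E {..<h * k} (gadget T)) =
        (- 1) ^ (card E - card T) * int (card {f \<in> ?X. (\<lambda>e. colour ` f ` e) ` E \<subseteq> T})"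
      unfolding hom_count_def by (subst homs) (assumption, rule refl)
  qed
  also have "\<dots> = int (card {f \<in> ?X. (\<lambda>e. colour ` f ` e) ` E = E})"
  proof (rule sum_mobius_card[OF finX finE])
    fix f assume "f \<in> ?X"
    then show "(\<lambda>e. colour ` f ` e) ` E \<subseteq> E"
      using gadget_iff[OF order_refl] unfolding graph_homs_def by blast
  qed
  finally show ?thesis .
qed

text \<open>The colours of \<open>f\<close> permute the non-isolated vertices of \<open>H\<close>, so composing \<open>f\<close> with the inverse
  permutation yields a colour-preserving map.\<close>

lemma triangle_if_surjective_hom:
  assumes vs: "is_cycle E vs" "a = vs ! 0" "b = vs ! 1"
    and f: "f \<in> graph_homs V E {..<h * k} (gadget E)" "(\<lambda>e. colour ` f ` e) ` E = E"
  shows "\<not> triangle_free F"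
proof -
  define V0 where "V0 = \<Union>E"
  define \<sigma> where "\<sigma> v = colour (f v)" for v
  have finV: "finite V" and EV: "E \<subseteq> Pow V" using H by (auto simp: simple_graph_def)
  have finV0: "finite V0" using finV EV by (auto simp: V0_def intro: finite_subset)
  have fE: "f ` e \<in> gadget E" if "e \<in> E" for e using f that by (auto simp: graph_homs_def)
  have fV: "f v < h * k" if "v \<in> V" for v using f that by (auto simp: graph_homs_def)
  have \<sigma>E: "(\<lambda>e. \<sigma> ` e) ` E = E" using f(2) by (simp add: \<sigma>_def image_image)
  \<comment> \<open>A map that sends \<open>E\<close> onto \<open>E\<close> sends the union of the
    edges onto itself, and on a finite set this forces injectivity.\<close>
  have "\<sigma> ` V0 = V0" unfolding V0_def using \<sigma>E by (metis image_Union)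
  then have inj: "inj_on \<sigma> V0" using finV0 by (simp add: eq_card_imp_inj_on)
  define g where "g v = f (inv_into V0 \<sigma> v)" for v
  have gE: "g ` e \<in> gadget E" if e: "e \<in> E" for e
  proof -
    obtain e' where e': "e' \<in> E" "e = \<sigma> ` e'" using \<sigma>E e by blast
    have "e' \<subseteq> V0" using e' by (auto simp: V0_def)
    then have "g ` e = f ` e'"
      unfolding e'(2) image_image g_def
      by (intro image_cong refl) (simp add: inv_into_f_f[OF inj] subset_iff)
    then show ?thesis using fE[OF e'(1)] by simp
  qed
  \<comment> \<open>As \<open>g\<close> sends each vertex into its own copy, only the position
    inside the copy is left as information.\<close>
  define x where "x v = g v div h" for v
  have gv: "g v = gvertex v (x v)" "v \<in> V" if "v \<in> V0" for v
  proof -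
    have v: "v \<in> \<sigma> ` V0" using that \<open>\<sigma> ` V0 = V0\<close> by simp
    then have "inv_into V0 \<sigma> v \<in> V0" "\<sigma> (inv_into V0 \<sigma> v) = v"
      by (rule inv_into_into, rule f_inv_into_f)
    moreover have "V0 \<subseteq> V" using EV by (auto simp: V0_def)
    ultimately show "g v = gvertex v (x v)" "v \<in> V"
      using colour_in[OF fV, of "inv_into V0 \<sigma> v"] that by (auto simp: g_def x_def \<sigma>_def)
  qed
  have adj: "compatible i j (x i) (x j)" if "{i, j} \<in> E" for i j
  proof -
    have ij: "i \<in> V0" "j \<in> V0" using that by (auto simp: V0_def)
    have "{gvertex i (x i), gvertex j (x j)} \<in> gadget E" using gE[OF that] gv[OF ij(1)] gv[OF ij(2)] by simp
    then show ?thesis using gadget_compatible gv ij by blast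
  qed
  define l where "l = length vs"
  have l: "3 \<le> l" "distinct vs" and cyc: "\<And>i. i < l \<Longrightarrow> {vs ! i, vs ! (Suc i mod l)} \<in> E"
    using vs(1) by (auto simp: is_cycle_def l_def)
  have nab: "vs ! i \<notin> {a, b}" if "2 \<le> i" "i < l" for i
  proof -
    have "0 < length vs" "1 < length vs" "i < length vs" "i \<noteq> 0" "i \<noteq> 1"
      using that l(1) by (auto simp: l_def)
    then show ?thesis
      unfolding vs(2,3) by (simp add: nth_eq_iff_index_eq[OF l(2)] del: One_nat_def)
  qed
  define R where "R p q \<longleftrightarrow> (\<exists>u v. {u, v} \<in> F \<and> p = lab u \<and> q = lab v)" for p q
  \<comment> \<open>From index 2 on the cycle avoids \<open>a\<close> and \<open>b\<close>, so its
    edges there are matchings and the position stays constant. On a 3-cycle there is only one such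
    index.\<close>
  have same: "x (vs ! i) = x (vs ! 2)" if "2 \<le> i" "i < l" for i
    using that
  proof (induction i rule: dec_induct)
    case (step i)
    have "compatible (vs ! i) (vs ! Suc i) (x (vs ! i)) (x (vs ! Suc i))"
      using cyc[of i] step by (intro adj) simp
    then show ?case using step nab[of i] nab[of "Suc i"] by (auto simp: compatible_def)
  qed simp
  have relR: "R p q" if "compatible i j p q" "i \<in> {a, b} \<or> j \<in> {a, b}" for i j p q
    using that by (simp only: compatible_def R_def if_True)
  have "{a, b} \<in> E" "{b, vs ! 2} \<in> E" "{vs ! (l - 1), a} \<in> E"
    using cyc[of 0] cyc[of 1] cyc[of "l - 1"] l(1) unfolding vs(2,3) by (simp_all add: numeral_2_eq_2)
  from this[THEN adj] have "R (x a) (x b)" "R (x b) (x (vs ! 2))" "R (x (vs ! (l - 1))) (x a)"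
    by (auto elim!: relR)
  moreover have "x (vs ! (l - 1)) = x (vs ! 2)"
    using same[of "l - 1"] l(1) by simp
  \<comment> \<open>Three adjacencies of \<open>F\<close> close up: injectivity of
    \<open>lab\<close> identifies their ends, and edges of size 2 make the three vertices
    distinct.\<close>
  ultimately obtain u1 v1 u2 v2 u3 v3 where
    e: "{u1, v1} \<in> F" "{u2, v2} \<in> F" "{u3, v3} \<in> F" and
    lb: "lab v1 = lab u2" "lab v2 = lab u3" "lab v3 = lab u1"
    unfolding R_def by auto
  have "v1 = u2" by (rule inj_onD[OF lab(1) lb(1)]) (use e in auto)
  moreover have "v2 = u3" by (rule inj_onD[OF lab(1) lb(2)]) (use e in auto)
  moreover have "v3 = u1" by (rule inj_onD[OF lab(1) lb(3)]) (use e in auto)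
  moreover have "card {u1, v1} = 2" "card {u2, v2} = 2" "card {u3, v3} = 2"
    using e F by blast+
  then have "u1 \<noteq> v1" "u2 \<noteq> v2" "u3 \<noteq> v3" by auto
  ultimately have "u1 \<noteq> u2 \<and> u2 \<noteq> u3 \<and> u1 \<noteq> u3 \<and> {u1, u2} \<in> F \<and> {u2, u3} \<in> F \<and> {u1, u3} \<in> F"
    using e by (auto simp: insert_commute)
  then show ?thesis
    unfolding triangle_free_def by blast
qed

text \<open>Send \<open>a\<close> and \<open>b\<close> to two corners of the triangle and all other
  vertices of H to the third. Edges meeting \<open>a\<close> or \<open>b\<close> then join different
  corners, and all others join equal positions, as the matchings allow.\<close>

lemma surjective_hom_if_triangle:
  assumes tr: "\<not> triangle_free F" and ab: "a \<noteq> b"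
  shows "\<exists>f. f \<in> graph_homs V E {..<h * (2 * m + 1)} (gadget E) \<and> (\<lambda>e. colour ` f ` e) ` E = E"
proof -
  obtain p q r where t: "{p, q} \<in> F" "{q, r} \<in> F" "{p, r} \<in> F"
    using tr unfolding triangle_free_def by blast
  define \<phi> where "\<phi> v = (if v = a then p else if v = b then q else r)" for v
  define f where "f = restrict (\<lambda>v. gvertex v (lab (\<phi> v))) V"
  have lab_less: "lab (\<phi> v) < 2 * m" for v
    using t lab(2) by (auto simp: \<phi>_def)
  have colf: "colour ` f ` e = e" if "e \<subseteq> V" for e
  proof -
    have "colour (f v) = v" if "v \<in> e" for v using that \<open>e \<subseteq> V\<close> by (auto simp: f_def)
    then show ?thesis by (simp add: image_image)
  qed
  have "f v < h * (2 * m + 1)" if "v \<in> V" for v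
  proof -
    have "f v < h * (lab (\<phi> v) + 1)" using idx_less[OF that] that by (simp add: f_def gvertex_def)
    also have "\<dots> \<le> h * (2 * m + 1)" using lab_less[of v] by (intro mult_left_mono) auto
    finally show ?thesis .
  qed
  moreover have "f ` e \<in> gadget E" if e: "e \<in> E" for e
  proof -
    obtain i j where ij: "e = {i, j}" "i \<noteq> j" using H e by (auto simp: simple_graph_def card_2_iff)
    have V: "i \<in> V" "j \<in> V" using edge_in_V e ij by auto
    have "compatible i j (lab (\<phi> i)) (lab (\<phi> j))"
    proof (cases "i \<in> {a, b} \<or> j \<in> {a, b}")
      case True
      then have "{\<phi> i, \<phi> j} \<in> F" using t ij(2) ab by (auto simp: \<phi>_def insert_commute)
      then show ?thesis using True by (auto simp: compatible_def)
    next
      case False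
      then show ?thesis using lab_less[of i] by (simp add: compatible_def \<phi>_def)
    qed
    then show ?thesis using e V unfolding gadget_def ij(1) f_def by auto
  qed
  ultimately have "f \<in> graph_homs V E {..<h * (2 * m + 1)} (gadget E)"
    by (auto simp: graph_homs_def f_def)
  moreover have "(\<lambda>e. colour ` f ` e) ` E = E"
    using colf H by (auto simp: simple_graph_def image_iff)
  ultimately show ?thesis by blast
qed

text \<open>The upper bound on \<open>k\<close> is recorded because the program knows the sum only
  modulo a power of 2; the bound makes the test for zero reliable.\<close>

lemma gadget_sum_detects_triangles:
  assumes vs: "is_cycle E vs" "a = vs ! 0" "b = vs ! 1"
  obtains k where
    "(\<Sum>T\<in>Pow E. (- 1) ^ (card E - card T) * int (hom_count V E {..<h * (2 * m + 1)} (gadget T))) = int k"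
    "k = 0 \<longleftrightarrow> triangle_free F" "k \<le> hom_count V E {..<h * (2 * m + 1)} (gadget E)"
proof
  let ?X = "graph_homs V E {..<h * (2 * m + 1)} (gadget E)"
  let ?Y = "{f \<in> ?X. (\<lambda>e. colour ` f ` e) ` E = E}"
  have "finite V" using H by (simp add: simple_graph_def)
  then have "finite (V \<rightarrow>\<^sub>E {..<h * (2 * m + 1)})" by (simp add: finite_PiE)
  then have fin: "finite ?X"
    by (rule rev_finite_subset) (simp add: graph_homs_def)
  have "distinct vs" "0 < length vs" "1 < length vs" using vs(1) by (auto simp: is_cycle_def)
  then have "a \<noteq> b" unfolding vs(2,3) by (simp add: nth_eq_iff_index_eq)
  show "(\<Sum>T\<in>Pow E. (- 1) ^ (card E - card T) * int (hom_count V E {..<h * (2 * m + 1)} (gadget T))) = int (card ?Y)"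
    by (rule sum_hom_count_gadget)
  show "card ?Y \<le> hom_count V E {..<h * (2 * m + 1)} (gadget E)"
    unfolding hom_count_def by (rule card_mono[OF fin]) auto
  have "?Y = {} \<longleftrightarrow> triangle_free F"
  proof
    show "triangle_free F" if "?Y = {}"
    proof (rule ccontr)
      assume "\<not> triangle_free F"
      then obtain f where "f \<in> ?X \<and> (\<lambda>e. colour ` f ` e) ` E = E"
        using surjective_hom_if_triangle[OF _ \<open>a \<noteq> b\<close>] by meson
      then have "f \<in> ?Y" by simp
      then show False using that by (metis empty_iff)
    qed
    show "?Y = {}" if "triangle_free F"
    proof (rule equals0I)
      fix f assume "f \<in> ?Y"
      then have "f \<in> ?X" "(\<lambda>e. colour ` f ` e) ` E = E" by simp_all
      from triangle_if_surjective_hom[OF vs this] that show False by simp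
    qed
  qed
  then show "card ?Y = 0 \<longleftrightarrow> triangle_free F"
    using fin by simp
qed

end

text \<open>Vertices are renamed to the last position at which they occur among the \<open>2 * m\<close> endpoints of the
  edge list. This takes time \<open>O(m)\<close> however many isolated vertices there are, which matters because
  \<open>worst_case_time\<close> is a supremum over all \<open>n\<close>. Each vertex of \<open>H\<close> gets \<open>2 * m + 1\<close> copies rather than
  \<open>2 * m\<close>, since \<open>linear_time\<close> says nothing about graphs without vertices.\<close>

primrec label :: "(nat \<Rightarrow> nat) \<Rightarrow> nat \<Rightarrow> nat \<Rightarrow> nat" where
  "label u 0 = (\<lambda>_. 0)"
| "label u (Suc j) = (label u j)(u j := j)"

text \<open>The label of an endpoint is a position at which it occurs, so \<open>u\<close> is a left
  inverse of the labelling; hence labels are injective on endpoints.\<close>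

lemma label_less: "k < j \<Longrightarrow> u (label u j (u k)) = u k \<and> label u j (u k) < j"
  by (induction j) (auto simp: less_Suc_eq)

definition endpoint :: "(nat \<times> nat) list \<Rightarrow> nat \<Rightarrow> nat" where
  "endpoint es j = (if even j then fst (es ! (j div 2)) else snd (es ! (j div 2)))"

abbreviation edge_label :: "(nat \<times> nat) list \<Rightarrow> nat \<Rightarrow> nat" where
  "edge_label es \<equiv> label (endpoint es) (2 * length es)"

text \<open>Edge number \<open>e\<close> of \<open>G\<close> contributes two edges for each edge \<open>ij\<close> of \<open>H\<close>: both orientations of
  itself if \<open>ij\<close> meets \<open>A\<close>, and the copies \<open>2 * e\<close> and \<open>2 * e + 1\<close> of the matching otherwise.\<close>

definition gpair ::
  "('a \<Rightarrow> nat) \<Rightarrow> nat \<Rightarrow> 'a set \<Rightarrow> (nat \<times> nat) list \<Rightarrow> nat \<Rightarrow> 'a \<times> 'a \<Rightarrow> bool \<Rightarrow> nat \<times> nat" where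
  "gpair idx h A es e ij c =
     (let l = edge_label es; u = fst (es ! e); v = snd (es ! e);
          (x, y) = (if fst ij \<in> A \<or> snd ij \<in> A then (if c then (l v, l u) else (l u, l v))
                    else (2 * e + of_bool c, 2 * e + of_bool c))
      in (idx (fst ij) + h * x, idx (snd ij) + h * y))"

definition gpairs ::
  "('a \<Rightarrow> nat) \<Rightarrow> nat \<Rightarrow> 'a set \<Rightarrow> (nat \<times> nat) list \<Rightarrow> ('a \<times> 'a) list \<Rightarrow> nat \<Rightarrow> (nat \<times> nat) list" where
  "gpairs idx h A es S e = concat (map (\<lambda>ij. [gpair idx h A es e ij False, gpair idx h A es e ij True]) S)"

definition gedges ::
  "('a \<Rightarrow> nat) \<Rightarrow> nat \<Rightarrow> 'a set \<Rightarrow> (nat \<times> nat) list \<Rightarrow> ('a \<times> 'a) list \<Rightarrow> (nat \<times> nat) list" where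
  "gedges idx h A es S = concat (map (gpairs idx h A es S) [0..<length es])"

abbreviation mk_edge :: "'a \<times> 'a \<Rightarrow> 'a set" where
  "mk_edge p \<equiv> {fst p, snd p}"

section \<open>Correctness of the edge list of the gadget\<close>

lemma mk_edge_eq: "(\<lambda>(u, v). {u, v}) = mk_edge"
  by auto

lemma length_gpairs: "length (gpairs idx h A es S e) = 2 * length S"
  unfolding gpairs_def by (induction S) auto

lemma gedges_eq: "gedges idx h A es S =
  map (\<lambda>(e, ij, c). gpair idx h A es e ij c) (List.product [0..<length es] (List.product S [False, True]))"
proof -
  have *: "gpairs idx h A es S = (\<lambda>e. map (\<lambda>(ij, c). gpair idx h A es e ij c) (List.product S [False, True]))"
  proof
    show "gpairs idx h A es S e = map (\<lambda>(ij, c). gpair idx h A es e ij c) (List.product S [False, True])" for e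
      unfolding gpairs_def by (induction S) auto
  qed
  show ?thesis
    unfolding gedges_def product_concat_map[of "[0..<length es]"]
    by (simp add: map_concat o_def * case_prod_unfold)
qed

lemma length_gedges: "length (gedges idx h A es S) = 2 * length es * length S"
  by (simp add: gedges_eq)

context
  fixes n :: nat and es :: "(nat \<times> nat) list" and F :: "nat set set"
  assumes enc: "encodes n es F"
begin

lemma edges_eq: "F = mk_edge ` set es" and edges_card: "\<forall>e\<in>F. card e = 2" and edges_subset: "\<forall>e\<in>F. e \<subseteq> {..<n}"
  and edge_list_inj: "distinct es" "inj_on mk_edge (set es)"
  using enc by (auto simp: encodes_def simple_graph_def mk_edge_eq distinct_map)

lemma endpoint_ends: "e < length es \<Longrightarrow> fst (es ! e) = endpoint es (2 * e) \<and> snd (es ! e) = endpoint es (Suc (2 * e))"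
  by (simp add: endpoint_def)

lemma Union_edges_subset: "\<Union>F \<subseteq> endpoint es ` {..<2 * length es}"
proof
  fix x assume "x \<in> \<Union>F"
  then obtain p where p: "p \<in> set es" "x = fst p \<or> x = snd p" by (auto simp: edges_eq)
  then obtain e where e: "e < length es" "p = es ! e" by (metis in_set_conv_nth)
  then have "x = endpoint es (2 * e) \<or> x = endpoint es (Suc (2 * e))"
    using p endpoint_ends[OF e(1)] by simp
  moreover have "2 * e < 2 * length es" "Suc (2 * e) < 2 * length es" using e(1) by auto
  ultimately show "x \<in> endpoint es ` {..<2 * length es}" by blast
qed

lemma endpoint_label: "x \<in> \<Union>F \<Longrightarrow> endpoint es (edge_label es x) = x \<and> edge_label es x < 2 * length es"
  using Union_edges_subset label_less[of _ "2 * length es" "endpoint es"] by blast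

lemma label_inj: "inj_on (edge_label es) (\<Union>F)"
  by (rule inj_on_inverseI) (rule conjunct1[OF endpoint_label])

lemma label_bound: "edge_label es ` (\<Union>F) \<subseteq> {..<2 * length es}"
  using endpoint_label by blast

lemma ends_in_edges: "e < length es \<Longrightarrow> mk_edge (es ! e) \<in> F \<and> fst (es ! e) \<noteq> snd (es ! e)"
proof -
  assume "e < length es"
  then have e: "mk_edge (es ! e) \<in> F" by (simp add: edges_eq)
  then have "card (mk_edge (es ! e)) = 2" using edges_card by blast
  then show ?thesis using e by (cases "fst (es ! e) = snd (es ! e)") auto
qed

context
  fixes V :: "'a set" and E :: "'a set set" and idx :: "'a \<Rightarrow> nat" and h :: nat and a b :: 'a
    and S :: "('a \<times> 'a) list"
  assumes H: "simple_graph V E" and idx: "bij_betw idx V {..<h}"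
    and S: "distinct (map mk_edge S)" "mk_edge ` set S \<subseteq> E"
begin

abbreviation "GV \<equiv> gvertex idx h"
abbreviation "GR \<equiv> compatible a b F (length es) (edge_label es)"
abbreviation "GG \<equiv> gadget idx h a b F (length es) (edge_label es)"

lemmas gadget_facts = H idx edges_card label_inj label_bound

lemma gpair_compatible:
  assumes "e < length es"
  shows "\<exists>x y. gpair idx h {a, b} es e ij c = (GV (fst ij) x, GV (snd ij) y) \<and> GR (fst ij) (snd ij) x y"
proof (cases "fst ij \<in> {a, b} \<or> snd ij \<in> {a, b}")
  case True
  have "{fst (es ! e), snd (es ! e)} \<in> F" "{snd (es ! e), fst (es ! e)} \<in> F"
    using ends_in_edges[OF assms] by (auto simp: insert_commute)
  then show ?thesis
    using True unfolding gpair_def compatible_def[OF gadget_facts] gvertex_def[OF gadget_facts]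
    by (cases c) (auto simp: Let_def)
next
  case False
  have "2 * e + of_bool c < 2 * length es" using assms by (cases c) auto
  then show ?thesis
    using False unfolding gpair_def compatible_def[OF gadget_facts] gvertex_def[OF gadget_facts]
    by (auto simp: Let_def)
qed

text \<open>An encoding must list every edge once. Colours give back \<open>ij\<close>; then either
  injective labels give back the edge of G with its orientation, or the matched position
  \<open>2 * e + of_bool c\<close> gives back \<open>e\<close> and \<open>c\<close> by
  parity.\<close>

lemma gpair_inj:
  assumes "e < length es" "e' < length es" "ij \<in> set S" "ij' \<in> set S"
    and "mk_edge (gpair idx h {a, b} es e ij c) = mk_edge (gpair idx h {a, b} es e' ij' c')"
  shows "e = e' \<and> ij = ij' \<and> c = c'"
proof -
  define l where "l = edge_label es"
  obtain x y where xy: "gpair idx h {a, b} es e ij c = (GV (fst ij) x, GV (snd ij) y)"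
    using gpair_compatible[OF assms(1)] by blast
  obtain x' y' where xy': "gpair idx h {a, b} es e' ij' c' = (GV (fst ij') x', GV (snd ij') y')"
    using gpair_compatible[OF assms(2)] by blast
  have "{fst ij, snd ij} \<in> E" "{fst ij', snd ij'} \<in> E" using S(2) assms(3,4) by auto
  then have V: "fst ij \<in> V" "snd ij \<in> V" "fst ij \<noteq> snd ij" "fst ij' \<in> V" "snd ij' \<in> V"
    using edge_in_V[OF gadget_facts] by auto
  have "colour V idx h ` mk_edge (gpair idx h {a, b} es e ij c) = mk_edge ij"
    "colour V idx h ` mk_edge (gpair idx h {a, b} es e' ij' c') = mk_edge ij'"
    using V by (simp_all add: xy xy' colour_gvertex[OF gadget_facts])
  then have "mk_edge ij = mk_edge ij'" using assms(5) by simp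
  then have ij: "ij = ij'"
    using S(1) assms(3,4) by (auto simp: distinct_map dest: inj_onD)
  have same: "gpair idx h {a, b} es e ij c = gpair idx h {a, b} es e' ij c'"
  proof -
    have "{GV (fst ij) x, GV (snd ij) y} = {GV (fst ij) x', GV (snd ij) y'}"
      using assms(5) unfolding xy xy' by (simp add: ij)
    then have "x = x' \<and> y = y'"
      using V by (simp add: doubleton_eq_iff gvertex_eq_iff[OF gadget_facts])
    then show ?thesis using xy xy' ij by simp
  qed
  have h: "h > 0" using V(1) idx by (cases h) (auto simp: bij_betw_def)
  show ?thesis
  proof (cases "fst ij \<in> {a, b} \<or> snd ij \<in> {a, b}")
    case True
    define p where "p e c = (if c then (snd (es ! e), fst (es ! e)) else (fst (es ! e), snd (es ! e)))" for e and c :: bool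
    have "(l (fst (p e c)), l (snd (p e c))) = (l (fst (p e' c')), l (snd (p e' c')))"
      using same True h by (cases c; cases c') (auto simp: gpair_def Let_def p_def l_def)
    moreover have "fst (p e c) \<in> \<Union>F" "snd (p e c) \<in> \<Union>F" "fst (p e' c') \<in> \<Union>F" "snd (p e' c') \<in> \<Union>F"
      using ends_in_edges[OF assms(1)] ends_in_edges[OF assms(2)] by (auto simp: p_def)
    ultimately have p: "p e c = p e' c'"
      using label_inj unfolding l_def by (auto simp: prod_eq_iff dest: inj_onD)
    have "mk_edge (p e c) = mk_edge (es ! e)" "mk_edge (p e' c') = mk_edge (es ! e')"
      by (auto simp: p_def)
    then have "es ! e = es ! e'"
      using p edge_list_inj(2) assms(1,2) by (auto dest: inj_onD)
    then have "e = e'" using edge_list_inj(1) assms(1,2) by (simp add: nth_eq_iff_index_eq)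
    moreover have "c = c'"
    proof (rule ccontr)
      assume "c \<noteq> c'"
      then have "fst (p e c) \<noteq> fst (p e c')"
        using conjunct2[OF ends_in_edges[OF assms(1)]] by (cases c; cases c') (simp_all add: p_def)
      then show False using p unfolding \<open>e = e'\<close> by metis
    qed
    ultimately show ?thesis using ij by simp
  next
    case False
    then have "2 * e + of_bool c = 2 * e' + of_bool c'"
      using same h by (simp add: gpair_def Let_def)
    then have "e = e' \<and> c = c'" by (cases c; cases c'; simp; presburger)
    then show ?thesis using ij by simp
  qed
qed

lemma set_gedges: "mk_edge ` set (gedges idx h {a, b} es S) = GG (mk_edge ` set S)"
proof (intro equalityI subsetI)
  fix z assume "z \<in> mk_edge ` set (gedges idx h {a, b} es S)"
  then obtain e ij c where e: "e < length es" "ij \<in> set S" "z = mk_edge (gpair idx h {a, b} es e ij c)"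
    by (auto simp: gedges_eq)
  then show "z \<in> GG (mk_edge ` set S)"
    using gpair_compatible[OF e(1), of ij c] unfolding gadget_def[OF gadget_facts] by fastforce
next
  fix z assume "z \<in> GG (mk_edge ` set S)"
  then obtain i j x y where z: "z = {GV i x, GV j y}" "{i, j} \<in> mk_edge ` set S" "GR i j x y"
    unfolding gadget_def[OF gadget_facts] by blast
  then obtain ij where ij: "ij \<in> set S" "{i, j} = mk_edge ij" by blast
  have "\<exists>x y. z = {GV (fst ij) x, GV (snd ij) y} \<and> GR (fst ij) (snd ij) x y"
    using ij(2) z compatible_sym[OF gadget_facts, of a b i j x y] by (auto simp: doubleton_eq_iff insert_commute)
  then obtain x y where z: "z = {GV (fst ij) x, GV (snd ij) y}" "GR (fst ij) (snd ij) x y"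
    by blast
  have "\<exists>e<length es. \<exists>c. gpair idx h {a, b} es e ij c = (GV (fst ij) x, GV (snd ij) y)"
  proof (cases "fst ij \<in> {a, b} \<or> snd ij \<in> {a, b}")
    case True
    then obtain u v where uv: "{u, v} \<in> F" "x = edge_label es u" "y = edge_label es v"
      using z(2) unfolding compatible_def[OF gadget_facts] by auto
    then obtain e where e: "e < length es" "{u, v} = mk_edge (es ! e)"
      by (auto simp: edges_eq in_set_conv_nth)
    then have "(u = fst (es ! e) \<and> v = snd (es ! e)) \<or> (u = snd (es ! e) \<and> v = fst (es ! e))"
      by (auto simp: doubleton_eq_iff)
    then have "gpair idx h {a, b} es e ij False = (GV (fst ij) x, GV (snd ij) y) \<or>
        gpair idx h {a, b} es e ij True = (GV (fst ij) x, GV (snd ij) y)"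
      using True uv unfolding gpair_def gvertex_def[OF gadget_facts] by (auto simp: Let_def)
    then show ?thesis using e(1) by blast
  next
    case False
    then have xy: "x = y" "x < 2 * length es"
      using z(2) unfolding compatible_def[OF gadget_facts] by auto
    \<comment> \<open>Each of the \<open>2 * length es\<close> matching positions is served by one
      input edge, namely number \<open>x div 2\<close>; parity selects the copy.\<close>
    have "x = 2 * (x div 2) + of_bool (odd x)" by simp
    then have "gpair idx h {a, b} es (x div 2) ij (odd x) = (GV (fst ij) x, GV (snd ij) y)"
      using False xy(1) unfolding gpair_def gvertex_def[OF gadget_facts] by (auto simp: Let_def)
    moreover have "x div 2 < length es" using xy(2) by auto
    ultimately show ?thesis by blast
  qed
  then obtain e c where e: "e < length es" "gpair idx h {a, b} es e ij c = (GV (fst ij) x, GV (snd ij) y)"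
    by blast
  then have "z = mk_edge (gpair idx h {a, b} es e ij c)"
    by (simp add: z(1))
  with e(1) show "z \<in> mk_edge ` set (gedges idx h {a, b} es S)"
    using ij(1) by (auto simp: gedges_eq intro!: image_eqI[of _ _ "gpair idx h {a, b} es e ij c"]
      image_eqI[of _ _ "(e, ij, c)"])
qed

lemma encodes_gedges:
  "encodes (h * (2 * length es + 1)) (gedges idx h {a, b} es S) (GG (mk_edge ` set S))"
  unfolding encodes_def mk_edge_eq
proof (intro conjI)
  show "set (map mk_edge (gedges idx h {a, b} es S)) = GG (mk_edge ` set S)"
    using set_gedges by simp
  have dS: "distinct S" using S(1) by (simp add: distinct_map)
  show "distinct (map mk_edge (gedges idx h {a, b} es S))"
    unfolding gedges_eq map_map distinct_map
  proof (intro conjI inj_onI)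
    show "distinct (List.product [0..<length es] (List.product S [False, True]))"
      by (simp add: distinct_product dS)
    fix p q
    assume pq: "p \<in> set (List.product [0..<length es] (List.product S [False, True]))"
      "q \<in> set (List.product [0..<length es] (List.product S [False, True]))"
      "(mk_edge \<circ> (\<lambda>(e, ij, c). gpair idx h {a, b} es e ij c)) p =
       (mk_edge \<circ> (\<lambda>(e, ij, c). gpair idx h {a, b} es e ij c)) q"
    obtain e ij c e' ij' c' where "p = (e, ij, c)" "q = (e', ij', c')"
      by (metis prod_cases3)
    then show "p = q"
      using pq gpair_inj[of e e' ij ij' c c'] by (simp del: prod.collapse)
  qed
  show "simple_graph {..<h * (2 * length es + 1)} (GG (mk_edge ` set S))"
    unfolding simple_graph_def
  proof (intro conjI ballI)
    fix z assume "z \<in> GG (mk_edge ` set S)"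
    then obtain i j x y where z: "z = {GV i x, GV j y}" "{i, j} \<in> mk_edge ` set S" "GR i j x y"
      unfolding gadget_def[OF gadget_facts] by blast
    then have ij: "i \<in> V" "j \<in> V" "i \<noteq> j"
      using edge_in_V[OF gadget_facts] S(2) by blast+
    have less: "GV k w < h * (2 * length es + 1)" if "k \<in> V" "w < 2 * length es" for k w
    proof -
      have "GV k w < h * (w + 1)" using idx_less[OF gadget_facts that(1)] by (simp add: gvertex_def[OF gadget_facts])
      also have "\<dots> \<le> h * (2 * length es + 1)" using that(2) by (intro mult_left_mono) auto
      finally show ?thesis .
    qed
    show "z \<subseteq> {..<h * (2 * length es + 1)}"
      using compatible_bounds[OF gadget_facts z(3)] ij less by (auto simp: z(1))
    have "GV i x \<noteq> GV j y" using ij by (simp add: gvertex_eq_iff[OF gadget_facts])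
    then show "card z = 2" by (simp add: z(1))
  qed simp
qed

end

end

section \<open>The program for triangle detection\<close>

lemma run_append: "run w (xs @ ys) R M = (case run w xs R M of (R', M') \<Rightarrow> run w ys R' M')"
  by (induction w xs R M rule: run.induct) (simp_all del: fun_upd_apply)

text \<open>Registers: 0 accumulator, 1 scratch, 2 loop counter, 3 number \<open>m\<close> of edges, 4 address of the label
  table, 5 number of vertices of the gadget, 6 and 7 the word range \<open>2 ^ v\<close> of the simulated machine
  and its mask, 8 base address of the current call, 9 write pointer, 11 to 14 the labels and matching
  indices of the current edge, 17 and 18 loop bounds, from 20 on the simulated registers.\<close>

definition emit :: "nat \<Rightarrow> instr list" where
  "emit r = [Bin And 10 r 7, Store 9 10, Const 10 1, Bin Add 9 9 10]"

definition put :: "nat \<Rightarrow> nat \<Rightarrow> nat \<Rightarrow> instr list" where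
  "put h i x = [Const 15 h, Bin Mul 15 15 x, Const 16 i, Bin Add 15 15 16] @ emit 15"

definition put_pair :: "('a \<Rightarrow> nat) \<Rightarrow> nat \<Rightarrow> 'a \<times> 'a \<Rightarrow> nat \<Rightarrow> nat \<Rightarrow> instr list" where
  "put_pair idx h ij x y = put h (idx (fst ij)) x @ put h (idx (snd ij)) y"

definition put_edges :: "('a \<Rightarrow> nat) \<Rightarrow> nat \<Rightarrow> 'a set \<Rightarrow> 'a \<times> 'a \<Rightarrow> instr list" where
  "put_edges idx h A ij =
     (if fst ij \<in> A \<or> snd ij \<in> A then put_pair idx h ij 11 12 @ put_pair idx h ij 12 11
      else put_pair idx h ij 13 13 @ put_pair idx h ij 14 14)"

definition fetch :: "instr list" where
  "fetch = [Bin Add 13 2 2, Const 15 2, Bin Add 15 15 13, Load 11 15, Bin Add 11 11 4, Load 11 11,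
     Const 16 1, Bin Add 15 15 16, Load 12 15, Bin Add 12 12 4, Load 12 12, Bin Add 14 13 16]"

text \<open>Adding a zero register serves as a move instruction. The first two words written are the
  numbers of vertices and edges, as \<open>input_words\<close> prescribes.\<close>

definition gadget_code :: "('a \<Rightarrow> nat) \<Rightarrow> nat \<Rightarrow> 'a set \<Rightarrow> ('a \<times> 'a) list \<Rightarrow> com" where
  "gadget_code idx h A S =
     Block ([Const 15 0, Bin Add 9 8 15] @ emit 5 @ [Const 15 (2 * length S), Bin Mul 15 15 3] @ emit 15) ;;
     Loop 2 3 1 (Block (fetch @ concat (map (put_edges idx h A) S)))"

definition clear_code :: "nat \<Rightarrow> instr list" where
  "clear_code nr = map (\<lambda>r. Const (20 + r) 0) [0..<nr]"

text \<open>Every call gets a region of memory above all addresses used before, which is still zero as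
  \<open>init_config\<close> demands; only the simulated registers must be cleared.\<close>

definition call_code :: "('a \<Rightarrow> nat) \<Rightarrow> nat \<Rightarrow> 'a set \<Rightarrow> program \<Rightarrow> nat \<Rightarrow> ('a \<times> 'a) list \<Rightarrow> bool \<Rightarrow> com" where
  "call_code idx h A P nr S neg = gadget_code idx h A S ;; Block (clear_code nr) ;; Sim P 20 1 7 8 ;;
     Block [Bin (if neg then Sub else Add) 0 0 20, Bin Add 8 9 6]"

definition calls_code ::
  "('a \<Rightarrow> nat) \<Rightarrow> nat \<Rightarrow> 'a set \<Rightarrow> program \<Rightarrow> nat \<Rightarrow> (('a \<times> 'a) list \<Rightarrow> bool) \<Rightarrow> ('a \<times> 'a) list list \<Rightarrow> com" where
  "calls_code idx h A P nr neg Ss =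
     foldr (\<lambda>S C. call_code idx h A P nr S (neg S) ;; C) Ss (Block [Const 15 0, Bin Eq 0 0 15])"

definition signed_sum :: "('b \<Rightarrow> bool) \<Rightarrow> ('b \<Rightarrow> nat) \<Rightarrow> 'b list \<Rightarrow> int" where
  "signed_sum neg out Ss = (\<Sum>S\<leftarrow>Ss. (if neg S then - 1 else 1) * int (out S))"

text \<open>Behind the input lies a label table of \<open>n\<close> cells, and register 8 points
  past it. Only the cells of endpoints are ever written, so the table causes no cost proportional to
  \<open>n\<close>.\<close>

definition init_block :: "nat \<Rightarrow> instr list" where
  "init_block h = [Const 15 1, Load 3 15, Bin Add 17 3 3, Const 15 2, Bin Add 4 17 15, Const 15 0, Load 16 15,
     Bin Add 8 4 16, Const 15 1, Bin Add 5 17 15, Const 15 h, Bin Mul 5 5 15, Const 15 1, Bin Add 18 5 15, Const 6 1]"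

definition label_block :: "instr list" where
  "label_block = [Const 15 2, Bin Add 15 15 2, Load 15 15, Bin Add 15 15 4, Store 15 2]"

text \<open>Doubling register 6 until it exceeds \<open>N + 1\<close> finds
  \<open>2 ^ floorlog 2 (N + 1)\<close>. Multiplying by the outcome of the comparison replaces a
  branch, which a straight block cannot contain.\<close>

definition double_block :: "instr list" where
  "double_block = [Bin Less 15 18 6, Const 16 0, Bin Eq 15 15 16, Bin Mul 15 15 6, Bin Add 6 6 15]"

text \<open>The simulated word size is \<open>c\<close> times the bit length of
  \<open>N + 1\<close>, so the word range is the \<open>c\<close>-th power of the number found by
  doubling.\<close>

definition mask_block :: "nat \<Rightarrow> instr list" where
  "mask_block c = [Const 7 1] @ replicate c (Bin Mul 7 7 6) @
     [Const 15 0, Bin Add 6 7 15, Const 15 1, Bin Sub 7 6 15]"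

definition init_code :: "nat \<Rightarrow> nat \<Rightarrow> com" where
  "init_code h c = Block (init_block h) ;; Loop 2 17 1 (Block label_block) ;;
     Loop 2 18 1 (Block double_block) ;; Block (mask_block c)"

section \<open>Correctness of writing the gadget and of the calls\<close>

definition words :: "(nat \<times> nat) list \<Rightarrow> nat list" where
  "words ps = concat (map (\<lambda>(u, v). [u, v]) ps)"

lemma words_simps [simp]: "words [] = []" "words (p # ps) = fst p # snd p # words ps"
  "words (ps @ qs) = words ps @ words qs"
  by (auto simp: words_def case_prod_beta)

lemma length_words [simp]: "length (words ps) = 2 * length ps"
  by (induction ps) auto

lemma straight_put_edges: "list_all straight (put_edges idx h A ij)" "length (put_edges idx h A ij) = 32"
  by (auto simp: put_edges_def put_pair_def put_def emit_def)

lemma run_clear: "run w (clear_code nr) R M = (\<lambda>k. if 20 \<le> k \<and> k < 20 + nr then 0 else R k, M)"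
proof (induction nr)
  case (Suc nr)
  then show ?case by (auto simp: clear_code_def run_append fun_eq_iff)
qed (auto simp: clear_code_def fun_eq_iff)

lemma run_power:
  "R r < 2 ^ w \<Longrightarrow> r \<noteq> b \<Longrightarrow>
    run w (replicate c (Bin Mul r r b)) R M = (R(r := take_bit w (R r * R b ^ c)), M)"
proof (induction c arbitrary: R)
  case (Suc c)
  define z where "z = take_bit w (R r * R b)"
  have *: "take_bit w (z * R b ^ c) = take_bit w (R r * R b ^ Suc c)"
    by (simp add: z_def take_bit_eq_mod mod_simps mult.assoc)
  have "run w (replicate c (Bin Mul r r b)) (R(r := z)) M = (R(r := take_bit w (z * R b ^ c)), M)"
    using Suc.IH[of "R(r := z)"] Suc.prems by (simp add: z_def fun_upd_def cong: if_cong)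
  then show ?case by (simp add: * z_def[symmetric] fun_eq_iff del: power_Suc)
qed (simp add: take_bit_nat_eq_self)

context
  fixes w v n N h :: nat and es :: "(nat \<times> nat) list" and F :: "nat set set"
    and V :: "'a set" and idx :: "'a \<Rightarrow> nat" and A :: "'a set"
  assumes enc: "encodes n es F" and idx: "\<And>i. i \<in> V \<Longrightarrow> idx i < h"
    and N: "N = h * (2 * length es + 1)" "N < 2 ^ w" and vw: "v \<le> w" and w2: "2 \<le> w"
begin

definition base_ok :: "nat \<Rightarrow> nat \<Rightarrow> (nat \<Rightarrow> nat) \<Rightarrow> (nat \<Rightarrow> nat) \<Rightarrow> bool" where
  "base_ok bs acc R M \<longleftrightarrow> R 0 = acc \<and> R 3 = length es \<and> R 4 = 2 * length es + 2 \<and> R 5 = N \<and>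
     R 6 = 2 ^ v \<and> R 7 = 2 ^ v - 1 \<and> R 8 = bs \<and>
     (\<forall>j<2 * length es. M (2 + j) = endpoint es j \<and>
        M (2 * length es + 2 + endpoint es j) = edge_label es (endpoint es j))"

definition ready :: "nat \<Rightarrow> nat \<Rightarrow> (nat \<Rightarrow> nat) \<Rightarrow> (nat \<Rightarrow> nat) \<Rightarrow> bool" where
  "ready bs acc R M \<longleftrightarrow> base_ok bs acc R M \<and> (\<forall>x\<ge>bs. M x = 0)"

definition writing :: "nat \<Rightarrow> nat \<Rightarrow> nat list \<Rightarrow> (nat \<Rightarrow> nat) \<Rightarrow> (nat \<Rightarrow> nat) \<Rightarrow> bool" where
  "writing bs acc ws R M \<longleftrightarrow> base_ok bs acc R M \<and> R 9 = bs + length ws \<and>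
     (\<forall>k<length ws. M (bs + k) = take_bit v (ws ! k)) \<and> (\<forall>x\<ge>bs + length ws. M x = 0)"

lemma endpoint_less: "j < 2 * length es \<Longrightarrow> endpoint es j < n"
proof -
  assume "j < 2 * length es"
  then have "j div 2 < length es" by auto
  from bspec[OF edges_subset[OF enc] conjunct1[OF ends_in_edges[OF enc this]]]
  show ?thesis by (auto simp: endpoint_def)
qed

lemma base_ok_regs:
  "base_ok bs acc R M \<Longrightarrow> (\<And>k. k \<in> {0, 3, 4, 5, 6, 7, 8} \<Longrightarrow> R' k = R k) \<Longrightarrow> base_ok bs acc R' M"
  by (simp add: base_ok_def)

lemma base_ok_mem:
  assumes "base_ok bs acc R M" "2 * length es + 2 + n \<le> bs" "\<And>x. x < bs \<Longrightarrow> M' x = M x"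
  shows "base_ok bs acc R M'"
  unfolding base_ok_def
proof (intro conjI allI impI)
  fix j assume j: "j < 2 * length es"
  have "2 + j < bs" "2 * length es + 2 + endpoint es j < bs"
    using endpoint_less[OF j] assms(2) j by linarith+
  then show "M' (2 + j) = endpoint es j" "M' (2 * length es + 2 + endpoint es j) = edge_label es (endpoint es j)"
    using assms(1,3) j by (simp_all add: base_ok_def)
qed (use assms(1) in \<open>simp_all add: base_ok_def\<close>)

lemma writing_regs:
  "writing bs acc ws R M \<Longrightarrow> (\<And>k. k \<in> {0, 3, 4, 5, 6, 7, 8, 9} \<Longrightarrow> R' k = R k) \<Longrightarrow> writing bs acc ws R' M"
proof -
  assume wr: "writing bs acc ws R M" and eq: "\<And>k. k \<in> {0, 3, 4, 5, 6, 7, 8, 9} \<Longrightarrow> R' k = R k"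
  have "base_ok bs acc R' M"
    by (rule base_ok_regs[of bs acc R M]) (use wr eq in \<open>auto simp: writing_def\<close>)
  then show "writing bs acc ws R' M" using wr eq[of 9] by (simp add: writing_def)
qed

text \<open>Words are cut to \<open>v\<close> bits when written because \<open>init_config\<close>
  cuts the input of the simulated machine in the same way.\<close>

lemma run_emit:
  assumes wr: "writing bs acc ws R M" and bs: "2 * length es + 2 + n \<le> bs" "bs + length ws + 1 < 2 ^ w"
  obtains R' M' where "run w (emit r) R M = (R', M')" "writing bs acc (ws @ [R r]) R' M'"
    "\<And>k. k \<notin> {9, 10} \<Longrightarrow> R' k = R k"
proof -
  have R: "R 7 = mask v" "R 9 = bs + length ws"
    using wr by (auto simp: writing_def base_ok_def mask_eq_exp_minus_1)
  define R' where "R' = R(10 := 1, 9 := bs + length ws + 1)"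
  define M' where "M' = M(bs + length ws := take_bit v (R r))"
  have "take_bit w (R r AND R 7) = take_bit v (R r)"
    using vw unfolding R(1) take_bit_eq_mask[symmetric] by (simp add: take_bit_take_bit min_absorb2)
  then have run: "run w (emit r) R M = (R', M')"
    using bs w2 R by (simp add: emit_def R'_def M'_def take_bit_nat_eq_self fun_upd_twist del: take_bit_and)
  have "base_ok bs acc R M" using wr by (simp add: writing_def)
  then have "base_ok bs acc R' M"
    by (rule base_ok_regs) (auto simp: R'_def)
  then have "base_ok bs acc R' M'"
    using bs(1) by (rule base_ok_mem) (simp add: M'_def)
  then have "writing bs acc (ws @ [R r]) R' M'"
    using wr by (auto simp: writing_def R'_def M'_def nth_append less_Suc_eq)
  with run show ?thesis by (rule that) (auto simp: R'_def)
qed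

lemma run_put:
  assumes wr: "writing bs acc ws R M" and bs: "2 * length es + 2 + n \<le> bs" "bs + length ws + 1 < 2 ^ w"
    and x: "i + h * R x < 2 ^ w" "x \<noteq> 15"
  obtains R' M' where "run w (put h i x) R M = (R', M')" "writing bs acc (ws @ [i + h * R x]) R' M'"
    "\<And>k. k \<notin> {9, 10, 15, 16} \<Longrightarrow> R' k = R k"
proof -
  define R1 where "R1 = R(16 := take_bit w i, 15 := i + h * R x)"
  have "take_bit w (take_bit w (take_bit w h * R x) + take_bit w i) = take_bit w (i + h * R x)"
    by (simp add: take_bit_eq_mod mod_simps add.commute)
  then have run1: "run w [Const 15 h, Bin Mul 15 15 x, Const 16 i, Bin Add 15 15 16] R M = (R1, M)"
    using x by (simp add: R1_def take_bit_nat_eq_self fun_upd_twist)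
  have "writing bs acc ws R1 M"
    by (rule writing_regs[OF wr]) (auto simp: R1_def)
  from run_emit[OF this bs, of 15] obtain R' M' where
    *: "run w (emit 15) R1 M = (R', M')" "writing bs acc (ws @ [R1 15]) R' M'" "\<And>k. k \<notin> {9, 10} \<Longrightarrow> R' k = R1 k"
    by blast
  show ?thesis
  proof (rule that)
    show "run w (put h i x) R M = (R', M')" unfolding put_def run_append run1 using * by simp
    show "writing bs acc (ws @ [i + h * R x]) R' M'" using *(2) by (simp add: R1_def)
    show "R' k = R k" if "k \<notin> {9, 10, 15, 16}" for k using *(3)[of k] that by (simp add: R1_def)
  qed
qed

lemma run_put_pair:
  assumes wr: "writing bs acc ws R M" and bs: "2 * length es + 2 + n \<le> bs" "bs + length ws + 2 < 2 ^ w"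
    and xy: "R x < 2 * length es" "R y < 2 * length es" "x \<in> {11..14}" "y \<in> {11..14}"
    and ij: "fst ij \<in> V" "snd ij \<in> V"
  obtains R' M' where "run w (put_pair idx h ij x y) R M = (R', M')"
    "writing bs acc (ws @ [idx (fst ij) + h * R x, idx (snd ij) + h * R y]) R' M'"
    "\<And>k. k \<notin> {9, 10, 15, 16} \<Longrightarrow> R' k = R k"
proof -
  have less: "idx i + h * z < 2 ^ w" if "i \<in> V" "z < 2 * length es" for i z
  proof -
    have "idx i + h * z < h * (z + 1)" using idx[OF that(1)] by simp
    also have "\<dots> \<le> N" unfolding N(1) using that(2) by (intro mult_left_mono) auto
    also note N(2)
    finally show ?thesis .
  qed
  have bs1: "bs + length ws + 1 < 2 ^ w" using bs by simp
  obtain R1 M1 where 1: "run w (put h (idx (fst ij)) x) R M = (R1, M1)"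
    "writing bs acc (ws @ [idx (fst ij) + h * R x]) R1 M1" "\<And>k. k \<notin> {9, 10, 15, 16} \<Longrightarrow> R1 k = R k"
    using run_put[OF wr bs(1) bs1 less[OF ij(1) xy(1)]] xy(3) by auto
  have y: "R1 y = R y" using 1(3)[of y] xy(4) by auto
  have bs2: "bs + length (ws @ [idx (fst ij) + h * R x]) + 1 < 2 ^ w" using bs by simp
  have "idx (snd ij) + h * R1 y < 2 ^ w" using less[OF ij(2) xy(2)] y by simp
  from run_put[OF 1(2) bs(1) bs2 this] xy(4) obtain R' M' where
    2: "run w (put h (idx (snd ij)) y) R1 M1 = (R', M')"
    "writing bs acc ((ws @ [idx (fst ij) + h * R x]) @ [idx (snd ij) + h * R1 y]) R' M'"
    "\<And>k. k \<notin> {9, 10, 15, 16} \<Longrightarrow> R' k = R1 k" by auto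
  show ?thesis
    by (rule that[of R' M']) (use 1 2 y in \<open>auto simp: put_pair_def run_append\<close>)
qed

definition fetched :: "nat \<Rightarrow> (nat \<Rightarrow> nat) \<Rightarrow> bool" where
  "fetched e R \<longleftrightarrow> R 11 = edge_label es (fst (es ! e)) \<and> R 12 = edge_label es (snd (es ! e)) \<and>
     R 13 = 2 * e \<and> R 14 = 2 * e + 1"

lemma run_put_edges:
  assumes wr: "writing bs acc ws R M" and bs: "2 * length es + 2 + n \<le> bs" "bs + length ws + 4 < 2 ^ w"
    and e: "e < length es" "fetched e R" and ij: "fst ij \<in> V" "snd ij \<in> V"
  obtains R' M' where "run w (put_edges idx h A ij) R M = (R', M')"
    "writing bs acc (ws @ words [gpair idx h A es e ij False, gpair idx h A es e ij True]) R' M'"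
    "\<And>k. k \<notin> {9, 10, 15, 16} \<Longrightarrow> R' k = R k"
proof -
  note result = that
  have "fst (es ! e) \<in> \<Union>F" "snd (es ! e) \<in> \<Union>F"
    using ends_in_edges[OF enc e(1)] by auto
  then have "edge_label es (fst (es ! e)) < 2 * length es" "edge_label es (snd (es ! e)) < 2 * length es"
    using endpoint_label[OF enc] by auto
  then have less: "R k < 2 * length es" if "k \<in> {11..14}" for k
  proof -
    have "k = 11 \<or> k = 12 \<or> k = 13 \<or> k = 14" using that by auto
    then show ?thesis
      using e \<open>edge_label es (fst (es ! e)) < 2 * length es\<close> \<open>edge_label es (snd (es ! e)) < 2 * length es\<close>
      by (auto simp: fetched_def)
  qed
  have two: thesis if regs: "x \<in> {11..14}" "y \<in> {11..14}" "x' \<in> {11..14}" "y' \<in> {11..14}"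
    and code: "put_edges idx h A ij = put_pair idx h ij x y @ put_pair idx h ij x' y'"
    and ws: "words [gpair idx h A es e ij False, gpair idx h A es e ij True] =
      [idx (fst ij) + h * R x, idx (snd ij) + h * R y] @ [idx (fst ij) + h * R x', idx (snd ij) + h * R y']"
    for x y x' y'
  proof -
    have bs1: "bs + length ws + 2 < 2 ^ w" using bs by simp
    obtain R1 M1 where 1: "run w (put_pair idx h ij x y) R M = (R1, M1)"
      "writing bs acc (ws @ [idx (fst ij) + h * R x, idx (snd ij) + h * R y]) R1 M1"
      "\<And>k. k \<notin> {9, 10, 15, 16} \<Longrightarrow> R1 k = R k"
      by (rule run_put_pair[OF wr bs(1) bs1 less[OF regs(1)] less[OF regs(2)] regs(1,2) ij]) blast
    have same: "R1 k = R k" if "k \<in> {11..14}" for k using 1(3)[of k] that by auto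
    have bs2: "bs + length (ws @ [idx (fst ij) + h * R x, idx (snd ij) + h * R y]) + 2 < 2 ^ w"
      using bs by simp
    have "R1 x' < 2 * length es" "R1 y' < 2 * length es"
      using same less regs by auto
    from run_put_pair[OF 1(2) bs(1) bs2 this regs(3,4) ij] obtain R' M' where
      2: "run w (put_pair idx h ij x' y') R1 M1 = (R', M')"
      "writing bs acc ((ws @ [idx (fst ij) + h * R x, idx (snd ij) + h * R y]) @
         [idx (fst ij) + h * R1 x', idx (snd ij) + h * R1 y']) R' M'"
      "\<And>k. k \<notin> {9, 10, 15, 16} \<Longrightarrow> R' k = R1 k" by blast
    show thesis
    proof (rule result)
      show "run w (put_edges idx h A ij) R M = (R', M')"
        unfolding code run_append 1(1) using 2(1) by simp
      show "writing bs acc (ws @ words [gpair idx h A es e ij False, gpair idx h A es e ij True]) R' M'"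
        unfolding ws using 2(2) same[OF regs(3)] same[OF regs(4)] by simp
      show "R' k = R k" if "k \<notin> {9, 10, 15, 16}" for k using 1(3) 2(3) that by simp
    qed
  qed
  show thesis
  proof (cases "fst ij \<in> A \<or> snd ij \<in> A")
    case True
    show thesis
      by (rule two[of 11 12 12 11]) (use True e(2) in \<open>auto simp: put_edges_def gpair_def fetched_def Let_def\<close>)
  next
    case False
    show thesis
      by (rule two[of 13 13 14 14]) (use False e(2) in \<open>auto simp: put_edges_def gpair_def fetched_def Let_def\<close>)
  qed
qed

lemma run_put_all:
  assumes "writing bs acc ws R M" and bs: "2 * length es + 2 + n \<le> bs" "bs + length ws + 4 * length S < 2 ^ w"
    and e: "e < length es" "fetched e R" and S: "\<forall>ij\<in>set S. fst ij \<in> V \<and> snd ij \<in> V"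
  shows "\<exists>R' M'. run w (concat (map (put_edges idx h A) S)) R M = (R', M') \<and>
    writing bs acc (ws @ words (gpairs idx h A es S e)) R' M' \<and> (\<forall>k. k \<notin> {9, 10, 15, 16} \<longrightarrow> R' k = R k)"
  using assms
proof (induction S arbitrary: ws R M)
  case (Cons ij S)
  obtain R1 M1 where 1: "run w (put_edges idx h A ij) R M = (R1, M1)"
    "writing bs acc (ws @ words [gpair idx h A es e ij False, gpair idx h A es e ij True]) R1 M1"
    "\<And>k. k \<notin> {9, 10, 15, 16} \<Longrightarrow> R1 k = R k"
    by (rule run_put_edges[of bs acc ws R M e ij]) (use Cons.prems in auto)
  have "fetched e R1" using Cons.prems(5) 1(3) by (simp add: fetched_def)
  then obtain R' M' where "run w (concat (map (put_edges idx h A) S)) R1 M1 = (R', M')"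
    "writing bs acc ((ws @ words [gpair idx h A es e ij False, gpair idx h A es e ij True]) @
      words (gpairs idx h A es S e)) R' M'" "\<forall>k. k \<notin> {9, 10, 15, 16} \<longrightarrow> R' k = R1 k"
    using Cons.IH[OF 1(2)] Cons.prems by auto
  then show ?case
    using 1 by (auto simp: run_append gpairs_def)
qed (auto simp: gpairs_def)

lemma run_fetch:
  assumes wr: "writing bs acc ws R M" and bs: "2 * length es + 2 + n \<le> bs" "bs < 2 ^ w"
    and e: "e < length es" "R 2 = e"
  obtains R' where "run w fetch R M = (R', M)" "writing bs acc ws R' M" "fetched e R'" "R' 2 = e"
proof -
  define l where "l = edge_label es"
  define L where "L = 2 * length es + 2"
  have j: "2 * e < 2 * length es" "2 * e + 1 < 2 * length es" using e by auto
  have ends: "endpoint es (2 * e) = fst (es ! e)" "endpoint es (2 * e + 1) = snd (es ! e)"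
    by (auto simp: endpoint_def)
  have lt: "fst (es ! e) < n" "snd (es ! e) < n"
    using endpoint_less[OF j(1)] endpoint_less[OF j(2)] ends by auto
  have "M (2 + 2 * e) = fst (es ! e)" "M (2 + (2 * e + 1)) = snd (es ! e)"
    "M (2 * length es + 2 + fst (es ! e)) = l (fst (es ! e))" "M (2 * length es + 2 + snd (es ! e)) = l (snd (es ! e))"
    using wr j ends unfolding writing_def base_ok_def l_def by metis+
  then have M: "M (Suc (Suc (e + e))) = fst (es ! e)" "M (Suc (Suc (Suc (e + e)))) = snd (es ! e)"
    "M (L + fst (es ! e)) = l (fst (es ! e))" "M (L + snd (es ! e)) = l (snd (es ! e))"
    by (simp_all add: L_def mult_2)
  have tb: "take_bit w (e + e) = e + e" "take_bit w (Suc (Suc (e + e))) = Suc (Suc (e + e))"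
    "take_bit w (Suc (Suc (Suc (e + e)))) = Suc (Suc (Suc (e + e)))" "take_bit w (Suc (e + e)) = Suc (e + e)"
    by (rule take_bit_nat_eq_self, use bs j in linarith)+
  have tbL: "take_bit w (fst (es ! e) + L) = L + fst (es ! e)" "take_bit w (snd (es ! e) + L) = L + snd (es ! e)"
  proof -
    have "L + fst (es ! e) < 2 ^ w" "L + snd (es ! e) < 2 ^ w" using bs lt unfolding L_def by linarith+
    then show "take_bit w (fst (es ! e) + L) = L + fst (es ! e)" "take_bit w (snd (es ! e) + L) = L + snd (es ! e)"
      by (simp_all add: take_bit_nat_eq_self add.commute)
  qed
  have R: "R 4 = L" "R 2 = e" "w \<noteq> 0" "0 < w"
    using wr e(2) w2 by (auto simp: writing_def base_ok_def L_def)
  define R' where "R' = R(13 := e + e, 15 := Suc (Suc (Suc (e + e))), 11 := l (fst (es ! e)), 16 := 1,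
    12 := l (snd (es ! e)), 14 := Suc (e + e))"
  have "run w fetch R M = (R', M)"
    by (simp add: fetch_def R w2 tb M tbL) (auto simp: R'_def fun_eq_iff)
  then show ?thesis
    by (rule that) (use e(2) in \<open>auto simp: R'_def fetched_def l_def intro: writing_regs[OF wr]\<close>)
qed


lemma length_words_gpairs: "length (words (concat (map (gpairs idx h A es S) [0..<j]))) = 4 * length S * j"
  by (induction j) (auto simp: length_gpairs)

lemma triple_gadget:
  assumes bs: "2 * length es + 2 + n \<le> bs" "bs + 2 + 4 * length S * length es < 2 ^ w"
    and S: "\<forall>ij\<in>set S. fst ij \<in> V \<and> snd ij \<in> V"
  shows "triple w (ready bs acc) (gadget_code idx h A S) (16 + length es * (17 + 32 * length S))
    (writing bs acc (input_words N (gedges idx h A es S)))"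
proof -
  define ws where "ws j = N # 2 * length es * length S # words (concat (map (gpairs idx h A es S) [0..<j]))" for j
  define C1 where "C1 = [Const 15 0, Bin Add 9 8 15] @ emit 5 @ [Const 15 (2 * length S), Bin Mul 15 15 3] @ emit 15"
  define C2 where "C2 = fetch @ concat (map (put_edges idx h A) S)"
  have len: "length (ws j) = 2 + 4 * length S * j" for j
    unfolding ws_def length_Cons length_words_gpairs by simp
  have lenC1: "length C1 = 12" by (simp add: C1_def emit_def)
  have lenC2: "length C2 = 12 + 32 * length S"
  proof -
    have "length (concat (map (put_edges idx h A) S)) = 32 * length S"
      by (induction S) (auto simp: straight_put_edges)
    then show ?thesis by (simp add: C2_def fetch_def)
  qed
  have stC2: "list_all straight C2"
  proof -
    have "list_all straight (concat (map (put_edges idx h A) S))"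
      by (induction S) (auto simp: straight_put_edges)
    then show ?thesis by (simp add: C2_def fetch_def)
  qed
  have bsw: "bs < 2 ^ w" "bs + length ([] :: nat list) + 1 < 2 ^ w" "bs + length [N] + 1 < 2 ^ w"
    using bs by auto
  have 1: "triple w (ready bs acc) (Block C1) (length C1) (writing bs acc (ws 0))"
  proof (rule triple_Block)
    fix R M assume rd: "ready bs acc R M"
    define R1 where "R1 = R(15 := 0, 9 := bs)"
    have R: "R 8 = bs" "R 3 = length es" "R 5 = N" using rd by (auto simp: ready_def base_ok_def)
    have r1: "run w [Const 15 0, Bin Add 9 8 15] R M = (R1, M)"
      using bsw R by (simp add: R1_def take_bit_nat_eq_self)
    have "base_ok bs acc R1 M"
      by (rule base_ok_regs[of bs acc R M]) (use rd in \<open>auto simp: ready_def R1_def\<close>)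
    then have "writing bs acc [] R1 M"
      using rd by (simp add: writing_def ready_def R1_def)
    from run_emit[OF this bs(1) bsw(2), of 5] obtain R2 M2 where
      r2: "run w (emit 5) R1 M = (R2, M2)" "writing bs acc ([] @ [R1 5]) R2 M2" by blast
    have w2': "writing bs acc [N] R2 M2" using r2(2) R by (simp add: R1_def)
    define R3 where "R3 = R2(15 := 2 * length es * length S)"
    have R23: "R2 3 = length es" using w2' by (simp add: writing_def base_ok_def)
    have "take_bit w (take_bit w (2 * length S) * length es) = take_bit w (2 * length S * length es)"
      by (simp only: take_bit_eq_mod mod_mult_left_eq)
    also have "\<dots> = 2 * length S * length es"
      by (rule take_bit_nat_eq_self) (use bs in linarith)
    finally have r3: "run w [Const 15 (2 * length S), Bin Mul 15 15 3] R2 M2 = (R3, M2)"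
      using R23 by (simp add: R3_def mult_ac del: mult_2)
    have "writing bs acc [N] R3 M2"
      by (rule writing_regs[OF w2']) (auto simp: R3_def)
    from run_emit[OF this bs(1) bsw(3), of 15] obtain R4 M4 where
      r4: "run w (emit 15) R3 M2 = (R4, M4)" "writing bs acc ([N] @ [R3 15]) R4 M4" by blast
    have "run w C1 R M = (R4, M4)"
      unfolding C1_def run_append r1 prod.case r2(1) r3 r4(1) ..
    then show "case_prod (writing bs acc (ws 0)) (run w C1 R M)"
      using r4(2) by (simp add: R3_def ws_def)
  qed (simp add: C1_def emit_def)
  have 2: "triple w (writing bs acc (ws 0)) (Loop 2 3 1 (Block C2)) (4 + length es * (5 + length C2))
      (writing bs acc (input_words N (gedges idx h A es S)))"
  proof (rule triple_Loop[where I = "\<lambda>j. writing bs acc (ws j)"])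
    fix j assume j: "j < length es"
    show "triple w (\<lambda>R M. writing bs acc (ws j) R M \<and> R 2 = j \<and> R 3 = length es) (Block C2) (length C2)
       (\<lambda>R M. writing bs acc (ws (Suc j)) R M \<and> R 2 = j \<and> R 3 = length es)"
    proof (rule triple_Block[OF stC2])
      fix R M assume A: "writing bs acc (ws j) R M \<and> R 2 = j \<and> R 3 = length es"
      then obtain R1 where r1: "run w fetch R M = (R1, M)" "writing bs acc (ws j) R1 M" "fetched j R1" "R1 2 = j"
        using run_fetch[OF _ bs(1) bsw(1) j, of acc "ws j" R M] by blast
      have "4 * length S * j + 4 * length S \<le> 4 * length S * length es"
        using mult_le_mono2[of "Suc j" "length es" "4 * length S"] j by simp
      then have "bs + length (ws j) + 4 * length S < 2 ^ w"
        unfolding len using bs by linarith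
      from run_put_all[OF r1(2) bs(1) this j r1(3) S] obtain R2 M2 where
        r2: "run w (concat (map (put_edges idx h A) S)) R1 M = (R2, M2)"
          "writing bs acc (ws j @ words (gpairs idx h A es S j)) R2 M2"
          "\<forall>k. k \<notin> {9, 10, 15, 16} \<longrightarrow> R2 k = R1 k" by blast
      have "R2 3 = length es" using r2(2) by (simp add: writing_def base_ok_def)
      then show "case run w C2 R M of (R, M) \<Rightarrow> writing bs acc (ws (Suc j)) R M \<and> R 2 = j \<and> R 3 = length es"
        unfolding C2_def run_append r1(1) prod.case r2(1) using r2(2,3) r1(4) by (simp add: ws_def)
    qed
  next
    fix R M assume "writing bs acc (ws (length es)) R M"
    then show "writing bs acc (input_words N (gedges idx h A es S)) R M"
      by (simp add: ws_def gedges_def[symmetric] input_words_def words_def[symmetric] length_gedges)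
  next
    show "writing bs acc (ws j) (R(2 := x, 1 := y)) M" if "writing bs acc (ws j) R M" for j R M x y
      by (rule writing_regs[OF that]) auto
    show "length es < 2 ^ w" using bs by linarith
  qed (use w2 in \<open>auto simp: writing_def base_ok_def\<close>)
  show ?thesis
    unfolding gadget_code_def C1_def[symmetric] C2_def[symmetric]
    by (rule triple_conseq[OF triple_Seq[OF 1 2]])
      (auto simp: lenC1 lenC2)
qed

text \<open>The written input may be longer than the simulated memory of \<open>2 ^ v\<close> cells,
  so the next region starts past the sum of both lengths; everything from there on is still
  zero.\<close>

lemma triple_call:
  assumes bs: "2 * length es + 2 + n \<le> bs" "bs + (2 + 4 * length S * length es + 2 ^ v) < 2 ^ w"
    and S: "\<forall>ij\<in>set S. fst ij \<in> V \<and> snd ij \<in> V"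
    and nr: "\<forall>I\<in>set P. \<forall>r\<in>instr_regs I. r < nr" "0 < nr"
    and cost: "2 * ERT v P (penalty out) (init_core v N (gedges idx h A es S)) \<le> of_nat B"
  shows "triple w (ready bs acc) (call_code idx h A P nr S neg)
    (18 + length es * (17 + 32 * length S) + nr + B)
    (ready (bs + (2 + 4 * length S * length es + 2 ^ v)) (binop_val w (if neg then Sub else Add) acc out))"
proof -
  define ws where "ws = input_words N (gedges idx h A es S)"
  define m where "m x = (if x < length ws then take_bit v (ws ! x) else 0)" for x
  have len: "length ws = 2 + 4 * length S * length es"
    by (simp add: ws_def length_input_words length_gedges)
  have ic: "init_core v N (gedges idx h A es S) = (0, (\<lambda>_. 0), m)"
    by (auto simp: init_core_def m_def ws_def)
  define Y where "Y R M \<longleftrightarrow> writing bs acc ws R M \<and> (\<forall>i<nr. R (20 + i) = 0)" for R M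
  define Z where "Z R M \<longleftrightarrow> base_ok bs acc R M \<and> R 9 = bs + length ws \<and> R 20 = out \<and>
    (\<forall>x\<ge>bs + length ws + 2 ^ v. M x = 0)" for R M
  have 1: "triple w (ready bs acc) (gadget_code idx h A S) (16 + length es * (17 + 32 * length S))
      (writing bs acc ws)"
    unfolding ws_def by (rule triple_gadget) (use bs S in auto)
  have 2: "triple w (writing bs acc ws) (Block (clear_code nr)) (length (clear_code nr)) Y"
  proof (rule triple_Block)
    fix R M assume wr: "writing bs acc ws R M"
    show "case_prod Y (run w (clear_code nr) R M)"
      unfolding run_clear prod.case Y_def
      by (intro conjI writing_regs[OF wr]) auto
  qed (simp add: clear_code_def list_all_iff)
  have 3: "triple w Y (Sim P 20 1 7 8) B Z"
  proof (rule triple_Sim[where nr = nr and v = v and base = bs and m = m and out = out])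
    show "2 * ERT v P (penalty out) (0, \<lambda>_. 0, m) \<le> of_nat B" using cost by (simp only: ic)
    show "bs + 2 ^ v \<le> 2 ^ w" using bs by simp
    show "\<forall>x. m x < 2 ^ v" by (simp add: m_def)
    fix R M assume Y: "Y R M"
    then show "R 7 = 2 ^ v - 1 \<and> R 8 = bs \<and> (\<forall>i<nr. R (20 + i) = 0) \<and> (\<forall>x<2 ^ v. M (bs + x) = m x)"
      by (auto simp: Y_def writing_def base_ok_def m_def)
    fix R' M'
    assume R': "R' 20 = out" "\<And>i. i \<notin> {20..<20 + nr} \<Longrightarrow> i \<noteq> 1 \<Longrightarrow> R' i = R i"
      and M': "\<And>x. x \<notin> {bs..<bs + 2 ^ v} \<Longrightarrow> M' x = M x"
    have "base_ok bs acc R M" using Y by (simp add: Y_def writing_def)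
    then have "base_ok bs acc R' M"
      by (rule base_ok_regs) (auto intro!: R'(2))
    then have "base_ok bs acc R' M'"
      using bs(1) by (rule base_ok_mem) (auto intro!: M')
    moreover have "R' 9 = bs + length ws" using R'(2)[of 9] Y by (simp add: Y_def writing_def)
    moreover have "M' x = 0" if "bs + length ws + 2 ^ v \<le> x" for x
      using M'[of x] that Y by (simp add: Y_def writing_def)
    ultimately show "Z R' M'" using R'(1) by (simp add: Z_def)
  qed (use nr vw in auto)
  have 4: "triple w Z (Block [Bin (if neg then Sub else Add) 0 0 20, Bin Add 8 9 6])
      (length [Bin (if neg then Sub else Add) 0 0 20, Bin Add 8 9 6])
      (ready (bs + length ws + 2 ^ v) (binop_val w (if neg then Sub else Add) acc out))"
  proof (rule triple_Block)
    fix R M assume "Z R M"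
    moreover have "take_bit w (bs + length ws + 2 ^ v) = bs + length ws + 2 ^ v"
      by (rule take_bit_nat_eq_self) (use bs(2) in \<open>simp add: len\<close>)
    ultimately show "case_prod (ready (bs + length ws + 2 ^ v) (binop_val w (if neg then Sub else Add) acc out))
        (run w [Bin (if neg then Sub else Add) 0 0 20, Bin Add 8 9 6] R M)"
      by (auto simp: Z_def ready_def base_ok_def simp del: binop_val.simps(2))
  qed simp
  have "triple w (ready bs acc) (call_code idx h A P nr S neg)
    (16 + length es * (17 + 32 * length S) + (length (clear_code nr) +
      (B + length [Bin (if neg then Sub else Add) 0 0 20, Bin Add 8 9 6])))
    (ready (bs + length ws + 2 ^ v) (binop_val w (if neg then Sub else Add) acc out))"
    unfolding call_code_def by (rule triple_Seq[OF 1 triple_Seq[OF 2 triple_Seq[OF 3 4]]])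
  then show ?thesis
    by (rule triple_conseq) (auto simp: clear_code_def len add.assoc)
qed

text \<open>Partial sums of an alternating sum may be negative; the accumulator represents them by
  their residues modulo \<open>2 ^ w\<close>.\<close>

lemma binop_val_mod:
  assumes "x < 2 ^ w"
  shows "binop_val w (if neg then Sub else Add) (nat (z mod 2 ^ w)) x =
    nat ((z + (if neg then - 1 else 1) * int x) mod 2 ^ w)"
proof -
  have z: "int (nat (z mod 2 ^ w)) = z mod 2 ^ w" by simp
  have "int (binop_val w (if neg then Sub else Add) (nat (z mod 2 ^ w)) x) =
      (z + (if neg then - 1 else 1) * int x) mod 2 ^ w"
  proof (cases neg)
    case True
    have "int (nat (z mod 2 ^ w) + 2 ^ w - x) = z mod 2 ^ w + 2 ^ w - int x"
      using assms by (simp add: of_nat_diff)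
    also have "\<dots> = (z - int x) + (1 - z div 2 ^ w) * 2 ^ w"
      using minus_div_mult_eq_mod[of z "2 ^ w"] by (simp add: algebra_simps)
    finally have "int (nat (z mod 2 ^ w) + 2 ^ w - x) mod 2 ^ w = (z - int x) mod 2 ^ w"
      by (simp only: mod_mult_self1)
    then show ?thesis
      using True by (simp add: take_bit_eq_mod zmod_int del: of_nat_diff)
  next
    case False
    then show ?thesis by (simp add: take_bit_eq_mod zmod_int mod_simps)
  qed
  then show ?thesis by (metis nat_int)
qed

text \<open>The arbitrary start value \<open>z\<close> carries the partial sum through the induction
  over the remaining calls.\<close>

lemma triple_calls:
  assumes nr: "\<forall>I\<in>set P. \<forall>r\<in>instr_regs I. r < nr" "0 < nr"
    and Ss: "\<forall>S\<in>set Ss. (\<forall>ij\<in>set S. fst ij \<in> V \<and> snd ij \<in> V) \<and> length S \<le> k \<and> out S < 2 ^ w \<and>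
      2 * ERT v P (penalty (out S)) (init_core v N (gedges idx h A es S)) \<le> of_nat B"
    and bs: "2 * length es + 2 + n \<le> bs" "bs + length Ss * (2 + 4 * k * length es + 2 ^ v) < 2 ^ w"
  shows "triple w (ready bs (nat (z mod 2 ^ w))) (calls_code idx h A P nr neg Ss)
    (2 + length Ss * (18 + length es * (17 + 32 * k) + nr + B))
    (\<lambda>R M. R 0 = of_bool ((z + signed_sum neg out Ss) mod 2 ^ w = 0))"
  using Ss bs
proof (induction Ss arbitrary: bs z)
  case Nil
  have "triple w (ready bs (nat (z mod 2 ^ w))) (Block [Const 15 0, Bin Eq 0 0 15])
      (length [Const 15 0, Bin Eq 0 0 15]) (\<lambda>R M. R 0 = of_bool (z mod 2 ^ w = 0))"
  proof (rule triple_Block)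
    fix R M assume "ready bs (nat (z mod 2 ^ w)) R M"
    moreover have "nat (z mod 2 ^ w) = 0 \<longleftrightarrow> z mod 2 ^ w = 0"
      by (metis nat_0_iff order_antisym_conv pos_mod_sign zero_less_numeral zero_less_power)
    ultimately show "case run w [Const 15 0, Bin Eq 0 0 15] R M of (R, M) \<Rightarrow> R 0 = of_bool (z mod 2 ^ w = 0)"
      using w2 by (auto simp: ready_def base_ok_def)
  qed simp
  then show ?case
    unfolding calls_code_def signed_sum_def foldr.simps id_apply by (rule triple_conseq) simp_all
next
  case (Cons S Ss)
  define st where "st = 2 + 4 * length S * length es + 2 ^ v"
  define z' where "z' = z + (if neg S then - 1 else 1) * int (out S)"
  have S: "length S \<le> k" "out S < 2 ^ w" using Cons.prems(1) by auto
  then have "4 * length S * length es \<le> 4 * k * length es" by simp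
  then have st: "st + length Ss * (2 + 4 * k * length es + 2 ^ v) \<le> length (S # Ss) * (2 + 4 * k * length es + 2 ^ v)"
    by (simp add: st_def)
  have bs': "2 * length es + 2 + n \<le> bs + st" "bs + st + length Ss * (2 + 4 * k * length es + 2 ^ v) < 2 ^ w"
    using Cons.prems(2,3) st by linarith+
  have IH: "triple w (ready (bs + st) (nat (z' mod 2 ^ w))) (calls_code idx h A P nr neg Ss)
    (2 + length Ss * (18 + length es * (17 + 32 * k) + nr + B))
    (\<lambda>R M. R 0 = of_bool ((z' + signed_sum neg out Ss) mod 2 ^ w = 0))"
    by (rule Cons.IH) (use Cons.prems(1) bs' in auto)
  have bss: "bs + st < 2 ^ w" using bs'(2) by linarith
  have call: "triple w (ready bs (nat (z mod 2 ^ w))) (call_code idx h A P nr S (neg S))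
    (18 + length es * (17 + 32 * length S) + nr + B) (ready (bs + st) (nat (z' mod 2 ^ w)))"
    unfolding st_def z'_def binop_val_mod[OF S(2), symmetric]
    by (rule triple_call[OF Cons.prems(2) bss[unfolded st_def] _ nr]) (use Cons.prems(1) in auto)
  have "length es * (17 + 32 * length S) \<le> length es * (17 + 32 * k)"
    using S(1) by (intro mult_left_mono) auto
  then have le: "18 + length es * (17 + 32 * length S) + nr + B + (2 + length Ss * (18 + length es * (17 + 32 * k) + nr + B))
      \<le> 2 + length (S # Ss) * (18 + length es * (17 + 32 * k) + nr + B)"
    by simp
  have code: "calls_code idx h A P nr neg (S # Ss) =
      call_code idx h A P nr S (neg S) ;; calls_code idx h A P nr neg Ss"
    by (simp add: calls_code_def)
  have sum: "z + signed_sum neg out (S # Ss) = z' + signed_sum neg out Ss"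
    by (simp add: signed_sum_def z'_def)
  show ?case
    unfolding code sum by (rule triple_conseq[OF triple_Seq[OF call IH] _ _ le])
qed

lemma nth_input_endpoint: "j < 2 * length es \<Longrightarrow> input_words n es ! (2 + j) = endpoint es j"
proof -
  assume j: "j < 2 * length es"
  then have e: "j div 2 < length es" by auto
  show ?thesis
  proof (cases "even j")
    case True
    then show ?thesis using nth_input_words(1)[OF e, of n] by (simp add: endpoint_def)
  next
    case False
    then have "2 + j = 3 + 2 * (j div 2)" by presburger
    then show ?thesis
      using nth_input_words(2)[OF e, of n, folded \<open>2 + j = 3 + 2 * (j div 2)\<close>] False by (simp add: endpoint_def)
  qed
qed

text \<open>The time is linear in the number of edges and in the number \<open>N\<close> of gadget
  vertices; it does not grow with \<open>n\<close>, however many isolated vertices the input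
  has.\<close>

lemma triple_init:
  assumes v: "v = c * fl" and fl: "fl = floorlog 2 (N + 1)"
    and less: "fl < w" "v < w" "N + 1 < 2 ^ w" "2 * length es + 2 + n < 2 ^ w"
  shows "triple w (\<lambda>R M. (0, R, M) = init_core w n es) (init_code h c)
    (38 + 20 * length es + 10 * N + c) (ready (2 * length es + 2 + n) 0)"
proof -
  define L where "L = 2 * length es + 2"
  define G where "G R M \<longleftrightarrow> R 0 = 0 \<and> R 3 = length es \<and> R 4 = L \<and> R 5 = N \<and> R 8 = L + n \<and>
    R 17 = 2 * length es \<and> R 18 = N + 1 \<and> (\<forall>j<2 * length es. M (2 + j) = endpoint es j) \<and> (\<forall>x\<ge>L + n. M x = 0)"
    for R M :: "nat \<Rightarrow> nat"
  define J where "J j R M \<longleftrightarrow> G R M \<and> R 6 = 1 \<and> (\<forall>y<n. M (L + y) = label (endpoint es) j y)" for j R M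
  define K where "K j R M \<longleftrightarrow> G R M \<and> R 6 = 2 ^ min j fl \<and> (\<forall>y<n. M (L + y) = edge_label es y)" for j R M
  have w0: "w \<noteq> 0" "0 < w" using w2 by auto
  have 1: "triple w (\<lambda>R M. (0, R, M) = init_core w n es) (Block (init_block h)) (length (init_block h)) (J 0)"
  proof (rule triple_Block)
    fix R M assume A: "(0::nat, R, M) = init_core w n es"
    have R: "R k = 0" for k using A by (simp add: init_core_def)
    have M: "M x = (if x < 2 + 2 * length es then take_bit w (input_words n es ! x) else 0)" for x
      using A by (simp add: init_core_def length_input_words)
    have M01: "M 0 = n" "M (Suc 0) = length es"
      using less(4) by (simp_all add: M input_words_def take_bit_nat_eq_self)
    have Mj: "M (2 + j) = endpoint es j" if "j < 2 * length es" for j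
      using that nth_input_endpoint[OF that] endpoint_less[OF that] less(4)
      by (simp add: M take_bit_nat_eq_self)
    have tb: "take_bit w (length es + length es) = 2 * length es" "take_bit w (2 * length es) = 2 * length es"
      "take_bit w (Suc (Suc (2 * length es))) = L" "take_bit w (L + n) = L + n"
      "take_bit w (Suc (2 * length es)) = Suc (2 * length es)" "take_bit w (Suc N) = Suc N"
      using less(3,4) by (simp_all add: take_bit_nat_eq_self L_def)
    have "take_bit w (Suc (2 * length es) * take_bit w h) = take_bit w (Suc (2 * length es) * h)"
      by (simp only: take_bit_eq_mod mod_mult_right_eq)
    also have "\<dots> = N" using N(2) by (simp add: N(1) take_bit_nat_eq_self mult.commute)
    finally have tN: "take_bit w (Suc (2 * length es) * take_bit w h) = N" .
    define R' where "R' = R(3 := length es, 17 := 2 * length es, 4 := L, 16 := n, 8 := L + n, 5 := N, 15 := 1, 18 := Suc N, 6 := 1)"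
    have "run w (init_block h) R M = (R', M)"
      by (simp add: init_block_def M01 w2 w0 tb tN del: mult_Suc mult_Suc_right)
        (auto simp: R'_def fun_eq_iff tb)
    moreover have "M x = 0" if "L \<le> x" for x using that by (simp add: M L_def)
    ultimately show "case_prod (J 0) (run w (init_block h) R M)"
      using R Mj by (simp add: J_def G_def R'_def)
  qed (simp add: init_block_def)
  have 2: "triple w (J 0) (Loop 2 17 1 (Block label_block)) (4 + 2 * length es * (5 + length label_block)) (K 0)"
  proof (rule triple_Loop[where I = J])
    fix j assume j: "j < 2 * length es"
    show "triple w (\<lambda>R M. J j R M \<and> R 2 = j \<and> R 17 = 2 * length es) (Block label_block) (length label_block)
       (\<lambda>R M. J (Suc j) R M \<and> R 2 = j \<and> R 17 = 2 * length es)"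
    proof (rule triple_Block)
      fix R M assume A: "J j R M \<and> R 2 = j \<and> R 17 = 2 * length es"
      define u where "u = endpoint es j"
      have u: "u < n" unfolding u_def by (rule endpoint_less[OF j])
      have M: "M (2 + j) = u" using A j by (simp add: J_def G_def u_def)
      have tb: "take_bit w (Suc (Suc j)) = Suc (Suc j)" "take_bit w (u + L) = L + u"
        using j u less(4) by (simp_all add: take_bit_nat_eq_self L_def)
      have R: "R 4 = L" "R 2 = j" using A by (auto simp: J_def G_def)
      define R' where "R' = R(15 := L + u)"
      define M' where "M' = M(L + u := j)"
      have M2: "M (Suc (Suc j)) = u" using M by simp
      have "run w label_block R M = (R', M')"
        by (simp add: label_block_def R w2 w0 tb M2) (auto simp: R'_def M'_def fun_eq_iff)
      moreover have "G R' M'"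
        using A u by (auto simp: J_def G_def R'_def M'_def L_def)
      moreover have "M' (L + y) = label (endpoint es) (Suc j) y" if "y < n" for y
        using A that by (simp add: J_def M'_def u_def)
      ultimately show "case run w label_block R M of (R, M) \<Rightarrow> J (Suc j) R M \<and> R 2 = j \<and> R 17 = 2 * length es"
        using A by (simp add: J_def R'_def)
    qed (simp add: label_block_def)
  qed (use w0 less in \<open>auto simp: J_def G_def K_def\<close>)
  \<comment> \<open>The bit length is exactly the exponent at which doubling stops.\<close>
  have bound: "N + 1 < 2 ^ k \<longleftrightarrow> fl \<le> k" for k
    unfolding fl by (simp add: floorlog_le_iff)
  have 3: "triple w (K 0) (Loop 2 18 1 (Block double_block)) (4 + (N + 1) * (5 + length double_block)) (K (N + 1))"
  proof (rule triple_Loop[where I = K])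
    fix j assume j: "j < N + 1"
    show "triple w (\<lambda>R M. K j R M \<and> R 2 = j \<and> R 18 = N + 1) (Block double_block) (length double_block)
       (\<lambda>R M. K (Suc j) R M \<and> R 2 = j \<and> R 18 = N + 1)"
    proof (rule triple_Block)
      fix R M assume A: "K j R M \<and> R 2 = j \<and> R 18 = N + 1"
      define p where "p = (2::nat) ^ min j fl"
      define q where "q = (2::nat) ^ min (Suc j) fl"
      have R: "R 18 = Suc N" "R 6 = p" using A by (auto simp: K_def p_def)
      have pw: "p < 2 ^ w" "q < 2 ^ w"
        using less(1) by (auto simp: p_def q_def intro!: power_strict_increasing)
      have pq: "if Suc N < p then q = p else q = p + p"
      proof (cases "Suc N < p")
        case True
        then have "fl \<le> j" using bound[of "min j fl"] by (simp add: p_def)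
        then show ?thesis using True by (simp add: p_def q_def min_absorb2)
      next
        case False
        then have "j < fl" using bound[of "min j fl"] by (simp add: p_def not_le)
        then show ?thesis using False by (simp add: p_def q_def min_absorb1 mult_2)
      qed
      define R' where "R' = R(15 := (if Suc N < p then 0 else p), 16 := 0, 6 := q)"
      have "run w double_block R M = (R', M)"
        using pq pw by (simp add: double_block_def R w0 take_bit_nat_eq_self split: if_splits)
          (auto simp: R'_def fun_eq_iff)
      then show "case run w double_block R M of (R, M) \<Rightarrow> K (Suc j) R M \<and> R 2 = j \<and> R 18 = N + 1"
        using A by (simp add: K_def G_def R'_def q_def)
    qed (simp add: double_block_def)
  qed (use w0 less in \<open>auto simp: K_def G_def\<close>)
  have 4: "triple w (K (N + 1)) (Block (mask_block c)) (length (mask_block c)) (ready (2 * length es + 2 + n) 0)"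
  proof (rule triple_Block)
    fix R M assume A: "K (N + 1) R M"
    \<comment> \<open>\<open>N + 1\<close> rounds of doubling are enough because
      \<open>N + 1 < 2 ^ (N + 1)\<close>.\<close>
    have "fl \<le> N + 1" using bound[of "N + 1"] less_exp[of "N + 1"] by blast
    then have R6: "R 6 = 2 ^ fl" using A by (simp add: K_def min_absorb2)
    have vw2: "(2::nat) ^ v < 2 ^ w" using less(2) by (intro power_strict_increasing) auto
    have pv: "((2::nat) ^ fl) ^ c = 2 ^ v" by (simp add: v mult.commute flip: power_mult)
    have "run w (replicate c (Bin Mul 7 7 6)) (R(7 := 1)) M = (R(7 := 2 ^ v), M)"
    proof -
      have "Suc 0 < 2 ^ w" using less_exp[of w] w2 by linarith
      then show ?thesis
        using run_power[of "R(7 := 1)" 7 w 6 c M] R6 pv vw2 by (simp add: take_bit_nat_eq_self)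
    qed
    moreover have "take_bit w (2 ^ v + 2 ^ w - Suc 0) = 2 ^ v - (1::nat)"
    proof -
      have eq: "(2::nat) ^ v + 2 ^ w - Suc 0 = (2 ^ v - 1) + 2 ^ w" by simp
      have "(2::nat) ^ v - 1 < 2 ^ w" using vw2 by linarith
      then show ?thesis unfolding eq take_bit_eq_mod mod_add_self2 by (rule mod_less)
    qed
    moreover have "take_bit w ((2::nat) ^ v) = 2 ^ v" using vw2 by (simp add: take_bit_nat_eq_self)
    ultimately have "run w (mask_block c) R M = (R(7 := 2 ^ v - 1, 15 := 1, 6 := 2 ^ v), M)"
      using w0 by (simp add: mask_block_def run_append del: take_bit_of_exp) (auto simp: fun_eq_iff)
    moreover have "M (L + endpoint es j) = edge_label es (endpoint es j)" if "j < 2 * length es" for j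
      using A endpoint_less[OF that] by (simp add: K_def)
    ultimately show "case_prod (ready (2 * length es + 2 + n) 0) (run w (mask_block c) R M)"
      using A by (simp add: K_def G_def ready_def base_ok_def L_def)
  qed (simp add: mask_block_def list_all_iff)
  show ?thesis
    unfolding init_code_def
    by (rule triple_conseq[OF triple_Seq[OF 1 triple_Seq[OF 2 triple_Seq[OF 3 4]]]])
      (auto simp: init_block_def label_block_def double_block_def mask_block_def)
qed

end

section \<open>Word size of the reduction and assembly of the triangle algorithm\<close>

lemma reduction_fits:
  fixes c h k m n N R fl v w :: nat
  assumes N: "N = h * (2 * m + 1)" and fl: "fl = floorlog 2 (N + 1)" and v: "v = c * fl"
    and w: "w = word_size (2 * k + (h + 5) * c + (h + 4) * h + h + 13) n"
    and mn: "m \<le> n * n" and h: "0 < h" and R: "R = 2 ^ k"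
  shows "2 \<le> w" "fl < w" "v < w" "N + 1 < 2 ^ w" "N ^ h < 2 ^ w"
    "2 * m + 2 + n + R * (2 + 4 * k * m + 2 ^ v) < 2 ^ w"
proof -
  \<comment> \<open>Everything is compared with powers of \<open>X = n + 2\<close>. In the exponent
    \<open>c'\<close>, the summand \<open>2 * k\<close> pays for the \<open>2 ^ k\<close> calls and
    for the factor \<open>k\<close> in the input lengths, \<open>(h + 5) * c\<close> for the
    simulated memory \<open>2 ^ v\<close>, and \<open>(h + 4) * h\<close> for counts up to
    \<open>N ^ h\<close>; the rest covers \<open>N + 1\<close>, the input of the host and the
    additions.\<close>
  define q where "q = k + 4 + (h + 5) * c"
  define c' where "c' = 2 * k + (h + 5) * c + (h + 4) * h + h + 13"
  have N0: "0 < N" using h by (simp add: N)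
  define X where "X = n + 2"
  have X: "2 \<le> X" "1 \<le> X" by (auto simp: X_def)
  have Xw: "X ^ i < 2 ^ w" if "i < c'" for i
  proof -
    have "X ^ i < X ^ c'" using X that by (intro power_strict_increasing) auto
    also have "\<dots> \<le> 2 ^ w" unfolding w X_def c'_def by (rule power_le_word)
    finally show ?thesis .
  qed
  have X2: "2 * z \<le> X ^ Suc i" if "z \<le> X ^ i" for z i
    using mult_le_mono[OF X(1) that] by simp
  have Xmono: "X ^ i \<le> X ^ j" if "i \<le> j" for i j
    using X that by (intro power_increasing) auto
  have kX: "z \<le> X ^ z" for z :: nat
  proof -
    have "z \<le> 2 ^ z" using less_exp[of z] by simp
    also have "\<dots> \<le> X ^ z" using X by (intro power_mono) auto
    finally show ?thesis .
  qed
  have "2 * m + 1 \<le> X ^ 3"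
    using mn by (simp add: X_def power3_eq_cube algebra_simps)
  then have "N \<le> X ^ h * X ^ 3" unfolding N using kX[of h] by (intro mult_le_mono)
  then have NX: "N \<le> X ^ (h + 3)" by (simp add: power_add)
  have "N + 1 \<le> 2 * N" using N0 by simp
  also have "\<dots> \<le> X ^ (h + 4)" using X2[OF NX] by (simp add: eval_nat_numeral)
  finally have N1: "N + 1 \<le> X ^ (h + 4)" .
  have fl0: "0 < fl" unfolding fl using N0 floorlog_eq_zero_iff[of 2 "N + 1"] by simp
  have "2 ^ (fl - 1) \<le> N + 1"
    using floorlog_bounds[of "N + 1" 2] by (simp add: fl)
  then have "2 * 2 ^ (fl - 1) \<le> X ^ Suc (h + 4)" using N1 by (intro X2) simp
  then have flX: "2 ^ fl \<le> X ^ (h + 5)" using fl0 by (simp add: power_eq_if)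
  have "(2 ^ fl) ^ c \<le> (X ^ (h + 5)) ^ c" using flX by (intro power_mono) auto
  then have vX: "2 ^ v \<le> X ^ ((h + 5) * c)" by (simp add: v mult.commute flip: power_mult)
  have "(2::nat) ^ fl < 2 ^ w" by (rule le_less_trans[OF flX Xw]) (simp add: c'_def)
  then show "fl < w" by simp
  have "(2::nat) ^ v < 2 ^ w" by (rule le_less_trans[OF vX Xw]) (simp add: c'_def q_def)
  then show "v < w" by simp
  show "N + 1 < 2 ^ w" by (rule le_less_trans[OF N1 Xw]) (simp add: c'_def)
  have base: "2 * m + 2 + n \<le> X ^ 3"
    using mn by (simp add: X_def power3_eq_cube algebra_simps)
  have RX: "R \<le> X ^ k"
    using X(1) unfolding R by (intro power_mono) auto
  have "4 * k * m + 2 \<le> X ^ k * X ^ 4"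
  proof -
    have "4 * m + 2 \<le> X ^ 4"
    proof -
      have "4 * m + 2 \<le> 4 * (n * n) + 2" using mn by simp
      also have "\<dots> \<le> X ^ 4" by (simp add: X_def eval_nat_numeral algebra_simps)
      finally show ?thesis .
    qed
    have "4 * k * m + 2 \<le> X ^ k * (4 * m + 2)"
    proof -
      have "4 * k * m \<le> X ^ k * (4 * m)" using mult_le_mono1[OF kX[of k], of "4 * m"] by (simp add: ac_simps)
      moreover have "1 \<le> X ^ k" using X by simp
      ultimately show ?thesis unfolding distrib_left by linarith
    qed
    also have "\<dots> \<le> X ^ k * X ^ 4" using \<open>4 * m + 2 \<le> X ^ 4\<close> by (rule mult_le_mono2)
    finally show ?thesis .
  qed
  also have "\<dots> = X ^ (k + 4)" by (rule power_add[symmetric])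
  also have "\<dots> \<le> X ^ q" by (rule Xmono) (simp add: q_def)
  finally have 1: "2 + 4 * k * m \<le> X ^ q" by (simp only: add.commute)
  have 2: "2 ^ v \<le> X ^ q" by (rule order_trans[OF vX Xmono]) (simp add: q_def)
  have "2 + 4 * k * m + 2 ^ v \<le> X ^ Suc q" using 1 2 X2[of "X ^ q" q] by linarith
  then have "R * (2 + 4 * k * m + 2 ^ v) \<le> X ^ k * X ^ Suc q" using RX by (intro mult_le_mono)
  also have "\<dots> = X ^ (k + Suc q)" by (rule power_add[symmetric])
  finally have 3: "R * (2 + 4 * k * m + 2 ^ v) \<le> X ^ (k + q + 1)" by simp
  have 4: "2 * m + 2 + n \<le> X ^ (k + q + 1)" by (rule order_trans[OF base Xmono]) (simp add: q_def)
  have "2 * m + 2 + n + R * (2 + 4 * k * m + 2 ^ v) \<le> X ^ Suc (k + q + 1)"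
    using 3 4 X2[of "X ^ (k + q + 1)" "k + q + 1"] by linarith
  also have "\<dots> < 2 ^ w" by (rule Xw) (simp add: c'_def q_def)
  finally show fits: "2 * m + 2 + n + R * (2 + 4 * k * m + 2 ^ v) < 2 ^ w" .
  have "(2::nat) ^ 2 \<le> X ^ 2" using X by (intro power_mono) auto
  also have "\<dots> < 2 ^ w" by (rule Xw) (simp add: c'_def)
  finally have "2 < w" by (rule power_less_imp_less_exp[rotated]) simp
  then show "2 \<le> w" by simp
  have "N ^ h \<le> (X ^ (h + 4)) ^ h" using N1 by (intro power_mono) auto
  also have "\<dots> < 2 ^ w" unfolding power_mult[symmetric] by (rule Xw) (simp add: c'_def)
  finally show "N ^ h < 2 ^ w" .
qed

text \<open>There is one call for each subset of the edges of H, hence a constant number, on gadgets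
  with \<open>O(m + 1)\<close> vertices and edges. Simulation at most doubles the expected time of a
  call.\<close>

lemma triangle_algorithm:
  fixes V :: "'a set"
  assumes H: "simple_graph V E" and cyc: "is_cycle E vs"
    and comp: "computes c P (\<lambda>n F. hom_count V E {..<n} F)" and lin: "linear_time c P"
  shows "\<exists>c' P' K. computes c' P' (\<lambda>n F. of_bool (triangle_free F)) \<and>
    (\<forall>n es F. encodes n es F \<longrightarrow> expected_time c' P' n es \<le> of_nat (K * (card F + 1)))"
proof -
  have finV: "finite V" and EV: "E \<subseteq> Pow V" and card2: "\<forall>e\<in>E. card e = 2"
    using H by (auto simp: simple_graph_def)
  have finE: "finite E" using finV EV by (meson finite_Pow_iff finite_subset)
  define a b where "a = vs ! 0" and "b = vs ! 1"
  have "{a, b} \<in> E" "a \<noteq> b"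
  proof -
    have l: "3 \<le> length vs" "distinct vs"
      and e: "\<And>i. i < length vs \<Longrightarrow> {vs ! i, vs ! (Suc i mod length vs)} \<in> E"
      using cyc by (auto simp: is_cycle_def)
    have "{vs ! 0, vs ! (Suc 0 mod length vs)} \<in> E"
      by (rule e) (use l in linarith)
    moreover have "0 < length vs" "1 < length vs" using l by linarith+
    ultimately show "{a, b} \<in> E" "a \<noteq> b"
      using l(2) by (simp_all add: a_def b_def nth_eq_iff_index_eq)
  qed
  define h where "h = card V"
  obtain idx where "bij_betw idx V {0..<h}"
    using ex_bij_betw_finite_nat[OF finV] by (auto simp: h_def)
  then have idx: "bij_betw idx V {..<h}" by (simp add: lessThan_atLeast0)
  then have idx_less: "\<And>i. i \<in> V \<Longrightarrow> idx i < h" by (auto simp: bij_betw_def)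
  have h: "0 < h" using idx_less[of a] \<open>{a, b} \<in> E\<close> EV by auto
  obtain el where el: "set el = E" "distinct el" using finite_distinct_list[OF finE] by blast
  have "\<exists>p. mk_edge p = e" if "e \<in> E" for e
  proof -
    have "card e = 2" using card2 that by blast
    then obtain i j where "e = {i, j}" by (auto simp: card_2_iff)
    then show ?thesis by (intro exI[of _ "(i, j)"]) simp
  qed
  then obtain pr where pr: "\<And>e. e \<in> E \<Longrightarrow> mk_edge (pr e) = e" by metis
  define hs where "hs = map pr el"
  have "map mk_edge hs = map id el" unfolding hs_def map_map by (intro map_cong refl) (auto simp: el pr)
  then have hs: "distinct (map mk_edge hs)" "mk_edge ` set hs = E"
    using el by (simp_all, metis el(1) list.set_map)
  then have dhs: "distinct hs" "inj_on mk_edge (set hs)" by (simp_all add: distinct_map)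
  define k where "k = length hs"
  have cardE: "card E = k" using hs(2) dhs by (metis card_image distinct_card k_def)
  define Ss where "Ss = List.subseqs hs"
  define neg where "neg S \<longleftrightarrow> odd (k - length S)" for S :: "('a \<times> 'a) list"
  have sub: "set S \<subseteq> set hs" "distinct (map mk_edge S)" "mk_edge ` set S \<subseteq> E" "length S \<le> k"
    "length S = card (mk_edge ` set S)" "\<forall>ij\<in>set S. fst ij \<in> V \<and> snd ij \<in> V" if "S \<in> set Ss" for S
  proof -
    have "set S \<in> Pow (set hs)" using that subseqs_powset[of hs] unfolding Ss_def by blast
    then show *: "set S \<subseteq> set hs" by simp
    have d: "distinct S" using that dhs subseqs_distinctD unfolding Ss_def by blast
    have inj: "inj_on mk_edge (set S)" using dhs(2) * by (rule inj_on_subset)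
    then show "distinct (map mk_edge S)" using d by (simp add: distinct_map)
    show **: "mk_edge ` set S \<subseteq> E" using * hs(2) by blast
    show "length S = card (mk_edge ` set S)" using inj d by (simp add: card_image distinct_card)
    have "card (set S) \<le> card (set hs)" using * by (intro card_mono) auto
    then show "length S \<le> k" using d dhs(1) by (simp add: distinct_card k_def)
    show "\<forall>ij\<in>set S. fst ij \<in> V \<and> snd ij \<in> V" using ** EV by blast
  qed
  have bij: "bij_betw (\<lambda>S. mk_edge ` set S) (set Ss) (Pow E)"
  proof -
    have "bij_betw set (set Ss) (Pow (set hs))"
      unfolding bij_betw_def Ss_def using subseqs_powset[of hs] distinct_set_subseqs[OF dhs(1)]
      by (simp add: distinct_map)
    moreover have "bij_betw (image mk_edge) (Pow (set hs)) (Pow E)"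
      using dhs(2) hs(2) by (intro bij_betw_Pow) (simp add: bij_betw_def)
    ultimately show ?thesis using bij_betw_trans by (fastforce simp: o_def)
  qed
  have dSs: "distinct Ss" using distinct_set_subseqs[OF dhs(1)] by (simp add: Ss_def distinct_map)
  \<comment> \<open>All registers of \<open>P\<close> lie below \<open>nr\<close>; shifted by 20
    they avoid the registers of the host, and they are cleared before each call.\<close>
  define nr where "nr = Suc (Max (insert 0 (\<Union>I\<in>set P. instr_regs I)))"
  have nr: "\<forall>I\<in>set P. \<forall>r\<in>instr_regs I. r < nr" "0 < nr"
    by (auto simp: nr_def less_Suc_eq_le intro!: Max_ge)
  obtain C where C: "\<And>n es F. encodes n es F \<Longrightarrow> n > 0 \<Longrightarrow> expected_time c P n es \<le> ennreal (C * real (n + card F))"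
    using lin unfolding linear_time_def by blast
  \<comment> \<open>The constant in \<open>linear_time\<close> is an arbitrary real, possibly
    negative, and is rounded up to a natural number.\<close>
  define Cn where "Cn = nat \<lceil>C\<rceil>"
  have Cn: "C \<le> real Cn" unfolding Cn_def by linarith
  define D where "D = Cn * (2 * h + 2 * k)"
  define R where "R = length Ss"
  have R: "R = 2 ^ k" by (simp add: R_def Ss_def length_subseqs k_def)
  define K where "K = 60 + 20 * h + c + R * (35 + 32 * k + nr + 2 * D)"
  define c' where "c' = 2 * k + (h + 5) * c + (h + 4) * h + h + 13"
  define prog where "prog = init_code h c ;; calls_code idx h {a, b} P nr neg Ss"
  have main: "ERT w (compile 0 prog) (penalty (of_bool (triangle_free F))) (init_core w n es) \<le>
      of_nat (K * (card F + 1))"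
    if enc: "encodes n es F" and w: "w = word_size c' n" for n es F w
  proof -
    define m where "m = length es"
    have mF: "card F = m" using encodes_length[OF enc] by (simp add: m_def)
    define N where "N = h * (2 * m + 1)"
    define fl where "fl = floorlog 2 (N + 1)"
    define v where "v = c * fl"
    have vN: "v = word_size c N" by (simp add: v_def fl_def word_size_def)
    have N0: "0 < N" using h by (simp add: N_def)
    have mn: "m \<le> n * n" using encodes_length_le[OF enc] by (simp add: m_def)
    note fits = reduction_fits[OF N_def fl_def v_def w[unfolded c'_def] mn h R]
    have vw: "v \<le> w" and base_w: "2 * m + 2 + n < 2 ^ w" and Nw: "N < 2 ^ w"
      using fits(3,4,6) by linarith+
    \<comment> \<open>Every count fits into a host word; this bounds the summands and, through
      \<open>cnt\<close>, the final total.\<close>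
    have homX: "hom_count V E {..<N} F' < 2 ^ w" for F'
    proof -
      have "hom_count V E {..<N} F' \<le> N ^ h" unfolding h_def by (rule hom_count_le[OF finV])
      also note fits(5)
      finally show ?thesis .
    qed
    let ?G = "gadget idx h a b F m (edge_label es)"
    note gf = H idx edges_card[OF enc] label_inj[OF enc] label_bound[OF enc]
    define out where "out S = hom_count V E {..<N} (?G (mk_edge ` set S))" for S
    define B where "B = 2 * D * (m + 1)"
    have N2: "N \<le> 2 * h * (m + 1)" by (simp add: N_def)
    have cost: "2 * ERT v P (penalty (out S)) (init_core v N (gedges idx h {a, b} es S)) \<le> of_nat B"
      if S: "S \<in> set Ss" for S
    proof -
      have encS: "encodes N (gedges idx h {a, b} es S) (?G (mk_edge ` set S))"
        unfolding N_def m_def by (rule encodes_gedges[OF enc H idx sub(2)[OF S] sub(3)[OF S]])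
      have cardG: "card (?G (mk_edge ` set S)) \<le> 2 * k * m"
      proof -
        have "card (?G (mk_edge ` set S)) = 2 * m * length S"
          using encodes_length[OF encS] by (simp add: length_gedges m_def)
        also have "\<dots> \<le> 2 * m * k" using sub(4)[OF S] by (rule mult_le_mono2)
        finally show ?thesis by (simp add: ac_simps)
      qed
      have le: "N + card (?G (mk_edge ` set S)) \<le> (2 * h + 2 * k) * (m + 1)"
        using N2 cardG by (simp add: algebra_simps)
      \<comment> \<open>The call runs at the very word size \<open>v\<close> that the algorithm uses
        on the gadget, so its correctness and its expected time carry over to
        \<open>ERT\<close>.\<close>
      have "ERT v P (penalty (out S)) (init_core v N (gedges idx h {a, b} es S)) =
          expected_time c P N (gedges idx h {a, b} es S)"
        unfolding out_def by (rule ERT_eq_expected_time[OF comp encS vN])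
      also have "\<dots> \<le> ennreal (C * real (N + card (?G (mk_edge ` set S))))"
        by (rule C[OF encS N0])
      also have "\<dots> \<le> ennreal (real (D * (m + 1)))"
      proof (rule ennreal_leI)
        have "C * real (N + card (?G (mk_edge ` set S))) \<le> real Cn * real ((2 * h + 2 * k) * (m + 1))"
        proof -
          have "C * real (N + card (?G (mk_edge ` set S))) \<le> real Cn * real (N + card (?G (mk_edge ` set S)))"
            using Cn by (intro mult_right_mono) auto
          also have "\<dots> \<le> real Cn * real ((2 * h + 2 * k) * (m + 1))"
            using le by (intro mult_left_mono of_nat_mono) auto
          finally show ?thesis .
        qed
        also have "\<dots> = real (D * (m + 1))" by (simp only: D_def of_nat_mult mult.assoc)
        finally show "C * real (N + card (?G (mk_edge ` set S))) \<le> real (D * (m + 1))" .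
      qed
      also have "\<dots> = of_nat (D * (m + 1))" by (rule ennreal_of_nat_eq_real_of_nat[symmetric])
      finally have "2 * ERT v P (penalty (out S)) (init_core v N (gedges idx h {a, b} es S)) \<le> 2 * of_nat (D * (m + 1))"
        by (intro mult_left_mono) auto
      also have "\<dots> = of_nat B" by (simp only: B_def of_nat_mult of_nat_numeral mult.assoc)
      finally show ?thesis .
    qed
    obtain cnt where cnt: "(\<Sum>T\<in>Pow E. (- 1) ^ (card E - card T) * int (hom_count V E {..<N} (?G T))) = int cnt"
      "cnt = 0 \<longleftrightarrow> triangle_free F" "cnt \<le> hom_count V E {..<N} (?G E)"
      using gadget_sum_detects_triangles[OF gf cyc a_def b_def] unfolding N_def m_def by blast
    have total: "signed_sum neg out Ss = int cnt"
    proof -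
      have "signed_sum neg out Ss = (\<Sum>S\<in>set Ss. (if neg S then - 1 else 1) * int (out S))"
        unfolding signed_sum_def by (rule sum_list_distinct_conv_sum_set[OF dSs])
      also have "\<dots> = (\<Sum>S\<in>set Ss. (- 1) ^ (card E - card (mk_edge ` set S)) *
          int (hom_count V E {..<N} (?G (mk_edge ` set S))))"
        by (rule sum.cong) (auto simp: neg_def out_def cardE sub(5)[symmetric])
      also have "\<dots> = (\<Sum>T\<in>Pow E. (- 1) ^ (card E - card T) * int (hom_count V E {..<N} (?G T)))"
        by (rule sum.reindex_bij_betw[OF bij])
      also have "\<dots> = int cnt"
        by (rule cnt(1))
      finally show ?thesis .
    qed
    have cnt_less: "cnt < 2 ^ w" using cnt(3) homX by (rule le_less_trans)
    have Nes: "N = h * (2 * length es + 1)" by (simp add: N_def m_def)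
    have Ss_ok: "\<forall>S\<in>set Ss. (\<forall>ij\<in>set S. fst ij \<in> V \<and> snd ij \<in> V) \<and> length S \<le> k \<and> out S < 2 ^ w \<and>
        2 * ERT v P (penalty (out S)) (init_core v N (gedges idx h {a, b} es S)) \<le> of_nat B"
    proof (rule ballI)
      fix S assume S: "S \<in> set Ss"
      show "(\<forall>ij\<in>set S. fst ij \<in> V \<and> snd ij \<in> V) \<and> length S \<le> k \<and> out S < 2 ^ w \<and>
        2 * ERT v P (penalty (out S)) (init_core v N (gedges idx h {a, b} es S)) \<le> of_nat B"
        unfolding out_def
        by (intro conjI sub(6)[OF S] sub(4)[OF S] homX cost[OF S, unfolded out_def])
    qed
    have init: "triple w (\<lambda>R M. (0, R, M) = init_core w n es) (init_code h c)
        (38 + 20 * length es + 10 * N + c) (ready v N es (2 * length es + 2 + n) (nat (0 mod 2 ^ w)))"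
      using triple_init[OF enc idx_less Nes Nw vw fits(1) v_def fl_def fits(2-4) base_w[unfolded m_def]]
      by simp
    have fits': "2 * length es + 2 + n + length Ss * (2 + 4 * k * length es + 2 ^ v) < 2 ^ w"
      using fits(6) by (simp add: m_def R_def)
    note calls = triple_calls[OF enc idx_less Nes Nw vw fits(1) nr Ss_ok order_refl fits',
        of 0 neg]
    have "triple w (\<lambda>R M. (0, R, M) = init_core w n es) prog
       (38 + 20 * length es + 10 * N + c + (2 + length Ss * (18 + length es * (17 + 32 * k) + nr + B)))
       (\<lambda>R M. R 0 = of_bool ((0 + signed_sum neg out Ss) mod 2 ^ w = 0))"
      unfolding prog_def by (rule triple_Seq[OF init calls])
    then have "triple w (\<lambda>R M. (0, R, M) = init_core w n es) prog (K * (card F + 1))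
       (\<lambda>R M. R 0 = of_bool (triangle_free F))"
    proof (rule triple_conseq)
      have "18 + m * (17 + 32 * k) + nr + B \<le> (35 + 32 * k + nr + 2 * D) * (m + 1)"
        by (simp add: B_def algebra_simps)
      then have "R * (18 + m * (17 + 32 * k) + nr + B) \<le> R * ((35 + 32 * k + nr + 2 * D) * (m + 1))"
        by (rule mult_le_mono2)
      moreover have "38 + 20 * m + 10 * N + c + 2 \<le> (60 + 20 * h + c) * (m + 1)"
        using N2 by (simp add: algebra_simps)
      moreover have "K * (m + 1) = (60 + 20 * h + c) * (m + 1) + R * ((35 + 32 * k + nr + 2 * D) * (m + 1))"
        unfolding K_def by (simp only: distrib_right mult.assoc)
      ultimately show "38 + 20 * length es + 10 * N + c + (2 + length Ss * (18 + length es * (17 + 32 * k) + nr + B))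
          \<le> K * (card F + 1)"
        unfolding mF m_def[symmetric] R_def[symmetric] by linarith
      fix R :: "nat \<Rightarrow> nat"
      have "int cnt mod 2 ^ w = int cnt" using cnt_less by (intro mod_pos_pos_trivial) auto
      then show "R 0 = of_bool (triangle_free F)"
        if "R 0 = of_bool ((0 + signed_sum neg out Ss) mod 2 ^ w = 0)"
        using that unfolding total by (simp add: cnt(2))
    qed
    then show ?thesis
      by (rule triple_program) (simp add: init_core_def)
  qed
  have "computes c' (compile 0 prog) (\<lambda>n F. of_bool (triangle_free F))"
    unfolding computes_def Let_def init_config_eq
    by (intro allI impI AE_halts_with_if_ERT_finite le_less_trans[OF main[OF _ refl] of_nat_less_top])
  moreover have "expected_time c' (compile 0 prog) n es \<le> of_nat (K * (card F + 1))"
    if "encodes n es F" for n es F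
    using expected_time_le_ERT[OF refl] main[OF that refl] by (rule order_trans)
  ultimately show ?thesis by blast
qed

section \<open>Superlinear growth and the contradiction with the conjecture\<close>

lemma superlinear_not_eventually_le:
  fixes C K \<gamma> :: real
  assumes "C > 0" "\<gamma> > 0" "K \<ge> 0"
  shows "\<not> (\<forall>\<^sub>F m in sequentially. C * real m powr (1 + \<gamma>) \<le> K * (real m + 1))"
proof
  assume ev: "\<forall>\<^sub>F m in sequentially. C * real m powr (1 + \<gamma>) \<le> K * (real m + 1)"
  \<comment> \<open>Once \<open>m\<close> exceeds \<open>A powr (1 / \<gamma>)\<close>, the factor
    \<open>C * m powr \<gamma>\<close> exceeds \<open>2 * K\<close>, while
    \<open>K * (m + 1)\<close> is at most \<open>2 * K * m\<close>. The summand 1 keeps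
    \<open>A\<close> positive also for \<open>K = 0\<close>.\<close>
  define A where "A = 2 * K / C + 1"
  have A: "0 < A" "2 * K / C < A" using assms by (simp_all add: A_def add_nonneg_pos)
  have "\<forall>\<^sub>F m in sequentially. A powr (1 / \<gamma>) < real m"
    using filterlim_real_sequentially unfolding filterlim_at_top_dense by blast
  then have "\<forall>\<^sub>F m in sequentially. 2 * K / C < real m powr \<gamma>"
  proof eventually_elim
    case (elim m)
    then have "(A powr (1 / \<gamma>)) powr \<gamma> < real m powr \<gamma>"
      using assms(2) by (intro powr_less_mono2) auto
    then show ?case using A assms(2) by (simp add: powr_powr)
  qed
  with ev eventually_gt_at_top[of 0] have "\<forall>\<^sub>F m in sequentially. False"
  proof eventually_elim
    case (elim m)
    have "2 * K < C * real m powr \<gamma>" using elim(3) assms(1) by (simp add: divide_less_eq mult.commute)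
    then have "2 * K * real m < C * real m powr \<gamma> * real m"
      using elim(2) by (intro mult_strict_right_mono) auto
    also have "\<dots> = C * real m powr (1 + \<gamma>)"
      using elim(2) by (simp add: powr_add mult_ac)
    also have "\<dots> \<le> K * (real m + 1)" by (rule elim(1))
    also have "\<dots> \<le> K * (2 * real m)" using elim(2) assms(3) by (intro mult_left_mono) auto
    finally show False by simp
  qed
  then show False by simp
qed

theorem theorem1p14:
  fixes V :: "'a set" and E :: "'a set set"
  assumes "triangle_detection_conjecture"
    and "simple_graph V E"
  shows "(\<exists>c P. computes c P (\<lambda>n F. hom_count V E {..<n} F) \<and> linear_time c P) \<longleftrightarrow> forest V E"
proof
  assume "forest V E"
  then show "\<exists>c P. computes c P (\<lambda>n F. hom_count V E {..<n} F) \<and> linear_time c P"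
    by (rule linear_time_if_forest)
next
  assume "\<exists>c P. computes c P (\<lambda>n F. hom_count V E {..<n} F) \<and> linear_time c P"
  then obtain c P where P: "computes c P (\<lambda>n F. hom_count V E {..<n} F)" "linear_time c P"
    by blast
  show "forest V E"
  proof (rule ccontr)
    assume "\<not> forest V E"
    then obtain vs where vs: "is_cycle E vs"
      using assms(2) by (auto simp: forest_def)
    obtain c' P' K where tri: "computes c' P' (\<lambda>n F. of_bool (triangle_free F))"
      and time: "\<And>n es F. encodes n es F \<Longrightarrow> expected_time c' P' n es \<le> of_nat (K * (card F + 1))"
      using triangle_algorithm[OF assms(2) vs P] by blast
    obtain \<gamma> C :: real where \<gamma>: "\<gamma> > 0" "C > 0"
      and ev: "\<forall>\<^sub>F m in sequentially. ennreal (C * real m powr (1 + \<gamma>)) \<le> worst_case_time c' P' m"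
      using assms(1) tri unfolding triangle_detection_conjecture_def by blast
    \<comment> \<open>The bound does not depend on the number of vertices, so it survives the
      supremum over all graphs with \<open>m\<close> edges.\<close>
    have "worst_case_time c' P' m \<le> ennreal (real K * (real m + 1))" for m
      unfolding worst_case_time_def
    proof (rule SUP_least, clarify)
      fix n es F assume "encodes n es F" "m = card F"
      then have "expected_time c' P' n es \<le> of_nat (K * (m + 1))" using time by simp
      also have "\<dots> = ennreal (real K * (real m + 1))"
        by (simp add: ennreal_of_nat_eq_real_of_nat algebra_simps)
      finally show "expected_time c' P' n es \<le> ennreal (real K * (real (card F) + 1))"
        by (simp add: \<open>m = card F\<close>)
    qed
    then have "ennreal (C * real m powr (1 + \<gamma>)) \<le> ennreal (real K * (real m + 1))"
      if "ennreal (C * real m powr (1 + \<gamma>)) \<le> worst_case_time c' P' m" for m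
      using that order_trans by blast
    with ev have "\<forall>\<^sub>F m in sequentially. ennreal (C * real m powr (1 + \<gamma>)) \<le> ennreal (real K * (real m + 1))"
      by (rule eventually_mono) blast
    then have "\<forall>\<^sub>F m in sequentially. C * real m powr (1 + \<gamma>) \<le> real K * (real m + 1)"
      by (rule eventually_mono) (simp add: ennreal_le_iff)
    with superlinear_not_eventually_le[OF \<gamma>(2,1), of "real K"] show False by simp
  qed
qed

end
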